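(* Let $\mathbb K$ be a field of characteristic zero and let $\mathfrak m_2$ be the $\mathbb N$-graded Lie algebra over $\mathbb K$ with basis $e_1,e_2,\dots$ and nontrivial brackets $[e_1,e_i]=e_{i+1}$ for all $i\ge2$, $[e_2,e_j]=e_{j+2}$ for all $j\ge3$. The bigraded cohomology algebra $H^*(\mathfrak m_2)=\bigoplus_{q,k}H^q_k(\mathfrak m_2)$ (trivial coefficients) is spanned by the cohomology classes of the following homogeneous cocycles: $$e^1,\quad e^2,\quad e^2\wedge e^3,\quad e^3\wedge e^4-e^2\wedge e^5,$$ $$w_{i_1,\dots,i_q,i_q+1,i_q+2}=\sum_{l\ge0}\frac1{2^l}\,\omega\Big(\big(\mathrm{ad}\,e_2^*+(\mathrm{ad}\,e_1^* )^2\big)^l(e^{i_1}\wedge\dots\wedge e^{i_q})\wedge e^{i_q+1+l}\wedge e^{i_q+2+l}\Big),$$ where $1\le q$, $3\le i_1<i_2<\dots<i_q$; in particular, for $q\ge3$, $$\dim H^q_{k+\frac{q(q+1)}{2}}(\mathfrak m_2)=P_q(k)-P_q(k-1)-P_q(k-2)+P_q(k-3).$$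
   Context: $e^1,e^2,\dots$ are the 1-forms dual to $e_1,e_2,\dots$. The cochain complex of $\mathfrak m_2$ consists of (formal series of) exterior forms in $e^1,e^2,\dots$ with $d(\rho\wedge\eta)=d\rho\wedge\eta+(-1)^{\deg\rho}\rho\wedge d\eta$ and $de^1=de^2=0$, $de^3=e^1\wedge e^2$, $de^4=e^1\wedge e^3$, $de^k=e^1\wedge e^{k-1}+e^2\wedge e^{k-2}$ for $k\ge5$. $\Lambda^q_k$ is the span of the monomials $e^{i_1}\wedge\dots\wedge e^{i_q}$, $i_1<\dots<i_q$, with $i_1+\dots+i_q=k$; $d\Lambda^q_k\subset\Lambda^{q+1}_k$, and $H^q_k(\mathfrak m_2)$ is the degree-$q$ cohomology of $(\Lambda^*_k,d)$. Inside the parentheses, $\mathrm{ad}\,e_1^*$ and $\mathrm{ad}\,e_2^*$ are the degree-0 derivations ($D(\xi\wedge\eta)=D\xi\wedge\eta+\xi\wedge D\eta$) of $\Lambda^*(e^1,e^3,e^4,\dots)$ extending the dual maps of $\mathrm{ad}\,e_1$ and $\mathrm{ad}\,e_2$ on the ideal $\mathfrak b=\mathrm{Span}(e_1,e_3,e_4,\dots)$, up to the sign convention giving: $\mathrm{ad}\,e_1^*(e^1)=\mathrm{ad}\,e_1^*(e^3)=0$, $\mathrm{ad}\,e_1^*(e^i)=e^{i-1}$ for $i\ge4$; $\mathrm{ad}\,e_2^*(e^1)=\mathrm{ad}\,e_2^*(e^4)=0$, $\mathrm{ad}\,e_2^*(e^3)=e^1$, $\mathrm{ad}\,e_2^*(e^i)=e^{i-2}$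 for $i\ge5$. $\omega$ is the linear map defined on monomials whose two largest superscripts are consecutive by $$\omega(e^{j_1}\wedge\dots\wedge e^{j_p}\wedge e^{j_p+1})=\sum_{l\ge0}(-1)^lD_1^l(e^{j_1}\wedge\dots\wedge e^{j_p})\wedge e^{j_p+1+l},\qquad j_1<\dots<j_p,$$ where $D_1$ is the degree-0 derivation with $D_1(e^1)=D_1(e^2)=0$, $D_1(e^i)=e^{i-1}$ for $i\ge3$. All sums are finite. $P_q(N)$ is the number of partitions of $N$ into $q$ parts, i.e. the number of solutions of $N=x_1+\dots+x_q$ in integers $1\le x_1\le\dots\le x_q$.
   Formalization: Corrected: ad e_2^*(e^3)=0 instead of e^1 (otherwise w_{3,4,5} is not closed); the degree shift is k+q(q+3)/2 instead of k+q(q+1)/2 (otherwise dim H^3_9 would be 1, but it is 0); and the unit class 1 spanning H^0 is added to the list. *)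

theory Defs
  imports Complex_Main "HOL-Library.Poly_Mapping" "HOL-Library.Groups_Big_Fun"
begin

section \<open>Exterior forms in the dual basis\<close>

text \<open>
  A (finite) exterior form in the 1-forms \<open>e\<^sup>1, e\<^sup>2, \<dots>\<close> is a finitely supported function on
  index sets: the set \<open>{i\<^sub>1 < \<dots> < i\<^sub>q}\<close> stands for the monomial
  \<open>e\<^sup>i\<^sup>1 \<and> \<dots> \<and> e\<^sup>i\<^sup>q\<close>.  The type also has infinite index sets and sets containing 0;
  they are excluded in \<open>index_sets\<close> below and never enter the complex.
\<close>

type_synonym 'a form = "nat set \<Rightarrow>\<^sub>0 'a"

abbreviation mon :: "nat set \<Rightarrow> 'a::field form"
  where "mon I \<equiv> Poly_Mapping.single I 1"

abbreviation e :: "nat \<Rightarrow> 'a::field form"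
  where "e i \<equiv> mon {i}"

definition fscale :: "'a::field \<Rightarrow> 'a form \<Rightarrow> 'a form"
  where "fscale c x = Poly_Mapping.map ((*) c) x"

lemma lookup_fscale [simp]: "Poly_Mapping.lookup (fscale c x) I = c * Poly_Mapping.lookup x I"
  unfolding fscale_def by transfer (auto simp: when_def)

global_interpretation form: vector_space "fscale :: 'a::field \<Rightarrow> 'a form \<Rightarrow> 'a form"
  by unfold_locales (auto intro!: poly_mapping_eqI simp: lookup_add algebra_simps)

definition lin_ext :: "(nat set \<Rightarrow> 'a::field form) \<Rightarrow> 'a form \<Rightarrow> 'a form"
  where "lin_ext g x = (\<Sum>I\<in>Poly_Mapping.keys x. fscale (Poly_Mapping.lookup x I) (g I))"

text \<open>The sign of \<open>mon I \<and> mon J\<close> is that of the permutation sorting the concatenation.\<close>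

definition mon_wedge :: "nat set \<Rightarrow> nat set \<Rightarrow> 'a::field form"
  where "mon_wedge I J =
    (if I \<inter> J = {} then fscale ((- 1) ^ card {(i, j). i \<in> I \<and> j \<in> J \<and> j < i}) (mon (I \<union> J)) else 0)"

definition wedge :: "'a::field form \<Rightarrow> 'a form \<Rightarrow> 'a form"  (infixl \<open>\<^bold>\<and>\<close> 70)
  where "x \<^bold>\<and> y = lin_ext (\<lambda>I. lin_ext (\<lambda>J. mon_wedge I J) y) x"

text \<open>
  The map \<open>D\<close> that is \<open>f\<close> on generators, vanishes on constants and satisfies
  \<open>D (e\<^sup>i \<and> \<eta>) = D e\<^sup>i \<and> \<eta> + s (e\<^sup>i \<and> D \<eta>)\<close>: a degree-0 derivation for \<open>s = 1\<close> and
  an antiderivation for \<open>s = - 1\<close>.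
\<close>

fun leibniz :: "'a::field \<Rightarrow> (nat \<Rightarrow> 'a form) \<Rightarrow> nat list \<Rightarrow> 'a form"
  where
    "leibniz s f [] = 0"
  | "leibniz s f (i # is) =
       f i \<^bold>\<and> mon (set is) + fscale s (e i \<^bold>\<and> leibniz s f is)"

definition deriv_ext :: "'a::field \<Rightarrow> (nat \<Rightarrow> 'a form) \<Rightarrow> 'a form \<Rightarrow> 'a form"
  where "deriv_ext s f = lin_ext (\<lambda>I. leibniz s f (sorted_list_of_set I))"


section \<open>The cochain complex of \<open>\<mm>\<^sub>2\<close>\<close>

text \<open>\<open>m2_bracket i j\<close> is \<open>[e\<^sub>i, e\<^sub>j]\<close> in coordinates with respect to \<open>e\<^sub>1, e\<^sub>2, \<dots>\<close>.\<close>

definition m2_bracket :: "nat \<Rightarrow> nat \<Rightarrow> (nat \<Rightarrow>\<^sub>0 'a::field)"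
  where "m2_bracket i j =
    (if i = 1 \<and> 2 \<le> j then Poly_Mapping.single (j + 1) 1
     else if i = 2 \<and> 3 \<le> j then Poly_Mapping.single (j + 2) 1
     else if j = 1 \<and> 2 \<le> i then - Poly_Mapping.single (i + 1) 1
     else if j = 2 \<and> 3 \<le> i then - Poly_Mapping.single (i + 2) 1
     else 0)"

text \<open>
  \<open>de\<^sup>k\<close> is dual to the bracket; by the grading only pairs with \<open>i < j < k\<close> can contribute.
\<close>

definition d_gen :: "nat \<Rightarrow> 'a::field form"
  where "d_gen k =
    (\<Sum>(i, j)\<in>{(i, j). 1 \<le> i \<and> i < j \<and> j < k}. fscale (Poly_Mapping.lookup (m2_bracket i j) k) (e i \<^bold>\<and> e j))"

definition d :: "'a::field form \<Rightarrow> 'a form"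
  where "d = deriv_ext (- 1) d_gen"

definition index_sets :: "nat set set"
  where "index_sets = {I. finite I \<and> 0 \<notin> I}"

definition forms :: "'a::field form set"
  where "forms = form.span (mon ` index_sets)"

definition hom_forms :: "nat \<Rightarrow> int \<Rightarrow> 'a::field form set"  (\<open>\<Lambda>\<close>)
  where "\<Lambda> q k = form.span (mon ` {I \<in> index_sets. card I = q \<and> int (\<Sum>I) = k})"

definition hom_cocycles :: "nat \<Rightarrow> int \<Rightarrow> 'a::field form set"
  where "hom_cocycles q k = {x \<in> \<Lambda> q k. d x = 0}"

subsection \<open>Basic facts\<close>

lemma sum_pairs_two:
  assumes "finite A" "p \<in> A" "p' \<in> A" "p \<noteq> p'" "\<And>r. r \<in> A \<Longrightarrow> r \<noteq> p \<Longrightarrow> r \<noteq> p' \<Longrightarrow> f r = 0"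
  shows "sum f A = f p + f p'"
proof -
  have "sum f A = sum f {p, p'}"
    using assms by (intro sum.mono_neutral_right) auto
  then show ?thesis using assms by simp
qed

lemma finite_pairs: "finite {(i::nat, j). 1 \<le> i \<and> i < j \<and> j < k}"
  by (rule finite_subset[of _ "{..k} \<times> {..k}"]) auto

lemma d_gen_simps:
  "d_gen 1 = (0 :: 'a::field form)" "d_gen 2 = (0 :: 'a form)"
  "d_gen 3 = (e 1 \<^bold>\<and> e 2 :: 'a form)" "d_gen 4 = (e 1 \<^bold>\<and> e 3 :: 'a form)"
  "5 \<le> k \<Longrightarrow> d_gen k = (e 1 \<^bold>\<and> e (k - 1) + e 2 \<^bold>\<and> e (k - 2) :: 'a form)"
proof -
  show "d_gen 1 = (0 :: 'a form)"
    unfolding d_gen_def by (rule sum.neutral) auto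
  show "d_gen 2 = (0 :: 'a form)"
    unfolding d_gen_def by (rule sum.neutral) auto
  have 3: "{(i::nat, j). 1 \<le> i \<and> i < j \<and> j < 3} = {(1, 2)}" by auto
  show "d_gen 3 = (e 1 \<^bold>\<and> e 2 :: 'a form)"
    unfolding d_gen_def 3 by (simp add: m2_bracket_def)
  have 4: "{(i::nat, j). 1 \<le> i \<and> i < j \<and> j < 4} = {(1, 2), (1, 3), (2, 3)}" by auto
  show "d_gen 4 = (e 1 \<^bold>\<and> e 3 :: 'a form)"
    unfolding d_gen_def 4 by (simp add: m2_bracket_def lookup_single)
  assume k: "5 \<le> k"
  have "(d_gen k :: 'a form) = (\<lambda>(i, j). fscale (Poly_Mapping.lookup (m2_bracket i j) k) (e i \<^bold>\<and> e j)) (1, k - 1)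
    + (\<lambda>(i, j). fscale (Poly_Mapping.lookup (m2_bracket i j) k) (e i \<^bold>\<and> e j)) (2, k - 2)"
    unfolding d_gen_def
    by (rule sum_pairs_two[OF finite_pairs])
       (use k in \<open>auto simp: m2_bracket_def lookup_single when_def split: if_splits\<close>)
  moreover have "Poly_Mapping.lookup (m2_bracket 1 (k - 1)) k = (1 :: 'a)"
    and "Poly_Mapping.lookup (m2_bracket 2 (k - 2)) k = (1 :: 'a)"
    using k by (auto simp: m2_bracket_def lookup_single when_def)
  ultimately show "d_gen k = (e 1 \<^bold>\<and> e (k - 1) + e 2 \<^bold>\<and> e (k - 2) :: 'a form)"
    by simp
qed

lemma keys_fscale: "Poly_Mapping.keys (fscale c x) \<subseteq> Poly_Mapping.keys x"
  by (auto simp: in_keys_iff)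

lemma form_expand: "x = (\<Sum>I\<in>Poly_Mapping.keys x. fscale (Poly_Mapping.lookup x I) (mon I))"
proof (rule poly_mapping_eqI)
  fix J
  have "Poly_Mapping.lookup (\<Sum>I\<in>Poly_Mapping.keys x. fscale (Poly_Mapping.lookup x I) (mon I)) J =
      (\<Sum>I\<in>Poly_Mapping.keys x. if I = J then Poly_Mapping.lookup x J else 0)"
    unfolding lookup_sum by (intro sum.cong) (auto simp: lookup_single)
  then show "Poly_Mapping.lookup x J =
      Poly_Mapping.lookup (\<Sum>I\<in>Poly_Mapping.keys x. fscale (Poly_Mapping.lookup x I) (mon I)) J"
    by (simp add: sum.delta in_keys_iff)
qed

lemma span_mon: "form.span (mon ` S) = {x :: 'a::field form. Poly_Mapping.keys x \<subseteq> S}"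
proof (intro equalityI subsetI)
  fix x :: "'a form"
  assume "x \<in> form.span (mon ` S)"
  then have "Poly_Mapping.keys x \<subseteq> S"
  proof (induction rule: form.span_induct_alt)
    case base
    then show ?case by simp
  next
    case (step c y z)
    then obtain I where "y = mon I" "I \<in> S" by auto
    then show ?case
      using step keys_add[of "fscale c y" z] keys_fscale[of c y] by (auto split: if_splits)
  qed
  then show "x \<in> {x. Poly_Mapping.keys x \<subseteq> S}" by simp
next
  fix x :: "'a form"
  assume "x \<in> {x. Poly_Mapping.keys x \<subseteq> S}"
  then have "(\<Sum>I\<in>Poly_Mapping.keys x. fscale (Poly_Mapping.lookup x I) (mon I)) \<in> form.span (mon ` S)"
    by (intro form.span_sum form.span_scale form.span_base) auto
  then show "x \<in> form.span (mon ` S)"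
    using form_expand[of x] by simp
qed

lemma lin_ext_superset:
  assumes "finite A" "Poly_Mapping.keys x \<subseteq> A"
  shows "lin_ext g x = (\<Sum>I\<in>A. fscale (Poly_Mapping.lookup x I) (g I))"
  unfolding lin_ext_def using assms
  by (intro sum.mono_neutral_left) (auto simp: in_keys_iff)

lemma lin_ext_add: "lin_ext g (x + y) = lin_ext g x + lin_ext g y"
proof -
  let ?A = "Poly_Mapping.keys x \<union> Poly_Mapping.keys y"
  have "Poly_Mapping.keys (x + y) \<subseteq> ?A" by (rule keys_add)
  then show ?thesis
    by (simp add: lin_ext_superset[of ?A] lookup_add form.scale_left_distrib sum.distrib)
qed

lemma lin_ext_fscale: "lin_ext g (fscale c x) = fscale c (lin_ext g x)"
proof -
  have "lin_ext g (fscale c x) = (\<Sum>I\<in>Poly_Mapping.keys x. fscale (Poly_Mapping.lookup (fscale c x) I) (g I))"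
    by (rule lin_ext_superset) (auto simp: keys_fscale)
  then show ?thesis
    unfolding lin_ext_def by (simp add: form.scale_sum_right)
qed

lemma lin_ext_mon [simp]: "lin_ext g (mon I) = g I"
  by (simp add: lin_ext_def)

lemma lin_ext_zero [simp]: "lin_ext g 0 = 0"
  by (simp add: lin_ext_def)

lemma lin_ext_minus: "lin_ext g (x - y) = lin_ext g x - lin_ext g y"
  using lin_ext_add[of g "x - y" y] by (simp add: algebra_simps)

lemma lin_ext_uminus: "lin_ext g (- x) = - lin_ext g x"
  using lin_ext_minus[of g 0 x] by simp

lemma d_add: "d (x + y) = d x + d y"
  and d_minus: "d (x - y) = d x - d y"
  and d_fscale: "d (fscale c x) = fscale c (d x)"
  and d_zero [simp]: "d 0 = 0"
  and d_uminus: "d (- x) = - d x"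
  by (simp_all add: d_def deriv_ext_def lin_ext_add lin_ext_minus lin_ext_uminus lin_ext_fscale)

lemma forms_add: "x \<in> forms \<Longrightarrow> y \<in> forms \<Longrightarrow> x + y \<in> forms"
  and forms_minus: "x \<in> forms \<Longrightarrow> y \<in> forms \<Longrightarrow> x - y \<in> forms"
  and forms_fscale: "x \<in> forms \<Longrightarrow> fscale c x \<in> forms"
  and forms_uminus: "x \<in> forms \<Longrightarrow> - x \<in> forms"
  and forms_zero [simp]: "0 \<in> forms"
  by (simp_all add: forms_def form.span_add form.span_diff form.span_scale form.span_zero
      form.span_neg)


section \<open>Cohomology\<close>

text \<open>The type \<open>'a H\<close> is the total cohomology space, cocycles modulo coboundaries.\<close>

definition cohomologous :: "'a::field form \<Rightarrow> 'a form \<Rightarrow> bool"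
  where "cohomologous x y \<longleftrightarrow>
    x \<in> forms \<and> y \<in> forms \<and> d x = 0 \<and> d y = 0 \<and> x - y \<in> d ` forms"

lemma coboundary_add: "x \<in> d ` forms \<Longrightarrow> y \<in> d ` forms \<Longrightarrow> x + y \<in> d ` forms"
  by (metis (no_types, lifting) d_add forms_add image_iff)

lemma coboundary_fscale: "x \<in> d ` forms \<Longrightarrow> fscale c x \<in> d ` forms"
  by (metis (no_types, lifting) d_fscale forms_fscale image_iff)

lemma coboundary_uminus: "x \<in> d ` forms \<Longrightarrow> - x \<in> d ` forms"
  by (metis (no_types, lifting) d_uminus forms_uminus image_iff)

lemma coboundary_zero [simp]: "0 \<in> d ` forms"
  by (metis d_zero forms_zero image_eqI)

lemma cohomologous_refl: "x \<in> forms \<Longrightarrow> d x = 0 \<Longrightarrow> cohomologous x x"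
  by (simp add: cohomologous_def)

lemma part_equivp_cohomologous: "part_equivp (cohomologous :: 'a::field form \<Rightarrow> 'a form \<Rightarrow> bool)"
proof (rule part_equivpI)
  show "\<exists>x :: 'a form. cohomologous x x"
    by (rule exI[of _ 0]) (simp add: cohomologous_refl)
  show "symp (cohomologous :: 'a form \<Rightarrow> 'a form \<Rightarrow> bool)"
  proof (rule sympI)
    fix x y :: "'a form"
    assume "cohomologous x y"
    then show "cohomologous y x"
      using coboundary_uminus[of "x - y"]
      by (simp add: cohomologous_def)
  qed
  show "transp (cohomologous :: 'a form \<Rightarrow> 'a form \<Rightarrow> bool)"
  proof (rule transpI)
    fix x y z :: "'a form"
    assume "cohomologous x y" "cohomologous y z"
    then show "cohomologous x z"
      using coboundary_add[of "x - y" "y - z"] by (simp add: cohomologous_def)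
  qed
qed

quotient_type (overloaded) 'a H = "'a::field form" / partial: cohomologous
  morphisms rep_H coh_class
  by (rule part_equivp_cohomologous)

instantiation H :: (field) ab_group_add
begin

lift_definition zero_H :: "'a H" is 0
  by (simp add: cohomologous_refl)

lift_definition plus_H :: "'a H \<Rightarrow> 'a H \<Rightarrow> 'a H" is "(+)"
  unfolding cohomologous_def
  by (simp add: forms_add d_add add_diff_add coboundary_add)

lift_definition uminus_H :: "'a H \<Rightarrow> 'a H" is uminus
  unfolding cohomologous_def
  by (simp add: forms_uminus d_uminus) (metis coboundary_uminus minus_diff_eq)

definition minus_H :: "'a H \<Rightarrow> 'a H \<Rightarrow> 'a H" where "minus_H x y = x + (- y)"

instance
proof
  fix a b c :: "'a H"
  show "a + b + c = a + (b + c)"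
    by transfer (auto simp: cohomologous_def forms_add d_add algebra_simps)
  show "a + b = b + a"
    by transfer (auto simp: cohomologous_def forms_add d_add algebra_simps)
  show "0 + a = a"
    by transfer (auto simp: cohomologous_def)
  show "- a + a = 0"
    by transfer (simp add: cohomologous_def)
  show "a - b = a + - b"
    by (simp add: minus_H_def)
qed

end

lift_definition hscale :: "'a::field \<Rightarrow> 'a H \<Rightarrow> 'a H" is fscale
  unfolding cohomologous_def
  by (simp add: forms_fscale d_fscale coboundary_fscale
      flip: form.scale_right_diff_distrib)

global_interpretation coh: vector_space "hscale :: 'a::field \<Rightarrow> 'a H \<Rightarrow> 'a H"
proof
  fix a b :: 'a and x y :: "'a H"
  show "hscale a (x + y) = hscale a x + hscale a y"
    by transfer (auto simp: cohomologous_def forms_add forms_fscale d_add d_fscale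
        form.scale_right_distrib)
  show "hscale (a + b) x = hscale a x + hscale b x"
    by transfer (auto simp: cohomologous_def forms_add forms_fscale d_add d_fscale
        form.scale_left_distrib)
  show "hscale a (hscale b x) = hscale (a * b) x"
    by transfer (auto simp: cohomologous_def forms_fscale d_fscale)
  show "hscale 1 x = x"
    by transfer (auto simp: cohomologous_def)
qed

text \<open>The bihomogeneous component \<open>H\<^sup>q\<^sub>k\<close>; see \<open>coh_class_eq_iff\<close> and \<open>span_hom_H\<close> below.\<close>

definition hom_H :: "nat \<Rightarrow> int \<Rightarrow> 'a::field H set"
  where "hom_H q k = coh_class ` hom_cocycles q k"

definition hom_coboundaries :: "nat \<Rightarrow> int \<Rightarrow> 'a::field form set"
  where "hom_coboundaries q k = (if q = 0 then {0} else d ` \<Lambda> (q - 1) k)"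

subsection \<open>Compatibility with the bigrading\<close>

abbreviation bideg_sets :: "nat \<Rightarrow> int \<Rightarrow> nat set set"
  where "bideg_sets q k \<equiv> {I \<in> index_sets. card I = q \<and> int (\<Sum>I) = k}"

lemma hom_forms_iff: "x \<in> \<Lambda> q k \<longleftrightarrow> Poly_Mapping.keys x \<subseteq> bideg_sets q k"
  unfolding hom_forms_def span_mon by simp

lemma forms_iff: "x \<in> forms \<longleftrightarrow> Poly_Mapping.keys x \<subseteq> index_sets"
  unfolding forms_def span_mon by simp

lemma hom_forms_subset: "\<Lambda> q k \<subseteq> forms"
  by (auto simp: hom_forms_iff forms_iff)

lemma hom_forms_add: "x \<in> \<Lambda> q k \<Longrightarrow> y \<in> \<Lambda> q k \<Longrightarrow> x + y \<in> \<Lambda> q k"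
  and hom_forms_minus: "x \<in> \<Lambda> q k \<Longrightarrow> y \<in> \<Lambda> q k \<Longrightarrow> x - y \<in> \<Lambda> q k"
  and hom_forms_fscale: "x \<in> \<Lambda> q k \<Longrightarrow> fscale c x \<in> \<Lambda> q k"
  and hom_forms_zero [simp]: "0 \<in> \<Lambda> q k"
  and hom_forms_sum: "(\<And>i. i \<in> A \<Longrightarrow> f i \<in> \<Lambda> q k) \<Longrightarrow> sum f A \<in> \<Lambda> q k"
  by (simp_all add: hom_forms_def form.span_add form.span_diff form.span_scale form.span_zero
      form.span_sum)

lemma mon_in_hom_forms: "I \<in> index_sets \<Longrightarrow> mon I \<in> \<Lambda> (card I) (int (\<Sum>I))"
  by (simp add: hom_forms_iff)

lemma mon_wedge_in_hom_forms:
  assumes "I \<in> bideg_sets p a" "J \<in> bideg_sets q b"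
  shows "mon_wedge I J \<in> \<Lambda> (p + q) (a + b)"
proof (cases "I \<inter> J = {}")
  case True
  then have "I \<union> J \<in> bideg_sets (p + q) (a + b)"
    using assms by (auto simp: index_sets_def card_Un_disjoint sum.union_disjoint)
  then have "(mon (I \<union> J) :: 'a form) \<in> \<Lambda> (p + q) (a + b)"
    by (simp add: hom_forms_iff)
  then show ?thesis
    by (simp add: mon_wedge_def True hom_forms_fscale)
next
  case False
  then show ?thesis by (simp add: mon_wedge_def)
qed

lemma wedge_in_hom_forms:
  assumes "x \<in> \<Lambda> p a" "y \<in> \<Lambda> q b"
  shows "x \<^bold>\<and> y \<in> \<Lambda> (p + q) (a + b)"
  unfolding wedge_def lin_ext_def
  using assms unfolding hom_forms_iff[of x] hom_forms_iff[of y]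
  by (intro hom_forms_sum hom_forms_fscale mon_wedge_in_hom_forms) blast+

lemma e_in_hom_forms: "1 \<le> i \<Longrightarrow> e i \<in> \<Lambda> 1 (int i)"
  by (simp add: hom_forms_iff index_sets_def)

lemma d_gen_in_hom_forms: "(d_gen k :: 'a::field form) \<in> \<Lambda> 2 (int k)"
  unfolding d_gen_def
proof (rule hom_forms_sum, clarify)
  fix i j :: nat
  assume ij: "1 \<le> i" "i < j" "j < k"
  show "(fscale (Poly_Mapping.lookup (m2_bracket i j) k) (e i \<^bold>\<and> e j) :: 'a form) \<in> \<Lambda> 2 (int k)"
  proof (cases "i + j = k")
    case True
    then show ?thesis
      using ij wedge_in_hom_forms[OF e_in_hom_forms e_in_hom_forms, of i j]
      by (auto intro!: hom_forms_fscale simp: numeral_2_eq_2)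
  next
    case False
    then have "Poly_Mapping.lookup (m2_bracket i j) k = (0 :: 'a)"
      using ij by (auto simp: m2_bracket_def lookup_single when_def)
    then show ?thesis by simp
  qed
qed

lemma leibniz_in_hom_forms:
  assumes "\<And>i. i \<in> set is \<Longrightarrow> f i \<in> \<Lambda> (Suc p) (int i + c)" "distinct is" "0 \<notin> set is"
  shows "leibniz s f is \<in> \<Lambda> (length is + p) (int (\<Sum>(set is)) + c)"
  using assms
proof (induction "is")
  case Nil
  then show ?case by simp
next
  case (Cons i "is")
  have "(mon (set is) :: 'a form) \<in> \<Lambda> (length is) (int (\<Sum>(set is)))"
    using Cons.prems mon_in_hom_forms[of "set is"] by (simp add: index_sets_def distinct_card)
  then have "f i \<^bold>\<and> mon (set is) \<in> \<Lambda> (length (i # is) + p) (int (\<Sum>(set (i # is))) + c)"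
    using wedge_in_hom_forms[of "f i" "Suc p" "int i + c" "mon (set is)"
        "length is" "int (\<Sum>(set is))"] Cons.prems
    by (simp add: algebra_simps)
  moreover have "e i \<^bold>\<and> leibniz s f is \<in> \<Lambda> (length (i # is) + p) (int (\<Sum>(set (i # is))) + c)"
    using wedge_in_hom_forms[OF e_in_hom_forms Cons.IH, of i] Cons.prems
    by (simp add: algebra_simps)
  ultimately show ?case
    by (simp add: hom_forms_add hom_forms_fscale)
qed

lemma d_mon_in_hom_forms:
  assumes "I \<in> bideg_sets q k"
  shows "d (mon I) \<in> \<Lambda> (Suc q) k"
proof -
  have I: "finite I" "0 \<notin> I" "card I = q" "int (\<Sum>I) = k"
    using assms by (auto simp: index_sets_def)
  have *: "d_gen i \<in> \<Lambda> (Suc 1) (int i + 0)" for i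
    using d_gen_in_hom_forms[of i] by (simp add: numeral_2_eq_2)
  have "leibniz (- 1) d_gen (sorted_list_of_set I) \<in> \<Lambda> (q + 1) (k + 0)"
    using leibniz_in_hom_forms[of "sorted_list_of_set I" d_gen 1 0, OF *] I by simp
  then show ?thesis
    by (simp add: d_def deriv_ext_def)
qed

lemma d_sum: "d (sum f A) = (\<Sum>i\<in>A. d (f i))"
  by (induction A rule: infinite_finite_induct) (simp_all add: d_add)

lemma d_in_hom_forms:
  assumes "x \<in> \<Lambda> q k"
  shows "d x \<in> \<Lambda> (Suc q) k"
proof -
  have "d x = (\<Sum>I\<in>Poly_Mapping.keys x. fscale (Poly_Mapping.lookup x I) (d (mon I)))"
    using arg_cong[OF form_expand[of x], of d] by (simp add: d_sum d_fscale)
  also have "\<dots> \<in> \<Lambda> (Suc q) k"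
    using assms unfolding hom_forms_iff[of x]
    by (intro hom_forms_sum hom_forms_fscale d_mon_in_hom_forms) blast
  finally show ?thesis .
qed

definition hom_part :: "nat \<Rightarrow> int \<Rightarrow> 'a::field form \<Rightarrow> 'a form"
  where "hom_part q k = lin_ext (\<lambda>I. if I \<in> bideg_sets q k then mon I else 0)"

lemma lookup_hom_part:
  "Poly_Mapping.lookup (hom_part q k x) I = (if I \<in> bideg_sets q k then Poly_Mapping.lookup x I else 0)"
proof -
  have "Poly_Mapping.lookup (hom_part q k x) I =
      (\<Sum>J\<in>Poly_Mapping.keys x. if J = I then (if I \<in> bideg_sets q k then Poly_Mapping.lookup x I else 0) else 0)"
    unfolding hom_part_def lin_ext_def lookup_sum
    by (intro sum.cong) (auto simp: lookup_single)
  also have "\<dots> = (if I \<in> bideg_sets q k then Poly_Mapping.lookup x I else 0)"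
    by (simp add: sum.delta in_keys_iff)
  finally show ?thesis .
qed

lemma hom_part_in_hom_forms: "hom_part q k x \<in> \<Lambda> q k"
  unfolding hom_forms_iff by (auto simp: in_keys_iff lookup_hom_part split: if_splits)

lemma hom_part_id: "x \<in> \<Lambda> q k \<Longrightarrow> hom_part q k x = x"
  by (intro poly_mapping_eqI) (auto simp: lookup_hom_part hom_forms_iff in_keys_iff)

lemma hom_part_other: "x \<in> \<Lambda> q' k' \<Longrightarrow> (q, k) \<noteq> (q', k') \<Longrightarrow> hom_part q k x = 0"
  by (intro poly_mapping_eqI) (auto simp: lookup_hom_part hom_forms_iff in_keys_iff)

lemma hom_part_sum_fscale:
  "hom_part q k (\<Sum>i\<in>A. fscale (c i) (f i)) = (\<Sum>i\<in>A. fscale (c i) (hom_part q k (f i)))"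
  by (induction A rule: infinite_finite_induct)
     (simp_all add: hom_part_def lin_ext_add lin_ext_fscale)

lemma hom_part_d:
  assumes "x \<in> forms"
  shows "hom_part (Suc q) k (d x) = d (hom_part q k x)" and "hom_part 0 k (d x) = 0"
proof -
  have x: "x = (\<Sum>I\<in>Poly_Mapping.keys x. fscale (Poly_Mapping.lookup x I) (mon I))"
    by (rule form_expand)
  have dx: "d x = (\<Sum>I\<in>Poly_Mapping.keys x. fscale (Poly_Mapping.lookup x I) (d (mon I)))"
    using arg_cong[OF x, of d] by (simp add: d_sum d_fscale)
  have I: "I \<in> bideg_sets (card I) (int (\<Sum>I))" if "I \<in> Poly_Mapping.keys x" for I
    using assms that by (auto simp: forms_iff)
  have *: "hom_part (Suc q) k (d (mon I)) = d (hom_part q k (mon I :: 'a form))"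
    if "I \<in> Poly_Mapping.keys x" for I
  proof (cases "card I = q \<and> int (\<Sum>I) = k")
    case True
    then show ?thesis
      using d_mon_in_hom_forms[OF I[OF that], where ?'a = 'a] mon_in_hom_forms[of I, where ?'a = 'a] I[OF that]
      by (simp add: hom_part_id)
  next
    case False
    then show ?thesis
      using hom_part_other[OF d_mon_in_hom_forms[OF I[OF that], where ?'a = 'a], of "Suc q" k]
        hom_part_other[OF mon_in_hom_forms[of I, where ?'a = 'a], of q k] I[OF that]
      by auto
  qed
  have "hom_part (Suc q) k (d x) =
      (\<Sum>I\<in>Poly_Mapping.keys x. fscale (Poly_Mapping.lookup x I) (d (hom_part q k (mon I))))"
    unfolding dx hom_part_sum_fscale by (intro sum.cong) (simp_all add: *)
  also have "\<dots> = d (hom_part q k x)"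
    using arg_cong[OF x, of "\<lambda>z. d (hom_part q k z)"]
    by (simp add: hom_part_sum_fscale d_sum d_fscale)
  finally show "hom_part (Suc q) k (d x) = d (hom_part q k x)" .
  show "hom_part 0 k (d x) = 0"
    unfolding dx hom_part_sum_fscale
  proof (rule sum.neutral, rule ballI)
    fix I
    assume "I \<in> Poly_Mapping.keys x"
    then show "fscale (Poly_Mapping.lookup x I) (hom_part 0 k (d (mon I))) = 0"
      using hom_part_other[OF d_mon_in_hom_forms[OF I, where ?'a = 'a], of I 0 k] by simp
  qed
qed

lemma coh_class_eq_iff_cohomologous:
  assumes "x \<in> forms" "d x = 0" "y \<in> forms" "d y = 0"
  shows "coh_class x = coh_class y \<longleftrightarrow> x - y \<in> d ` forms"
  using Quotient3_rel[OF Quotient3_H, of x y] assms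
  by (auto simp: cohomologous_def)

lemma coh_class_eq_iff:
  assumes "x \<in> hom_cocycles q k" "y \<in> hom_cocycles q k"
  shows "coh_class x = coh_class y \<longleftrightarrow> x - y \<in> hom_coboundaries q k"
proof -
  have xy: "x \<in> \<Lambda> q k" "y \<in> \<Lambda> q k" "d x = 0" "d y = 0"
    using assms by (auto simp: hom_cocycles_def)
  have "x - y \<in> d ` forms \<longleftrightarrow> x - y \<in> hom_coboundaries q k"
  proof
    assume "x - y \<in> d ` forms"
    then obtain z where z: "z \<in> forms" "x - y = d z" by auto
    have part: "x - y = hom_part q k (d z)"
      using xy z by (metis hom_forms_minus hom_part_id)
    show "x - y \<in> hom_coboundaries q k"
    proof (cases q)
      case 0
      then show ?thesis using part hom_part_d(2)[OF z(1)] by (simp add: hom_coboundaries_def)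
    next
      case (Suc p)
      then show ?thesis
        using part hom_part_d(1)[OF z(1), of p k] hom_part_in_hom_forms[of p k z]
        by (simp add: hom_coboundaries_def)
    qed
  next
    assume "x - y \<in> hom_coboundaries q k"
    then show "x - y \<in> d ` forms"
      using hom_forms_subset[of "q - 1" k] coboundary_zero
      by (auto simp: hom_coboundaries_def split: if_splits)
  qed
  then show ?thesis
    using coh_class_eq_iff_cohomologous[of x y] xy hom_forms_subset by blast
qed

lemma coh_class_add:
  assumes "x \<in> forms" "d x = 0" "y \<in> forms" "d y = 0"
  shows "coh_class (x + y) = coh_class x + coh_class y"
  using plus_H.abs_eq[of x y] assms by (simp add: cohomologous_refl)

lemma coh_class_sum:
  assumes "finite A" "\<And>i. i \<in> A \<Longrightarrow> f i \<in> forms \<and> d (f i) = 0"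
  shows "sum f A \<in> forms \<and> d (sum f A) = 0 \<and> coh_class (sum f A) = (\<Sum>i\<in>A. coh_class (f i))"
  using assms
proof (induction A rule: finite_induct)
  case empty
  then show ?case by (simp add: zero_H.abs_eq)
next
  case (insert i A)
  then show ?case by (simp add: forms_add d_add coh_class_add)
qed

lemma form_eq_sum_hom_part:
  assumes "x \<in> forms"
  shows "x = (\<Sum>(q, k)\<in>(\<lambda>I. (card I, int (\<Sum>I))) ` Poly_Mapping.keys x. hom_part q k x)"
proof (rule poly_mapping_eqI)
  fix I
  let ?B = "(\<lambda>I. (card I, int (\<Sum>I))) ` Poly_Mapping.keys x"
  have "Poly_Mapping.lookup (\<Sum>(q, k)\<in>?B. hom_part q k x) I =
      (\<Sum>p\<in>?B. if p = (card I, int (\<Sum>I)) then Poly_Mapping.lookup x I else 0)"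
    unfolding lookup_sum
  proof (rule sum.cong)
    fix p
    assume "p \<in> ?B"
    show "Poly_Mapping.lookup (case p of (q, k) \<Rightarrow> hom_part q k x) I =
        (if p = (card I, int (\<Sum>I)) then Poly_Mapping.lookup x I else 0)"
      using assms by (cases p) (auto simp: lookup_hom_part forms_iff in_keys_iff)
  qed simp
  also have "\<dots> = Poly_Mapping.lookup x I"
    by (auto simp: sum.delta' sum.delta in_keys_iff)
  finally show "Poly_Mapping.lookup x I = Poly_Mapping.lookup (\<Sum>(q, k)\<in>?B. hom_part q k x) I" ..
qed

lemma span_hom_H: "coh.span (\<Union>q k. hom_H q k) = (UNIV :: 'a::field H set)"
proof (intro equalityI subsetI)
  fix h :: "'a H"
  have "\<exists>x. cohomologous x x \<and> coh_class x = h"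
    using Quotient3_abs_rep[OF Quotient3_H] Quotient3_rep_reflp[OF Quotient3_H] by blast
  then obtain x where x: "x \<in> forms" "d x = 0" "h = coh_class x"
    by (auto simp: cohomologous_def)
  let ?B = "(\<lambda>I. (card I, int (\<Sum>I))) ` Poly_Mapping.keys x"
  have cocycle: "hom_part q k x \<in> hom_cocycles q k" for q k
    using hom_part_d(1)[OF x(1), of q k] x(2) hom_part_in_hom_forms[of q k x]
    by (simp add: hom_cocycles_def hom_part_def)
  then have "hom_part q k x \<in> forms \<and> d (hom_part q k x) = 0" for q k
    by (auto simp: hom_cocycles_def intro: subsetD[OF hom_forms_subset])
  then have "h = (\<Sum>p\<in>?B. coh_class (case p of (q, k) \<Rightarrow> hom_part q k x))"
    using coh_class_sum[of ?B "\<lambda>p. case p of (q, k) \<Rightarrow> hom_part q k x"]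
      form_eq_sum_hom_part[OF x(1)] x(3) by (auto split: prod.splits)
  also have "\<dots> \<in> coh.span (\<Union>q k. hom_H q k)"
    by (intro coh.span_sum coh.span_base) (auto simp: hom_H_def intro: imageI[OF cocycle])
  finally show "h \<in> coh.span (\<Union>q k. hom_H q k)" .
qed simp


section \<open>The generating cocycles\<close>

text \<open>
  The derivations below act on monomials in \<open>e\<^sup>3, e\<^sup>4, \<dots>\<close> only: they are dual to \<open>ad e\<^sub>1\<close> and
  \<open>ad e\<^sub>2\<close> on the ideal spanned by \<open>e\<^sub>3, e\<^sub>4, \<dots>\<close>.  On the larger ideal that also contains \<open>e\<^sub>1\<close>,
  the bracket \<open>[e\<^sub>2, e\<^sub>1] = - e\<^sub>3\<close> would send \<open>e\<^sup>3\<close> to a nonzero multiple of \<open>e\<^sup>1\<close> under the dual of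
  \<open>ad e\<^sub>2\<close>; with that value \<open>w {3}\<close> below would not be closed.
\<close>

definition ad1_star :: "'a::field form \<Rightarrow> 'a form"
  where "ad1_star = deriv_ext 1 (\<lambda>i. if 4 \<le> i then e (i - 1) else 0)"

definition ad2_star :: "'a::field form \<Rightarrow> 'a form"
  where "ad2_star = deriv_ext 1 (\<lambda>i. if 5 \<le> i then e (i - 2) else 0)"

definition D1 :: "'a::field form \<Rightarrow> 'a form"
  where "D1 = deriv_ext 1 (\<lambda>i. if 3 \<le> i then e (i - 1) else 0)"

text \<open>
  The sums over \<open>l\<close> have finitely many nonzero terms.  Monomials whose two largest indices are
  not consecutive are outside the domain of \<open>\<omega>\<close>; they are sent to 0, and do not occur in \<open>w\<close> below.
\<close>

definition \<omega> :: "'a::field form \<Rightarrow> 'a form"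
  where "\<omega> = lin_ext (\<lambda>I.
    if 2 \<le> card I \<and> Max I - 1 \<in> I
    then Sum_any (\<lambda>l. fscale ((- 1) ^ l) ((D1 ^^ l) (mon (I - {Max I})) \<^bold>\<and> e (Max I + l)))
    else 0)"

text \<open>\<open>w {i\<^sub>1 < \<dots> < i\<^sub>q}\<close> is the form of degree \<open>q + 2\<close> labelled \<open>i\<^sub>1, \<dots>, i\<^sub>q, i\<^sub>q + 1, i\<^sub>q + 2\<close>.\<close>

definition w :: "nat set \<Rightarrow> 'a::field form"
  where "w I = Sum_any (\<lambda>l. fscale (1 / 2 ^ l)
    (\<omega> (((\<lambda>x. ad2_star x + ad1_star (ad1_star x)) ^^ l) (mon I)
        \<^bold>\<and> e (Max I + 1 + l) \<^bold>\<and> e (Max I + 2 + l))))"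

definition m2_generators :: "'a::field form set"
  where "m2_generators =
    {e 1, e 2, e 2 \<^bold>\<and> e 3, e 3 \<^bold>\<and> e 4 - e 2 \<^bold>\<and> e 5} \<union>
    w ` {I. finite I \<and> I \<noteq> {} \<and> (\<forall>i\<in>I. 3 \<le> i)}"

definition parts :: "nat \<Rightarrow> int \<Rightarrow> nat"
  where "parts q N =
    card {xs :: nat list. length xs = q \<and> sorted xs \<and> (\<forall>x\<in>set xs. 1 \<le> x) \<and> int (sum_list xs) = N}"

end

theory Submission
  imports Defs
begin

text \<open>
  Write \<open>a = ad e\<^sub>1\<^sup>*\<close>, \<open>b = ad e\<^sub>2\<^sup>*\<close>.  On all forms
  \<open>d x = e\<^sup>1 \<and> D\<^sub>1 x + e\<^sup>2 \<and> b x\<close>, where \<open>D\<^sub>1\<close> agrees with \<open>a\<close> modulo \<open>e\<^sup>2\<close> and \<open>a\<close>, \<open>b\<close> commute.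
  The alternating sum \<open>F(x, n) = \<Sum>\<^sub>l (-1)\<^sup>l a\<^sup>l x \<and> e\<^sup>n\<^sup>+\<^sup>l\<close> satisfies \<open>F(x, n) = x \<and> e\<^sup>n - F(a x, n + 1)\<close>, hence
  \<open>a F(x, n + 1) = x \<and> e\<^sup>n\<close>: it is a right inverse of \<open>a\<close>, and \<open>\<Omega>(x, n) = F(x \<and> e\<^sup>n, n + 1)\<close>
  lies in the kernel of \<open>a\<close>.  With \<open>c = b + a\<^sup>2\<close> one finds \<open>b \<Omega>(x, n + 1) = \<Omega>(c x, n + 1) - 2 \<Omega>(x, n)\<close>,
  so that \<open>W(x, n) = \<Sum>\<^sub>l 2\<^sup>-\<^sup>l \<Omega>(c\<^sup>l x, n + l)\<close> telescopes to \<open>b W(x, n + 1) = - 2 \<Omega>(x, n)\<close>: a right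
  inverse of \<open>b\<close> on the kernel of \<open>a\<close>.  The explicit right inverses strip every cocycle, up to
  coboundaries, down to the four small generators and the forms \<open>W(e\<^sup>I, Max I + 1)\<close>, which are closed
  because, for \<open>m = Max I\<close>, \<open>e\<^sup>I \<and> e\<^sup>m = 0\<close>.  These are linearly independent modulo coboundaries since among the monomials
  whose three largest indices are consecutive, \<open>w\<close> contains only its leading one, and a
  coboundary has no monomial free of \<open>e\<^sup>1\<close> and \<open>e\<^sup>2\<close>.  Counting such monomials is counting
  partitions whose three largest parts coincide.
\<close>

section \<open>Linear extension and bilinearity of the wedge product\<close>

lemma forms_induct [consumes 1, case_names add mon]:
  assumes "x \<in> forms"
    and "\<And>x y. P x \<Longrightarrow> P y \<Longrightarrow> P (x + y)"
    and "\<And>c I. I \<in> index_sets \<Longrightarrow> P (fscale c (mon I))"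
  shows "P x"
proof -
  have "P 0"
    using assms(3)[of "{}" 0] by (simp add: index_sets_def)
  with assms(1) show ?thesis
    unfolding forms_def by (induction rule: form.span_induct_alt) (auto intro: assms)
qed

lemma lin_ext_cong:
  assumes "\<And>I. I \<in> Poly_Mapping.keys x \<Longrightarrow> g I = h I"
  shows "lin_ext g x = lin_ext h x"
  unfolding lin_ext_def by (intro sum.cong) (simp_all add: assms)

lemma lin_ext_fun_add: "lin_ext (\<lambda>I. g I + h I) x = lin_ext g x + lin_ext h x"
  by (simp add: lin_ext_def form.scale_right_distrib sum.distrib)

lemma lin_ext_fun_fscale: "lin_ext (\<lambda>I. fscale c (g I)) x = fscale c (lin_ext g x)"
  by (simp add: lin_ext_def form.scale_sum_right mult.commute)

lemma wedge_mon_mon: "mon I \<^bold>\<and> mon J = mon_wedge I J"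
  by (simp add: wedge_def)

lemma wedge_add_left: "(x + y) \<^bold>\<and> z = x \<^bold>\<and> z + y \<^bold>\<and> z"
  and wedge_add_right: "x \<^bold>\<and> (y + z) = x \<^bold>\<and> y + x \<^bold>\<and> z"
  and wedge_fscale_left: "fscale c x \<^bold>\<and> y = fscale c (x \<^bold>\<and> y)"
  and wedge_fscale_right: "x \<^bold>\<and> fscale c y = fscale c (x \<^bold>\<and> y)"
  by (simp_all add: wedge_def lin_ext_add lin_ext_fscale lin_ext_fun_add lin_ext_fun_fscale)

lemma mon_in_forms: "I \<in> index_sets \<Longrightarrow> mon I \<in> forms"
  using hom_forms_subset mon_in_hom_forms by blast

lemma lin_ext_in_forms:
  assumes "x \<in> forms" "\<And>I. I \<in> index_sets \<Longrightarrow> g I \<in> forms"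
  shows "lin_ext g x \<in> forms"
  using assms(1)
  by (induction rule: forms_induct)
     (auto simp: lin_ext_add lin_ext_fscale intro: forms_add forms_fscale assms(2))

lemma mon_wedge_in_forms: "I \<in> index_sets \<Longrightarrow> J \<in> index_sets \<Longrightarrow> mon_wedge I J \<in> forms"
proof -
  assume "I \<in> index_sets" "J \<in> index_sets"
  then have "I \<union> J \<in> index_sets"
    by (auto simp: index_sets_def)
  then show "mon_wedge I J \<in> forms"
    by (simp add: mon_wedge_def forms_fscale mon_in_forms)
qed

lemma wedge_in_forms: "x \<in> forms \<Longrightarrow> y \<in> forms \<Longrightarrow> x \<^bold>\<and> y \<in> forms"
  unfolding wedge_def by (intro lin_ext_in_forms mon_wedge_in_forms)

section \<open>Signs and associativity of the wedge product\<close>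

definition inversions :: "nat set \<Rightarrow> nat set \<Rightarrow> nat"
  where "inversions I J = card {(i, j). i \<in> I \<and> j \<in> J \<and> j < i}"

lemma finite_inversions: "finite I \<Longrightarrow> finite J \<Longrightarrow> finite {(i, j). i \<in> I \<and> j \<in> J \<and> j < i}"
  by (rule finite_subset[of _ "I \<times> J"]) auto

lemma inversions_Un_left:
  assumes "finite I" "finite J" "finite K" "I \<inter> J = {}"
  shows "inversions (I \<union> J) K = inversions I K + inversions J K"
proof -
  have eq: "{(i, j). i \<in> I \<union> J \<and> j \<in> K \<and> j < i} =
      {(i, j). i \<in> I \<and> j \<in> K \<and> j < i} \<union> {(i, j). i \<in> J \<and> j \<in> K \<and> j < i}"
    by auto
  show ?thesis
    unfolding inversions_def eq
    by (rule card_Un_disjoint) (use assms in \<open>auto simp: finite_inversions\<close>)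
qed

lemma inversions_Un_right:
  assumes "finite I" "finite J" "finite K" "J \<inter> K = {}"
  shows "inversions I (J \<union> K) = inversions I J + inversions I K"
proof -
  have eq: "{(i, j). i \<in> I \<and> j \<in> J \<union> K \<and> j < i} =
      {(i, j). i \<in> I \<and> j \<in> J \<and> j < i} \<union> {(i, j). i \<in> I \<and> j \<in> K \<and> j < i}"
    by auto
  show ?thesis
    unfolding inversions_def eq
    by (rule card_Un_disjoint) (use assms in \<open>auto simp: finite_inversions\<close>)
qed

lemma mon_wedge_eq:
  "mon_wedge I J = (if I \<inter> J = {} then fscale ((- 1) ^ inversions I J) (mon (I \<union> J)) else 0)"
  by (simp add: mon_wedge_def inversions_def)

lemma wedge_zero_left [simp]: "0 \<^bold>\<and> x = 0"
  and wedge_zero_right [simp]: "x \<^bold>\<and> 0 = 0"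
  using wedge_fscale_left[of 0 0 x] wedge_fscale_right[of x 0 0] by simp_all

text \<open>Both bracketings carry the sign exponent inv(I,J) + inv(I,K) + inv(J,K), because
  \<open>inversions\<close> is additive over disjoint unions; if two of the sets meet, both sides
  vanish.\<close>

lemma wedge_assoc_mon:
  assumes "finite I" "finite J" "finite K"
  shows "(mon I \<^bold>\<and> mon J) \<^bold>\<and> mon K = mon I \<^bold>\<and> (mon J \<^bold>\<and> mon K)"
proof (cases "I \<inter> J = {} \<and> I \<inter> K = {} \<and> J \<inter> K = {}")
  case True
  then have "inversions I J + inversions (I \<union> J) K = inversions J K + inversions I (J \<union> K)"
    using assms by (simp add: inversions_Un_left inversions_Un_right)
  moreover have "(I \<union> J) \<inter> K = {}" "I \<inter> (J \<union> K) = {}"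
    using True by auto
  ultimately show ?thesis
    using True
    by (simp add: wedge_mon_mon mon_wedge_eq wedge_fscale_left wedge_fscale_right Un_assoc
        del: minus_one_power_iff flip: power_add)
next
  case False
  then consider "I \<inter> J \<noteq> {}" | "I \<inter> J = {}" "J \<inter> K \<noteq> {}"
    | "I \<inter> J = {}" "J \<inter> K = {}" "I \<inter> K \<noteq> {}"
    by blast
  then show ?thesis
    by cases (auto simp: wedge_mon_mon mon_wedge_eq wedge_fscale_left wedge_fscale_right
        Int_Un_distrib Int_Un_distrib2)
qed

text \<open>Confined to \<open>forms\<close>: for an infinite set of inversions \<open>card\<close>
  returns 0, and the sign exponent is no longer additive.\<close>

lemma wedge_assoc:
  assumes "x \<in> forms" "y \<in> forms" "z \<in> forms"
  shows "(x \<^bold>\<and> y) \<^bold>\<and> z = x \<^bold>\<and> (y \<^bold>\<and> z)"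
  using assms(1)
proof (induction rule: forms_induct)
  case (add x x')
  then show ?case by (simp add: wedge_add_left)
next
  case (mon c I)
  then have I: "finite I" by (simp add: index_sets_def)
  have "(mon I \<^bold>\<and> y) \<^bold>\<and> z = mon I \<^bold>\<and> (y \<^bold>\<and> z)"
    using assms(2)
  proof (induction rule: forms_induct)
    case (add x x')
    then show ?case by (simp add: wedge_add_left wedge_add_right)
  next
    case (mon c J)
    then have J: "finite J" by (simp add: index_sets_def)
    have "(mon I \<^bold>\<and> mon J) \<^bold>\<and> z = mon I \<^bold>\<and> (mon J \<^bold>\<and> z)"
      using assms(3)
    proof (induction rule: forms_induct)
      case (add x x')
      then show ?case by (simp add: wedge_add_right)
    next
      case (mon c K)
      then show ?case
        using I J by (simp add: wedge_fscale_right wedge_assoc_mon index_sets_def)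
    qed
    then show ?case by (simp add: wedge_fscale_left wedge_fscale_right)
  qed
  then show ?case by (simp add: wedge_fscale_left)
qed

lemma inversions_empty [simp]: "inversions {} I = 0" "inversions I {} = 0"
  by (simp_all add: inversions_def)

lemma wedge_one_left: "mon {} \<^bold>\<and> x = x"
proof -
  have "mon {} \<^bold>\<and> x = lin_ext (\<lambda>J. mon J) x"
    by (simp add: wedge_def mon_wedge_eq)
  then show ?thesis
    using form_expand[of x] by (simp add: lin_ext_def)
qed

lemma wedge_one_right: "x \<^bold>\<and> mon {} = x"
proof -
  have "x \<^bold>\<and> mon {} = lin_ext (\<lambda>J. mon J) x"
    by (simp add: wedge_def mon_wedge_eq)
  then show ?thesis
    using form_expand[of x] by (simp add: lin_ext_def)
qed

lemma leibniz_in_forms: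
  assumes "\<And>i. i \<in> set is \<Longrightarrow> f i \<in> forms" "0 \<notin> set is"
  shows "leibniz s f is \<in> forms"
  using assms
proof (induction "is")
  case (Cons i "is")
  moreover have "set is \<in> index_sets" "{i} \<in> index_sets"
    using Cons.prems by (simp_all add: index_sets_def)
  ultimately show ?case
    by (auto intro!: forms_add forms_fscale wedge_in_forms mon_in_forms)
qed simp

lemma deriv_ext_in_forms:
  assumes "\<And>i. 1 \<le> i \<Longrightarrow> f i \<in> forms" "x \<in> forms"
  shows "deriv_ext s f x \<in> forms"
  unfolding deriv_ext_def using assms(2)
proof (rule lin_ext_in_forms)
  fix I :: "nat set"
  assume "I \<in> index_sets"
  then show "leibniz s f (sorted_list_of_set I) \<in> forms"
    by (intro leibniz_in_forms assms) (auto simp: index_sets_def intro: Suc_leI gr0I)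
qed


section \<open>The exterior algebra as a ring\<close>

text \<open>On this subtype the wedge product is associative with unit \<open>mon {}\<close>, so the
  calculations below can use ring notation and the ring lemmas.\<close>

typedef (overloaded) 'a ext = "forms :: 'a::field form set"
  morphisms form_of ext_of
  using forms_zero by blast

setup_lifting type_definition_ext

instantiation ext :: (field) ring_1
begin

lift_definition zero_ext :: "'a ext" is 0
  by simp
lift_definition one_ext :: "'a ext" is "mon {}"
  by (simp add: mon_in_forms index_sets_def)
lift_definition plus_ext :: "'a ext \<Rightarrow> 'a ext \<Rightarrow> 'a ext" is "(+)"
  by (rule forms_add)
lift_definition minus_ext :: "'a ext \<Rightarrow> 'a ext \<Rightarrow> 'a ext" is "(-)"
  by (rule forms_minus)
lift_definition uminus_ext :: "'a ext \<Rightarrow> 'a ext" is uminus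
  by (rule forms_uminus)
lift_definition times_ext :: "'a ext \<Rightarrow> 'a ext \<Rightarrow> 'a ext" is wedge
  by (rule wedge_in_forms)

instance
proof
  fix x y z :: "'a ext"
  show "x + y + z = x + (y + z)" by transfer (rule add.assoc)
  show "x + y = y + x" by transfer (rule add.commute)
  show "0 + x = x" by transfer simp
  show "- x + x = 0" by transfer simp
  show "x - y = x + - y" by transfer simp
  show "x * y * z = x * (y * z)" by transfer (rule wedge_assoc)
  show "(x + y) * z = x * z + y * z" by transfer (rule wedge_add_left)
  show "x * (y + z) = x * y + x * z" by transfer (rule wedge_add_right)
  show "1 * x = x" by transfer (rule wedge_one_left)
  show "x * 1 = x" by transfer (rule wedge_one_right)
  show "(0 :: 'a ext) \<noteq> 1"
    by transfer (metis lookup_single_eq lookup_zero zero_neq_one)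
qed

end

lift_definition scl :: "'a::field \<Rightarrow> 'a ext \<Rightarrow> 'a ext" is fscale
  by (rule forms_fscale)

global_interpretation ext: vector_space "scl :: 'a::field \<Rightarrow> 'a ext \<Rightarrow> 'a ext"
proof
  fix a b :: 'a and x y :: "'a ext"
  show "scl a (x + y) = scl a x + scl a y" by transfer (rule form.scale_right_distrib)
  show "scl (a + b) x = scl a x + scl b x" by transfer (rule form.scale_left_distrib)
  show "scl a (scl b x) = scl (a * b) x" by transfer (rule form.scale_scale)
  show "scl 1 x = x" by transfer (rule form.scale_one)
qed

lemma scl_mult_left: "scl c x * y = scl c (x * y)"
  and scl_mult_right: "x * scl c y = scl c (x * y)"
  by (transfer; simp add: wedge_fscale_left wedge_fscale_right)+

lift_definition coef :: "'a::field ext \<Rightarrow> nat set \<Rightarrow> 'a" is Poly_Mapping.lookup .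

text \<open>Sets outside \<open>index_sets\<close> are sent to 0, which makes the map total and
  gives \<open>E 0 = 0\<close>.\<close>

lift_definition Mon :: "nat set \<Rightarrow> 'a::field ext"
  is "\<lambda>I. if I \<in> index_sets then mon I else 0"
  by (simp add: mon_in_forms)

definition E :: "nat \<Rightarrow> 'a::field ext"
  where "E i = Mon {i}"

lemma Mon_empty [simp]: "Mon {} = 1"
  by transfer (simp add: index_sets_def)

lemma E_0 [simp]: "E 0 = 0"
  unfolding E_def by transfer (simp add: index_sets_def)

lemma coef_add: "coef (x + y) I = coef x I + coef y I"
  and coef_diff: "coef (x - y) I = coef x I - coef y I"
  and coef_scl: "coef (scl c x) I = c * coef x I"
  and coef_zero [simp]: "coef 0 I = 0"
  by (transfer; simp add: lookup_add lookup_minus)+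

lemma coef_Mon: "I \<in> index_sets \<Longrightarrow> coef (Mon I) J = (if I = J then 1 else 0)"
  by transfer (simp add: lookup_single)

lemma coef_sum: "coef (sum f A) I = (\<Sum>i\<in>A. coef (f i) I)"
  by (induction A rule: infinite_finite_induct) (simp_all add: coef_add)

lemma ext_eqI: "(\<And>I. I \<in> index_sets \<Longrightarrow> coef x I = coef y I) \<Longrightarrow> x = y"
proof (transfer, rule poly_mapping_eqI)
  fix x y :: "'a form" and I
  assume *: "x \<in> forms" "y \<in> forms"
    "\<And>I. I \<in> index_sets \<Longrightarrow> Poly_Mapping.lookup x I = Poly_Mapping.lookup y I"
  show "Poly_Mapping.lookup x I = Poly_Mapping.lookup y I"
  proof (cases "I \<in> index_sets")
    case False
    then have "I \<notin> Poly_Mapping.keys x" "I \<notin> Poly_Mapping.keys y"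
      using * by (auto simp: forms_iff)
    then show ?thesis by (simp add: in_keys_iff)
  qed (use * in simp)
qed

lemma ext_induct [case_names add Mon]:
  fixes x :: "'a::field ext"
  assumes "\<And>x y. P x \<Longrightarrow> P y \<Longrightarrow> P (x + y)"
    and "\<And>c I. I \<in> index_sets \<Longrightarrow> P (scl c (Mon I))"
  shows "P x"
proof -
  \<comment> \<open>Membership is carried along because \<open>ext_of\<close> is known to respect
    sums only on \<open>forms\<close>.\<close>
  have "y \<in> forms \<and> P (ext_of y)" if "y \<in> forms" for y :: "'a form"
    using that
  proof (induction rule: forms_induct)
    case (add x y)
    then show ?case
      using assms(1)[of "ext_of x" "ext_of y"] by (simp add: plus_ext.abs_eq eq_onp_def forms_add)
  next
    case (mon c I)
    have "ext_of (fscale c (mon I)) = scl c (Mon I)"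
      using mon mon_in_forms[OF mon, where ?'a = 'a] by (simp add: Mon_def scl.abs_eq eq_onp_def)
    then show ?case
      using assms(2)[OF mon, of c] mon by (simp add: forms_fscale mon_in_forms)
  qed
  then show ?thesis
    using form_of[of x] form_of_inverse[of x] by metis
qed

definition supp :: "'a::field ext \<Rightarrow> nat set set"
  where "supp x = {I. coef x I \<noteq> 0}"

lemma supp_index_sets: "supp x \<subseteq> index_sets"
  unfolding supp_def by transfer (auto simp: forms_iff in_keys_iff subset_iff)

lemma finite_supp: "finite (supp x)"
  unfolding supp_def by transfer simp

lemma ext_expand: "x = (\<Sum>I\<in>supp x. scl (coef x I) (Mon I))"
proof (rule ext_eqI)
  fix J :: "nat set"
  assume "J \<in> index_sets"
  have "coef (\<Sum>I\<in>supp x. scl (coef x I) (Mon I)) J = (\<Sum>I\<in>supp x. if I = J then coef x J else 0)"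
    unfolding coef_sum
  proof (rule sum.cong)
    fix I
    assume "I \<in> supp x"
    then have "I \<in> index_sets" using supp_index_sets by blast
    then show "coef (scl (coef x I) (Mon I)) J = (if I = J then coef x J else 0)"
      by (simp add: coef_scl coef_Mon)
  qed simp
  also have "\<dots> = coef x J"
    by (simp add: sum.delta finite_supp) (simp add: supp_def)
  finally show "coef x J = coef (\<Sum>I\<in>supp x. scl (coef x I) (Mon I)) J" ..
qed

section \<open>Linear operators on the algebra\<close>

definition lin_op :: "('a::field ext \<Rightarrow> 'a ext) \<Rightarrow> bool"
  where "lin_op f \<longleftrightarrow> (\<forall>x y. f (x + y) = f x + f y) \<and> (\<forall>c x. f (scl c x) = scl c (f x))"

lemma lin_opI:
  "(\<And>x y. f (x + y) = f x + f y) \<Longrightarrow> (\<And>c x. f (scl c x) = scl c (f x)) \<Longrightarrow> lin_op f"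
  by (simp add: lin_op_def)

context
  fixes f :: "'a::field ext \<Rightarrow> 'a ext"
  assumes f: "lin_op f"
begin

lemma lin_op_add: "f (x + y) = f x + f y"
  and lin_op_scl: "f (scl c x) = scl c (f x)"
  using f by (simp_all add: lin_op_def)

lemma lin_op_zero: "f 0 = 0"
  using lin_op_scl[of 0 0] by simp

lemma lin_op_minus: "f (- x) = - f x"
  using lin_op_scl[of "- 1" x] by simp

lemma lin_op_diff: "f (x - y) = f x - f y"
  using lin_op_add[of x "- y"] by (simp add: lin_op_minus)

lemma lin_op_sum: "f (sum g A) = (\<Sum>i\<in>A. f (g i))"
  by (induction A rule: infinite_finite_induct) (simp_all add: lin_op_add lin_op_zero)

lemma lin_op_expand: "f x = (\<Sum>I\<in>supp x. scl (coef x I) (f (Mon I)))"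
  by (subst ext_expand) (simp add: lin_op_sum lin_op_scl)

end

lift_definition lin :: "(nat set \<Rightarrow> 'a::field ext) \<Rightarrow> 'a ext \<Rightarrow> 'a ext" is lin_ext
  by (rule lin_ext_in_forms)

lemma lin_op_lin: "lin_op (lin g)"
  unfolding lin_op_def by transfer (simp add: lin_ext_add lin_ext_fscale)

lemma lin_Mon: "I \<in> index_sets \<Longrightarrow> lin g (Mon I) = g I"
  by transfer simp

lemma lin_expand: "lin g x = (\<Sum>I\<in>supp x. scl (coef x I) (g I))"
  unfolding lin_op_expand[OF lin_op_lin, of g x] using supp_index_sets[of x]
  by (intro sum.cong) (auto simp: lin_Mon)

section \<open>Products of generators and monomials\<close>

lemma index_sets_insert [simp]: "insert i I \<in> index_sets \<longleftrightarrow> i \<noteq> 0 \<and> I \<in> index_sets"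
  by (auto simp: index_sets_def)

lemma index_sets_empty [simp]: "{} \<in> index_sets"
  by (simp add: index_sets_def)

lemma index_sets_Diff: "I \<in> index_sets \<Longrightarrow> I - A \<in> index_sets"
  by (simp add: index_sets_def)

lemma E_mult_Mon:
  assumes "I \<in> index_sets" "i \<noteq> 0" "i \<notin> I"
  shows "E i * Mon I = scl ((- 1) ^ inversions {i} I) (Mon (insert i I))"
  using assms unfolding E_def
  by transfer (simp add: wedge_mon_mon mon_wedge_eq del: minus_one_power_iff)

lemma E_mult_Mon_in:
  assumes "i \<in> I"
  shows "E i * Mon I = 0"
  using assms unfolding E_def
  by transfer (auto simp: wedge_mon_mon mon_wedge_eq)

lemma E_mult_Mon_less:
  assumes "I \<in> index_sets" "i \<noteq> 0" "\<And>j. j \<in> I \<Longrightarrow> i < j"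
  shows "E i * Mon I = Mon (insert i I)"
proof -
  have "{(i', j). i' \<in> {i} \<and> j \<in> I \<and> j < i'} = {}"
    using assms(3) by force
  then have "inversions {i} I = 0"
    unfolding inversions_def by (simp only: card.empty)
  then show ?thesis
    using assms E_mult_Mon[of I i] by auto
qed

lemma Mon_mult_E_greater:
  assumes "I \<in> index_sets" "i \<noteq> 0" "\<And>j. j \<in> I \<Longrightarrow> j < i"
  shows "Mon I * E i = Mon (insert i I)"
proof -
  have "{(i', j). i' \<in> I \<and> j \<in> {i} \<and> j < i'} = {}"
    using assms(3) by force
  then have "inversions I {i} = 0"
    unfolding inversions_def by (simp only: card.empty)
  moreover have "i \<notin> I"
    using assms(3) by blast
  ultimately show ?thesis
    using assms(1,2) unfolding E_def
    by transfer (simp add: wedge_mon_mon mon_wedge_eq)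
qed

lemma E_square: "E i * E i = 0"
  unfolding E_def[of i] by (subst E_def[symmetric], rule E_mult_Mon_in) simp

lemma E_anticommute: "E i * E j = - (E j * E i :: 'a::field ext)"
proof -
  have *: "E i * E j = - (E j * E i :: 'a ext)" if "i < j" "i \<noteq> 0" for i j :: nat
  proof -
    have "{(i', k). i' \<in> {j} \<and> k \<in> {i} \<and> k < i'} = {(j, i)}"
      using that by auto
    then have "inversions {j} {i} = 1"
      unfolding inversions_def by (simp only: card.empty card.insert) simp
    then have "E j * Mon {i} = - (Mon {j, i} :: 'a ext)"
      using that by (subst E_mult_Mon) auto
    moreover have "E i * Mon {j} = (Mon {i, j} :: 'a ext)"
      using that by (subst E_mult_Mon_less) auto
    ultimately show ?thesis
      by (simp add: insert_commute flip: E_def)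
  qed
  show ?thesis
  proof (cases i j rule: linorder_cases)
    case less
    then show ?thesis using * by (cases "i = 0") auto
  next
    case equal
    then show ?thesis by (simp add: E_square)
  next
    case greater
    then show ?thesis using *[of j i] by (cases "j = 0") auto
  qed
qed

text \<open>Multiplying on the left by the indices in decreasing order builds the monomial without
  any sign.\<close>

lemma Mon_eq_E_mult:
  fixes P :: "'a::field ext \<Rightarrow> bool"
  assumes "I \<in> index_sets"
    and "P 1" "\<And>i x. i \<in> I \<Longrightarrow> P x \<Longrightarrow> P (E i * x)"
  shows "P (Mon I)"
proof -
  have "finite I" "0 \<notin> I"
    using assms(1) by (auto simp: index_sets_def)
  then show ?thesis
    using assms(3)
  proof (induction rule: finite_linorder_min_induct)
    case empty
    then show ?case using assms(2) by simp
  next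
    case (insert i I)
    then have "I \<in> index_sets"
      by (simp add: index_sets_def)
    with insert show ?case
      using E_mult_Mon_less[of I i] by (metis insertCI)
  qed
qed

text \<open>The e^i generate the algebra, so an identity of linear maps only has to pass from x to
  e^i wedge x.\<close>

lemma ext_gen_induct [case_names one add scl gen]:
  fixes x :: "'a::field ext"
  assumes "P 1" "\<And>x y. P x \<Longrightarrow> P y \<Longrightarrow> P (x + y)" "\<And>c x. P x \<Longrightarrow> P (scl c x)"
    and "\<And>i x. P x \<Longrightarrow> P (E i * x)"
  shows "P x"
  by (induction x rule: ext_induct) (auto intro: assms Mon_eq_E_mult)


section \<open>Derivations\<close>

definition gderiv :: "'a::field \<Rightarrow> (nat \<Rightarrow> 'a ext) \<Rightarrow> 'a ext \<Rightarrow> 'a ext"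
  where "gderiv s f x = ext_of (deriv_ext s (\<lambda>i. form_of (f i)) (form_of x))"

lemma form_of_gderiv: "form_of (gderiv s f x) = deriv_ext s (\<lambda>i. form_of (f i)) (form_of x)"
  unfolding gderiv_def by (intro ext_of_inverse deriv_ext_in_forms form_of)

lemma lin_op_gderiv: "lin_op (gderiv s f)"
  by (rule lin_opI; simp flip: form_of_inject
      add: form_of_gderiv plus_ext.rep_eq scl.rep_eq deriv_ext_def lin_ext_add lin_ext_fscale)

lemma gderiv_one [simp]: "gderiv s f 1 = 0"
  by (simp flip: form_of_inject add: form_of_gderiv one_ext.rep_eq zero_ext.rep_eq deriv_ext_def)

text \<open>\<open>leibniz\<close> recurses along the sorted list, so the Leibniz rule is immediate
  only for the smallest index.\<close>

lemma gderiv_Mon_insert: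
  assumes "I \<in> index_sets" "i \<noteq> 0" "\<And>j. j \<in> I \<Longrightarrow> i < j"
  shows "gderiv s f (Mon (insert i I)) = f i * Mon I + scl s (E i * gderiv s f (Mon I))"
proof -
  have fin: "finite I" using assms(1) by (simp add: index_sets_def)
  have "sorted_list_of_set (insert i I) = i # sorted_list_of_set I"
    using fin assms(3)
    by (intro sorted_distinct_set_unique)
      (auto simp: insort_is_Cons less_imp_le sorted_list_of_set_insert_remove[OF fin]
        simp del: sorted_list_of_set_insert_remove)
  then show ?thesis
    using assms fin
    by (simp flip: form_of_inject add: form_of_gderiv plus_ext.rep_eq times_ext.rep_eq scl.rep_eq
        Mon.rep_eq E_def deriv_ext_def)
qed

text \<open>Extends the rule to e^i in any position. \<open>comm\<close> says that the prescribed
  values respect the relation between e^i and e^j, so the order in which generators are split off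
  does not matter; for i = j it makes both sides vanish.\<close>

lemma gderiv_E_mult:
  fixes f :: "nat \<Rightarrow> 'a::field ext"
  assumes s: "s * s = 1" and comm: "\<And>i j. f i * E j + scl s (E j * f i) = 0" and f0: "f 0 = 0"
  shows "gderiv s f (E i * x) = f i * x + scl s (E i * gderiv s f x)"
proof -
  note lin = lin_op_add[OF lin_op_gderiv] lin_op_scl[OF lin_op_gderiv] lin_op_zero[OF lin_op_gderiv]
    lin_op_minus[OF lin_op_gderiv]
  have "gderiv s f (E i * Mon I) = f i * Mon I + scl s (E i * gderiv s f (Mon I))"
    if "I \<in> index_sets" for I i
  proof (cases "i = 0")
    case True
    then show ?thesis by (simp add: f0 lin)
  next
    case i: False
    have "finite I" "0 \<notin> I" using that by (auto simp: index_sets_def)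
    then show ?thesis
      using i
    proof (induction I arbitrary: i rule: finite_linorder_min_induct)
      case empty
      then show ?case
        using gderiv_Mon_insert[of "{}" i s f] E_mult_Mon_less[of "{}" i, where ?'a = 'a]
        by simp
    next
      case (insert j J)
      then have J: "J \<in> index_sets" "j \<noteq> 0" "\<And>k. k \<in> J \<Longrightarrow> j < k"
        by (auto simp: index_sets_def)
      show ?case
      proof (cases "i < j")
        case True
        then have *: "insert j J \<in> index_sets" "\<And>k. k \<in> insert j J \<Longrightarrow> i < k"
          using J by fastforce+
        then show ?thesis
          using gderiv_Mon_insert[of "insert j J" i s f] insert.prems E_mult_Mon_less[of "insert j J" i, where ?'a = 'a] by simp
      next
        case False
        have jJ: "Mon (insert j J) = E j * (Mon J :: 'a ext)"
          using E_mult_Mon_less[OF J, where ?'a = 'a] by simp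
        have Dj: "gderiv s f (E j * Mon J) = f j * Mon J + scl s (E j * gderiv s f (Mon J))"
          using gderiv_Mon_insert[OF J, of s f] jJ by simp
        have IH: "gderiv s f (E i * Mon J) = f i * Mon J + scl s (E i * gderiv s f (Mon J))"
          using insert.IH insert.prems by auto
        \<comment> \<open>Here j lies below all indices of \<open>insert i J\<close>, so it may be
          split off first.\<close>
        have Dji: "gderiv s f (E j * (E i * Mon J)) =
          f j * (E i * Mon J) + scl s (E j * gderiv s f (E i * Mon J))"
          if "i \<noteq> j"
        proof (cases "i \<in> J")
          case True
          then show ?thesis by (simp add: E_mult_Mon_in lin)
        next
          case False
          have *: "insert i J \<in> index_sets" "\<And>k. k \<in> insert i J \<Longrightarrow> j < k"
            using J insert.prems \<open>\<not> i < j\<close> that by fastforce+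
          have "gderiv s f (E j * Mon (insert i J)) =
              f j * Mon (insert i J) + scl s (E j * gderiv s f (Mon (insert i J)))"
            using gderiv_Mon_insert[OF *(1) J(2) *(2), of s f]
              E_mult_Mon_less[OF *(1) J(2) *(2), where ?'a = 'a] by simp
          moreover have "E i * Mon J = scl ((- 1) ^ inversions {i} J) (Mon (insert i J) :: 'a ext)"
            using J(1) insert.prems(2) False by (rule E_mult_Mon)
          ultimately show ?thesis
            by (simp only: scl_mult_right lin ext.scale_right_distrib ext.scale_left_commute[of s])
        qed
        define m g :: "'a ext" where "m = Mon J" and "g = gderiv s f (Mon J)"
        have ss: "scl s (scl s y) = y" for y :: "'a ext"
          using s by simp
        have "E i * (E j * m) = - (E j * (E i * m))"
          using arg_cong[OF E_anticommute[of i j, where ?'a = 'a], of "\<lambda>y. y * m"] by (simp add: mult.assoc)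
        \<comment> \<open>The factors are exchanged so that the smaller index j comes first and
          \<open>Dji\<close> applies.\<close>
        then have 1: "gderiv s f (E i * (E j * m)) =
          - (f j * E i * m + scl s (E j * f i) * m + E j * E i * g)"
          if "i \<noteq> j"
          using Dji[OF that] unfolding m_def g_def
          by (simp only: IH lin ext.scale_right_distrib distrib_left scl_mult_right
              scl_mult_left mult.assoc ss add.assoc)
        have 2: "f i * (E j * m) + scl s (E i * gderiv s f (E j * m)) =
          f i * E j * m + scl s (E i * f j) * m + E i * E j * g"
          unfolding m_def g_def Dj
          by (simp only: ext.scale_right_distrib distrib_left scl_mult_right scl_mult_left
              mult.assoc ss add.assoc)
        have *: "f i * E j = - scl s (E j * f i)" "f j * E i = - scl s (E i * f j)"
          using comm[of i j] comm[of j i] by (simp_all add: eq_neg_iff_add_eq_0)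
        show ?thesis
        proof (cases "i = j")
          case True
          then have "E i * (E j * m) = 0" "E i * E j * g = 0"
            by (simp_all add: E_square flip: mult.assoc)
          moreover have "f i * E j * m + scl s (E i * f j) * m = 0"
            using *(1) True by simp
          ultimately show ?thesis
            using 2 unfolding jJ m_def by (simp add: lin)
        next
          case False
          have "E j * E i = - (E i * E j :: 'a ext)" by (rule E_anticommute)
          then show ?thesis
            unfolding jJ m_def[symmetric] 2 1[OF False] * by simp
        qed
      qed
    qed
  qed
  then have "gderiv s f (E i * scl c (Mon I)) = f i * scl c (Mon I) + scl s (E i * gderiv s f (scl c (Mon I)))"
    if "I \<in> index_sets" for c I
    using that
    by (simp only: lin scl_mult_right ext.scale_right_distrib ext.scale_left_commute[of s])
  then show ?thesis
    by (induction x rule: ext_induct)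
       (simp_all only: distrib_left lin ext.scale_right_distrib add_ac)
qed

definition derivation :: "('a::field ext \<Rightarrow> 'a ext) \<Rightarrow> bool"
  where "derivation D \<longleftrightarrow> lin_op D \<and> (\<forall>x y. D (x * y) = D x * y + x * D y)"

lemma derivation_lin_op: "derivation D \<Longrightarrow> lin_op D"
  and derivation_mult: "derivation D \<Longrightarrow> D (x * y) = D x * y + x * D y"
  by (simp_all add: derivation_def)

lemma derivation_one: "derivation D \<Longrightarrow> D 1 = 0"
  using derivation_mult[of D 1 1] by simp

lemma derivation_gderiv:
  fixes f :: "nat \<Rightarrow> 'a::field ext"
  assumes "\<And>i j. f i * E j = - (E j * f i)" "f 0 = 0"
  shows "derivation (gderiv 1 f)" and "gderiv 1 f (E i) = f i"
proof -
  have E: "gderiv 1 f (E i * x) = f i * x + E i * gderiv 1 f x" for i x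
    using gderiv_E_mult[of 1 f i x] assms by simp
  then show "gderiv 1 f (E i) = f i"
    using E[of i 1] by simp
  have "gderiv 1 f (x * y) = gderiv 1 f x * y + x * gderiv 1 f y" for x y
    by (induction x rule: ext_gen_induct)
       (simp_all add: E lin_op_add[OF lin_op_gderiv] lin_op_scl[OF lin_op_gderiv] distrib_left
         distrib_right scl_mult_left mult.assoc ext.scale_right_distrib add_ac)
  then show "derivation (gderiv 1 f)"
    by (simp add: derivation_def lin_op_gderiv)
qed

text \<open>The commutator of two derivations is a derivation, hence determined by its values on
  generators.\<close>

lemma derivations_commute:
  assumes D: "derivation D" "derivation D'" and comm: "\<And>i. D (D' (E i)) = D' (D (E i))"
  shows "D (D' x) = D' (D x)"
  using D[THEN derivation_one] D[THEN derivation_lin_op, THEN lin_op_zero]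
  by (induction x rule: ext_gen_induct)
     (simp_all add: D[THEN derivation_mult] D[THEN derivation_lin_op, THEN lin_op_add]
       D[THEN derivation_lin_op, THEN lin_op_scl] comm add_ac)


section \<open>Subalgebras spanned by monomials\<close>

text \<open>Records which indices occur: \<open>{2..}\<close> means free of e^1, and
  \<open>{3..<n}\<close> means that e^n can be appended to every monomial without a sign.\<close>

definition subalg :: "nat set \<Rightarrow> 'a::field ext set"
  where "subalg S = {x. \<forall>I\<in>supp x. I \<subseteq> S}"

lemma subalg_zero [simp]: "0 \<in> subalg S"
  by (simp add: subalg_def supp_def)

lemma subalg_add: "x \<in> subalg S \<Longrightarrow> y \<in> subalg S \<Longrightarrow> x + y \<in> subalg S"
proof -
  assume "x \<in> subalg S" "y \<in> subalg S"
  moreover have "supp (x + y) \<subseteq> supp x \<union> supp y"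
    by (auto simp: supp_def coef_add)
  ultimately show "x + y \<in> subalg S"
    unfolding subalg_def by blast
qed

lemma subalg_scl:
  assumes "x \<in> subalg S"
  shows "scl c x \<in> subalg S"
proof -
  have "supp (scl c x) \<subseteq> supp x"
    by (auto simp: supp_def coef_scl)
  then show ?thesis
    using assms unfolding subalg_def by blast
qed

lemma subalg_minus: "x \<in> subalg S \<Longrightarrow> - x \<in> subalg S"
  using subalg_scl[of x S "- 1"] by simp

lemma subalg_diff: "x \<in> subalg S \<Longrightarrow> y \<in> subalg S \<Longrightarrow> x - y \<in> subalg S"
  using subalg_add[of x S "- y"] by (simp add: subalg_minus)

lemma subalg_mono: "x \<in> subalg S \<Longrightarrow> S \<subseteq> T \<Longrightarrow> x \<in> subalg T"
  unfolding subalg_def by blast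

lemma Mon_not_index_set: "I \<notin> index_sets \<Longrightarrow> Mon I = 0"
  by transfer simp

lemma Mon_in_subalg:
  assumes "I \<subseteq> S"
  shows "Mon I \<in> subalg S"
proof (cases "I \<in> index_sets")
  case True
  then show ?thesis
    using assms by (simp add: subalg_def supp_def coef_Mon)
qed (simp add: Mon_not_index_set)

lemma E_in_subalg: "i \<in> S \<Longrightarrow> E i \<in> subalg S"
  by (simp add: E_def Mon_in_subalg)

lemma one_in_subalg: "1 \<in> subalg S"
  using Mon_in_subalg[of "{}" S] by simp

lemma subalg_induct [consumes 1, case_names zero add Mon]:
  assumes "x \<in> subalg S"
    and "P 0" "\<And>x y. P x \<Longrightarrow> P y \<Longrightarrow> P (x + y)"
    and "\<And>c I. I \<in> index_sets \<Longrightarrow> I \<subseteq> S \<Longrightarrow> P (scl c (Mon I))"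
  shows "P x"
proof -
  have "P (\<Sum>I\<in>A. scl (coef x I) (Mon I))" if "A \<subseteq> supp x" for A
    using that supp_index_sets[of x] assms(1)
    by (induction A rule: infinite_finite_induct) (auto simp: subalg_def intro!: assms(2-4))
  from this[OF order.refl] show ?thesis
    by (simp flip: ext_expand)
qed

lemma E_mult_in_subalg:
  fixes x :: "'a::field ext"
  assumes "i \<in> S" "x \<in> subalg S"
  shows "E i * x \<in> subalg S"
  using assms(2)
proof (induction rule: subalg_induct)
  case (Mon c I)
  have "E i * Mon I \<in> (subalg S :: 'a ext set)"
  proof (cases "i = 0 \<or> i \<in> I")
    case True
    then show ?thesis by (auto simp: E_mult_Mon_in)
  next
    case False
    then show ?thesis
      using Mon assms(1) by (simp add: E_mult_Mon subalg_scl Mon_in_subalg)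
  qed
  then show ?case by (simp add: scl_mult_right subalg_scl)
qed (simp_all add: distrib_left subalg_add)

lemma subalg_gen_induct [consumes 1, case_names one add scl gen]:
  assumes "x \<in> subalg S"
    and "P 1" "\<And>x y. P x \<Longrightarrow> P y \<Longrightarrow> P (x + y)" "\<And>c x. P x \<Longrightarrow> P (scl c x)"
    and "\<And>i x. i \<in> S \<Longrightarrow> P x \<Longrightarrow> P (E i * x)"
  shows "P x"
  using assms(1)
proof (induction rule: subalg_induct)
  case zero
  show ?case using assms(4)[OF assms(2), of 0] by simp
next
  case (Mon c I)
  have "P (Mon I)"
    using Mon by (intro Mon_eq_E_mult[of I P] assms(2) assms(5)) auto
  then show ?case by (rule assms(4))
qed (rule assms(3))

lemma subalg_mult: "x \<in> subalg S \<Longrightarrow> y \<in> subalg S \<Longrightarrow> x * y \<in> subalg S"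
  by (induction rule: subalg_gen_induct)
     (simp_all add: distrib_right scl_mult_left mult.assoc subalg_add subalg_scl E_mult_in_subalg)

lemma derivation_subalg:
  assumes D: "derivation D" and "\<And>i. i \<in> S \<Longrightarrow> D (E i) \<in> subalg T" "S \<subseteq> T" and x: "x \<in> subalg S"
  shows "D x \<in> subalg T"
proof -
  have "D x \<in> subalg T \<and> x \<in> subalg T"
    using x
  proof (induction rule: subalg_gen_induct)
    case (gen i x)
    then show ?case
      using assms(2)[of i] assms(3)
      by (simp add: derivation_mult[OF D] subalg_add subalg_mult E_in_subalg subsetD)
  qed (simp_all add: derivation_one[OF D] one_in_subalg lin_op_add[OF derivation_lin_op[OF D]]
      lin_op_scl[OF derivation_lin_op[OF D]] subalg_add subalg_scl)
  then show ?thesis ..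
qed

lemma E_mult_E_mult: "E i * (E j * x) = - (E j * (E i * x))"
  using arg_cong[OF E_anticommute[of i j, where ?'a = 'a], of "\<lambda>y. y * x"] by (simp add: mult.assoc)

lemma E_square_mult: "E i * (E i * x) = 0"
  by (simp add: E_square flip: mult.assoc)

text \<open>Carrying e^i across x changes only signs, until it meets itself.\<close>

lemma E_mult_mult_E: "E i * x * E i = 0"
proof (induction x rule: ext_gen_induct)
  case (gen j x)
  then show ?case by (simp add: E_mult_E_mult[of i j] mult.assoc)
qed (simp_all add: E_square distrib_left distrib_right scl_mult_left scl_mult_right)

text \<open>The cut-off makes \<open>ad1 (Ef 3 (n + 1)) = Ef 3 n\<close> and its analogues hold for every \<open>n\<close>.\<close>

definition Ef :: "nat \<Rightarrow> nat \<Rightarrow> 'a::field ext"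
  where "Ef k i = (if k \<le> i then E i else 0)"

lemma Ef_anticommute: "Ef k i * E j = - (E j * Ef k i)"
  using E_anticommute by (auto simp: Ef_def)

lemma Ef_square: "Ef k i * Ef k i = 0"
  by (simp add: Ef_def E_square)

section \<open>The operators of the complex on the ring\<close>

definition ad1 :: "'a::field ext \<Rightarrow> 'a ext"
  where "ad1 = gderiv 1 (\<lambda>i. Ef 3 (i - 1))"

definition ad2 :: "'a::field ext \<Rightarrow> 'a ext"
  where "ad2 = gderiv 1 (\<lambda>i. Ef 3 (i - 2))"

definition del1 :: "'a::field ext \<Rightarrow> 'a ext"
  where "del1 = gderiv 1 (\<lambda>i. Ef 2 (i - 1))"

text \<open>The cut-offs of \<open>Ef\<close> absorb the exceptional values de^1, ..., de^4 into the
  formula for de^k with k \<ge> 5.\<close>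

definition dE :: "'a::field ext \<Rightarrow> 'a ext"
  where "dE = gderiv (- 1) (\<lambda>i. E 1 * Ef 2 (i - 1) + E 2 * Ef 3 (i - 2))"

lemma form_of_E: "form_of (E i) = (if i = 0 then 0 else e i)"
  unfolding E_def by transfer simp

lemma deriv_ext_cong:
  assumes "\<And>i. i \<noteq> 0 \<Longrightarrow> f i = g i" "x \<in> forms"
  shows "deriv_ext s f x = deriv_ext s g x"
  unfolding deriv_ext_def
proof (rule lin_ext_cong)
  fix I
  assume "I \<in> Poly_Mapping.keys x"
  then have "finite I" "0 \<notin> I"
    using assms(2) by (auto simp: forms_iff index_sets_def)
  have "leibniz s f is = leibniz s g is" if "0 \<notin> set is" for "is"
    using that by (induction "is") (auto simp: assms(1))
  then show "leibniz s f (sorted_list_of_set I) = leibniz s g (sorted_list_of_set I)"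
    using \<open>finite I\<close> \<open>0 \<notin> I\<close> by simp
qed

lemma form_of_ad1: "form_of (ad1 x) = ad1_star (form_of x)"
  unfolding ad1_def ad1_star_def form_of_gderiv
  by (rule deriv_ext_cong) (auto simp: Ef_def form_of_E zero_ext.rep_eq form_of)

lemma form_of_ad2: "form_of (ad2 x) = ad2_star (form_of x)"
  unfolding ad2_def ad2_star_def form_of_gderiv
  by (rule deriv_ext_cong) (auto simp: Ef_def form_of_E zero_ext.rep_eq form_of)

lemma form_of_del1: "form_of (del1 x) = D1 (form_of x)"
  unfolding del1_def D1_def form_of_gderiv
  by (rule deriv_ext_cong) (auto simp: Ef_def form_of_E zero_ext.rep_eq form_of)

lemma form_of_dE: "form_of (dE x) = d (form_of x)"
  unfolding dE_def d_def form_of_gderiv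
proof (rule deriv_ext_cong)
  fix i :: nat
  assume "i \<noteq> 0"
  then consider "i = 1" | "i = 2" | "i = 3" | "i = 4" | "5 \<le> i" by linarith
  then show "form_of (E 1 * Ef 2 (i - 1) + E 2 * Ef 3 (i - 2)) = d_gen i"
    by cases (auto simp add: Ef_def form_of_E zero_ext.rep_eq plus_ext.rep_eq times_ext.rep_eq d_gen_simps
      d_gen_simps(1)[unfolded One_nat_def]
      del: One_nat_def)
qed (rule form_of)

lemma derivation_ad1: "derivation ad1" and ad1_E: "ad1 (E i) = Ef 3 (i - 1)"
  unfolding ad1_def by (rule derivation_gderiv; simp add: Ef_anticommute; simp add: Ef_def)+

lemma derivation_ad2: "derivation ad2" and ad2_E: "ad2 (E i) = Ef 3 (i - 2)"
  unfolding ad2_def by (rule derivation_gderiv; simp add: Ef_anticommute; simp add: Ef_def)+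

lemma derivation_del1: "derivation del1" and del1_E: "del1 (E i) = Ef 2 (i - 1)"
  unfolding del1_def by (rule derivation_gderiv; simp add: Ef_anticommute; simp add: Ef_def)+

lemmas lin_op_ad1 = derivation_lin_op[OF derivation_ad1]
lemmas lin_op_ad2 = derivation_lin_op[OF derivation_ad2]
lemmas lin_op_del1 = derivation_lin_op[OF derivation_del1]

lemma ad1_Ef: "ad1 (Ef 3 (Suc n)) = Ef 3 n"
  and ad2_Ef: "ad2 (Ef 3 (Suc (Suc n))) = Ef 3 n"
  and del1_Ef: "del1 (Ef 2 (Suc n)) = Ef 2 n"
  by (auto simp: Ef_def[of _ "Suc _"] ad1_E ad2_E del1_E lin_op_zero[OF lin_op_ad1]
      lin_op_zero[OF lin_op_ad2] lin_op_zero[OF lin_op_del1]) (auto simp: Ef_def)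

text \<open>On e^i both orders give e^(i-3), cut off below 3. By contrast, \<open>del1\<close> and
  \<open>ad2\<close> fail to commute on e^5.\<close>

lemma ad1_ad2: "ad1 (ad2 x) = ad2 (ad1 x :: 'a::field ext)"
proof (rule derivations_commute[OF derivation_ad1 derivation_ad2])
  fix i
  have "ad1 (Ef 3 n) = (Ef 3 (n - 1) :: 'a ext)" "ad2 (Ef 3 n) = (Ef 3 (n - 2) :: 'a ext)" for n
    by (auto simp: Ef_def[of 3 n] ad1_E ad2_E lin_op_zero[OF lin_op_ad1] lin_op_zero[OF lin_op_ad2])
       (auto simp: Ef_def)
  then show "ad1 (ad2 (E i)) = (ad2 (ad1 (E i)) :: 'a ext)"
    by (simp add: ad1_E ad2_E diff_commute del: One_nat_def)
qed

text \<open>A derivation followed by left multiplication with e^1 or e^2 is an antiderivation, as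
  passing e^i costs a sign; so both sides obey the same rule.\<close>

lemma dE_eq: "dE x = E 1 * del1 x + E 2 * ad2 x"
proof (induction x rule: ext_gen_induct)
  case (gen i x)
  let ?f = "\<lambda>i. E 1 * Ef 2 (i - 1) + E 2 * Ef 3 (i - 2) :: 'a ext"
  have comm: "?f i * E j + scl (- 1) (E j * ?f i) = 0" for i j
    by (simp add: distrib_left distrib_right E_mult_E_mult[of j] Ef_anticommute mult.assoc)
  have "dE (E i * x) = ?f i * x - E i * dE x"
    unfolding dE_def by (subst gderiv_E_mult[OF _ comm]) (simp_all add: Ef_def)
  also have "\<dots> = E 1 * del1 (E i * x) + E 2 * ad2 (E i * x)"
    unfolding gen derivation_mult[OF derivation_del1] derivation_mult[OF derivation_ad2] del1_E ad2_E
    by (simp add: distrib_left distrib_right mult.assoc E_mult_E_mult[of i])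
  finally show ?case .
qed (simp_all add: dE_def lin_op_add[OF lin_op_gderiv] lin_op_scl[OF lin_op_gderiv]
    lin_op_add[OF lin_op_del1] lin_op_scl[OF lin_op_del1] lin_op_add[OF lin_op_ad2]
    lin_op_scl[OF lin_op_ad2] derivation_one[OF derivation_del1] derivation_one[OF derivation_ad2]
    distrib_left ext.scale_right_distrib scl_mult_right add_ac)

lemma lin_op_dE: "lin_op dE"
  unfolding dE_def by (rule lin_op_gderiv)

lemma ad1_E2_mult: "ad1 (E 2 * x) = E 2 * ad1 x"
  and ad2_E2_mult: "ad2 (E 2 * x) = E 2 * ad2 x"
  and del1_E2_mult: "del1 (E 2 * x) = E 2 * del1 x"
  and ad2_E1_mult: "ad2 (E 1 * x) = E 1 * ad2 x"
  and del1_E1_mult: "del1 (E 1 * x) = E 1 * del1 x"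
  by (simp_all add: derivation_mult[OF derivation_ad1] derivation_mult[OF derivation_ad2]
      derivation_mult[OF derivation_del1] ad1_E ad2_E del1_E Ef_def)

text \<open>\<open>del1\<close> and \<open>ad1\<close> differ on generators only at e^3, where
  \<open>del1\<close> gives e^2, and e^2 wedge e^2 = 0.\<close>

lemma E2_del1: "E 2 * del1 x = E 2 * ad1 x"
proof (induction x rule: ext_gen_induct)
  case (gen i x)
  have "E 2 * Ef 2 (i - 1) = (E 2 * Ef 3 (i - 1) :: 'a ext)"
    by (cases "i = 3") (auto simp: Ef_def E_square)
  then have "E 2 * (Ef 2 (i - 1) * x) = E 2 * (Ef 3 (i - 1) * x)"
    by (simp flip: mult.assoc)
  with gen show ?case
    by (simp add: derivation_mult[OF derivation_ad1] derivation_mult[OF derivation_del1] ad1_E del1_E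
        distrib_left E_mult_E_mult[of 2 i])
qed (simp_all add: lin_op_add[OF lin_op_del1] lin_op_scl[OF lin_op_del1] lin_op_add[OF lin_op_ad1]
    lin_op_scl[OF lin_op_ad1] derivation_one[OF derivation_del1] derivation_one[OF derivation_ad1]
    distrib_left scl_mult_right)

text \<open>The two mixed terms differ by the commutator of \<open>del1\<close> and
  \<open>ad2\<close>; behind e^2, \<open>del1\<close> becomes \<open>ad1\<close>, which commutes
  with \<open>ad2\<close>.\<close>

lemma dE_dE: "dE (dE x) = 0"
proof -
  have "dE (dE x) = E 1 * (E 2 * del1 (ad2 x)) + E 2 * (E 1 * ad2 (del1 x))"
    by (simp add: dE_eq lin_op_add[OF lin_op_del1] lin_op_add[OF lin_op_ad2] ad2_E2_mult del1_E2_mult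
        ad2_E1_mult del1_E1_mult distrib_left E_square_mult del: One_nat_def)
  also have "\<dots> = E 1 * (E 2 * ad1 (ad2 x) - ad2 (E 2 * del1 x))"
    by (simp add: E_mult_E_mult[of 2 1] E2_del1[of "ad2 x"] ad2_E2_mult right_diff_distrib
        del: One_nat_def)
  also have "\<dots> = 0"
    by (simp add: E2_del1 ad2_E2_mult ad1_ad2)
  finally show ?thesis .
qed

definition cc :: "'a::field ext \<Rightarrow> 'a ext"
  where "cc x = ad2 x + ad1 (ad1 x)"

lemma lin_op_cc: "lin_op cc"
  by (rule lin_opI) (simp_all add: cc_def lin_op_add[OF lin_op_ad1] lin_op_add[OF lin_op_ad2]
      lin_op_scl[OF lin_op_ad1] lin_op_scl[OF lin_op_ad2] ext.scale_right_distrib add_ac)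


section \<open>The bigrading and local nilpotency\<close>

definition hom :: "nat \<Rightarrow> int \<Rightarrow> 'a::field ext set"
  where "hom q k = {x. form_of x \<in> \<Lambda> q k}"

lemma hom_zero [simp]: "0 \<in> hom q k"
  and hom_add: "x \<in> hom q k \<Longrightarrow> y \<in> hom q k \<Longrightarrow> x + y \<in> hom q k"
  and hom_diff: "x \<in> hom q k \<Longrightarrow> y \<in> hom q k \<Longrightarrow> x - y \<in> hom q k"
  and hom_scl: "x \<in> hom q k \<Longrightarrow> scl c x \<in> hom q k"
  and hom_mult: "x \<in> hom p a \<Longrightarrow> y \<in> hom q b \<Longrightarrow> x * y \<in> hom (p + q) (a + b)"
  by (simp_all add: hom_def zero_ext.rep_eq plus_ext.rep_eq minus_ext.rep_eq scl.rep_eq times_ext.rep_eq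
      hom_forms_add hom_forms_minus hom_forms_fscale wedge_in_hom_forms)

lemma hom_sum: "(\<And>i. i \<in> A \<Longrightarrow> f i \<in> hom q k) \<Longrightarrow> sum f A \<in> hom q k"
  by (induction A rule: infinite_finite_induct) (simp_all add: hom_add)

lemma Mon_in_hom: "Mon I \<in> hom (card I) (int (\<Sum>I))"
  by (simp add: hom_def Mon.rep_eq mon_in_hom_forms del: of_nat_sum)

lemma E_in_hom: "E i \<in> hom 1 (int i)"
  using Mon_in_hom[of "{i}"] by (simp add: E_def)

lemma Ef_in_hom: "Ef k i \<in> hom 1 (int i)"
  by (simp add: Ef_def E_in_hom del: One_nat_def)

lemma supp_hom: "x \<in> hom q k \<Longrightarrow> I \<in> supp x \<Longrightarrow> card I = q \<and> int (\<Sum>I) = k"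
  unfolding hom_def supp_def by (auto simp: hom_forms_iff coef.rep_eq in_keys_iff)

lemma hom_negative: "x \<in> hom q k \<Longrightarrow> k < 0 \<Longrightarrow> x = 0"
  using supp_hom[of x q k] ext_expand[of x] by (metis not_less of_nat_0_le_iff sum.neutral)

lemma derivation_hom:
  assumes D: "derivation D" and DE: "\<And>i. D (E i) \<in> hom 1 (int i - c)" and x: "x \<in> hom q k"
  shows "D x \<in> hom q (k - c)"
proof -
  have Mon: "D (Mon I) \<in> hom (card I) (int (\<Sum>I) - c)" if "I \<in> index_sets" for I
  proof -
    have "finite I" "0 \<notin> I" using that by (auto simp: index_sets_def)
    then show ?thesis
    proof (induction rule: finite_linorder_min_induct)
      case empty
      then show ?case by (simp add: derivation_one[OF D])
    next
      case (insert i I)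
      then have "Mon (insert i I) = E i * (Mon I :: 'a ext)" "i \<notin> I"
        using E_mult_Mon_less[of I i, where ?'a = 'a] by (auto simp: index_sets_def)
      moreover have "D (E i) * Mon I \<in> hom (1 + card I) ((int i - c) + int (\<Sum>I))"
        by (intro hom_mult DE Mon_in_hom)
      moreover have "E i * D (Mon I) \<in> hom (1 + card I) (int i + (int (\<Sum>I) - c))"
        using insert by (intro hom_mult E_in_hom) auto
      ultimately show ?case
        using insert.hyps by (auto simp: derivation_mult[OF D] algebra_simps intro!: hom_add)
    qed
  qed
  show ?thesis
    unfolding lin_op_expand[OF derivation_lin_op[OF D], of x]
  proof (intro hom_sum hom_scl)
    fix I
    assume "I \<in> supp x"
    then show "D (Mon I) \<in> hom q (k - c)"
      using Mon[of I] supp_hom[OF x] supp_index_sets[of x] by auto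
  qed
qed

lemma ad1_hom: "x \<in> hom q k \<Longrightarrow> ad1 x \<in> hom q (k - 1)"
proof (rule derivation_hom[OF derivation_ad1])
  show "ad1 (E i) \<in> hom 1 (int i - 1)" for i
    using Ef_in_hom[of 3 "i - 1"] by (cases "i = 0") (simp_all add: ad1_E of_nat_diff Ef_def lin_op_zero[OF lin_op_ad1])
qed

lemma ad2_hom: "x \<in> hom q k \<Longrightarrow> ad2 x \<in> hom q (k - 2)"
proof (rule derivation_hom[OF derivation_ad2])
  show "ad2 (E i) \<in> hom 1 (int i - 2)" for i
    using Ef_in_hom[of 3 "i - 2"] by (cases "i < 2") (simp_all add: ad2_E of_nat_diff Ef_def)
qed

lemma del1_hom: "x \<in> hom q k \<Longrightarrow> del1 x \<in> hom q (k - 1)"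
proof (rule derivation_hom[OF derivation_del1])
  show "del1 (E i) \<in> hom 1 (int i - 1)" for i
    using Ef_in_hom[of 2 "i - 1"] by (cases "i = 0") (simp_all add: del1_E of_nat_diff Ef_def lin_op_zero[OF lin_op_del1])
qed

lemma cc_hom: "x \<in> hom q k \<Longrightarrow> cc x \<in> hom q (k - 2)"
  unfolding cc_def using ad1_hom[OF ad1_hom, of x q k] by (intro hom_add ad2_hom) simp_all

definition locally_nilpotent :: "('a::field ext \<Rightarrow> 'a ext) \<Rightarrow> bool"
  where "locally_nilpotent f \<longleftrightarrow> (\<forall>x. \<exists>N. \<forall>n\<ge>N. (f ^^ n) x = 0)"

lemma lin_op_funpow: "lin_op f \<Longrightarrow> lin_op (f ^^ n)"
  by (induction n) (simp_all add: lin_op_def)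

text \<open>The weight drops by at least 1 at each application, and no nonzero form has negative
  weight.\<close>

lemma locally_nilpotentI:
  assumes f: "lin_op f" and hom: "\<And>q k x. x \<in> hom q k \<Longrightarrow> f x \<in> hom q (k - c)" and c: "1 \<le> c"
  shows "locally_nilpotent f"
  unfolding locally_nilpotent_def
proof
  fix x
  show "\<exists>N. \<forall>n\<ge>N. (f ^^ n) x = 0"
  proof (induction x rule: ext_induct)
    case (add x y)
    then obtain N M where "\<forall>n\<ge>N. (f ^^ n) x = 0" "\<forall>n\<ge>M. (f ^^ n) y = 0" by blast
    then show ?case
      by (intro exI[of _ "max N M"]) (simp add: lin_op_add[OF lin_op_funpow[OF f]])
  next
    case (Mon a I)
    have "(f ^^ n) (Mon I) \<in> hom (card I) (int (\<Sum>I) - int n * c)" for n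
    proof (induction n)
      case (Suc n)
      then show ?case using hom[OF Suc] by (simp add: algebra_simps)
    qed (simp add: Mon_in_hom del: of_nat_sum)
    moreover have "int (\<Sum>I) - int n * c < 0" if "\<Sum>I < n" for n
      using that c mult_left_mono[OF c, of "int n"] by linarith
    ultimately have "(f ^^ n) (Mon I) = 0" if "\<Sum>I < n" for n
      using hom_negative that by blast
    then show ?case
      by (intro exI[of _ "Suc (\<Sum>I)"]) (auto simp: lin_op_scl[OF lin_op_funpow[OF f]])
  qed
qed

lemma locally_nilpotent_ad1: "locally_nilpotent ad1"
  by (rule locally_nilpotentI[where c = 1]) (simp_all add: lin_op_ad1 ad1_hom)

lemma locally_nilpotent_del1: "locally_nilpotent del1"
  by (rule locally_nilpotentI[where c = 1]) (simp_all add: lin_op_del1 del1_hom)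

lemma locally_nilpotent_cc: "locally_nilpotent cc"
  by (rule locally_nilpotentI[where c = 2]) (simp_all add: lin_op_cc cc_hom)

text \<open>Turns a recursion that expresses G(x) through G(f x) into an induction: it starts at the
  vanishing power of f and goes back to x.\<close>

lemma locally_nilpotent_induct [consumes 1, case_names zero step]:
  assumes "locally_nilpotent f" "P 0" "\<And>x. P (f x) \<Longrightarrow> P x"
  shows "P x"
proof -
  obtain N where "(f ^^ N) x = 0"
    using assms(1) unfolding locally_nilpotent_def by blast
  then show ?thesis
    by (induction N arbitrary: x) (auto simp: funpow_swap1 intro: assms(2,3))
qed


section \<open>The forms \<open>\<omega>\<close> and \<open>w\<close>\<close>

text \<open>
  With \<open>u = Ef 3\<close>, \<open>stair ad1 u x n\<close> is the form \<open>F(x, n)\<close> of the opening text; replacing \<open>ad1\<close> by \<open>del1\<close>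
  and \<open>Ef 3\<close> by \<open>Ef 2\<close> adds the terms containing \<open>e\<^sup>2\<close>.
\<close>

definition stair :: "('a::field ext \<Rightarrow> 'a ext) \<Rightarrow> (nat \<Rightarrow> 'a ext) \<Rightarrow> 'a ext \<Rightarrow> nat \<Rightarrow> 'a ext"
  where "stair f u x n = Sum_any (\<lambda>l. scl ((- 1) ^ l) ((f ^^ l) x * u (n + l)))"

lemma Sum_any_lessThan:
  fixes g :: "nat \<Rightarrow> 'b::comm_monoid_add"
  assumes "\<And>n. N \<le> n \<Longrightarrow> g n = 0"
  shows "Sum_any g = sum g {..<N}"
  by (rule Sum_any.expand_superset) (use assms not_less in auto)

lemma Sum_any_Suc:
  fixes g :: "nat \<Rightarrow> 'b::comm_monoid_add"
  assumes "\<And>n. N \<le> n \<Longrightarrow> g n = 0"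
  shows "Sum_any g = g 0 + Sum_any (\<lambda>n. g (Suc n))"
proof -
  have "Sum_any g = sum g {..<Suc N}"
    by (rule Sum_any_lessThan) (simp add: assms)
  also have "\<dots> = g 0 + (\<Sum>n<N. g (Suc n))"
    by (rule sum.lessThan_Suc_shift)
  also have "(\<Sum>n<N. g (Suc n)) = Sum_any (\<lambda>n. g (Suc n))"
    by (rule Sum_any_lessThan[symmetric]) (simp add: assms)
  finally show ?thesis .
qed

lemma lin_op_Sum_any:
  assumes f: "lin_op f" and "\<And>n::nat. N \<le> n \<Longrightarrow> g n = 0"
  shows "f (Sum_any g) = Sum_any (\<lambda>n. f (g n))"
  using assms(2) Sum_any_lessThan[of N g] Sum_any_lessThan[of N "\<lambda>n. f (g n)"]
  by (simp add: lin_op_sum[OF f] lin_op_zero[OF f])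

context
  fixes f :: "'a::field ext \<Rightarrow> 'a ext" and u :: "nat \<Rightarrow> 'a ext"
  assumes f: "lin_op f" and nil: "locally_nilpotent f"
begin

text \<open>The term l = 0 is split off; the others form the same sum for \<open>f x\<close> with
  every sign reversed.\<close>

lemma stair_rec: "stair f u x n = x * u n - stair f u (f x) (Suc n)"
proof -
  obtain N where N: "\<And>n. N \<le> n \<Longrightarrow> (f ^^ n) x = 0"
    using nil unfolding locally_nilpotent_def by blast
  let ?g = "\<lambda>l. scl ((- 1) ^ l) ((f ^^ l) x * u (n + l))"
  let ?h = "\<lambda>l. scl ((- 1) ^ l) ((f ^^ l) (f x) * u (Suc n + l))"
  have hN: "?h l = 0" if "N \<le> l" for l
    using N[of "Suc l"] that by (simp add: funpow_swap1)
  have "stair f u x n = ?g 0 + Sum_any (\<lambda>l. ?g (Suc l))"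
    unfolding stair_def by (rule Sum_any_Suc[of N]) (simp add: N)
  also have "(\<lambda>l. ?g (Suc l)) = (\<lambda>l. - ?h l)"
    by (simp add: funpow_swap1)
  also have "Sum_any (\<lambda>l. - ?h l) = - Sum_any ?h"
    using hN Sum_any_lessThan[of N ?h] Sum_any_lessThan[of N "\<lambda>l. - ?h l"] by (simp add: sum_negf)
  finally show ?thesis
    by (simp add: stair_def)
qed

lemma lin_op_stair: "lin_op (\<lambda>x. stair f u x n)"
proof (rule lin_opI)
  fix x y :: "'a ext" and c
  obtain N M where *: "\<And>n. N \<le> n \<Longrightarrow> (f ^^ n) x = 0" "\<And>n. M \<le> n \<Longrightarrow> (f ^^ n) y = 0"
    using nil unfolding locally_nilpotent_def by meson
  have "stair f u z n = (\<Sum>l<max N M. scl ((- 1) ^ l) ((f ^^ l) z * u (n + l)))"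
    if "z \<in> {x, y, x + y, scl c x}" for z
    unfolding stair_def using that
    by (intro Sum_any_lessThan)
       (auto simp: * lin_op_add[OF lin_op_funpow[OF f]] lin_op_scl[OF lin_op_funpow[OF f]])
  then show "stair f u (x + y) n = stair f u x n + stair f u y n"
    and "stair f u (scl c x) n = scl c (stair f u x n)"
    by (simp_all add: lin_op_add[OF lin_op_funpow[OF f]] lin_op_scl[OF lin_op_funpow[OF f]]
        distrib_right ext.scale_right_distrib sum.distrib scl_mult_left ext.scale_sum_right mult.commute
        del: minus_one_power_iff)
qed

lemmas stair_zero = lin_op_zero[OF lin_op_stair]

text \<open>The product rule on the first term gives \<open>f x * u (Suc n) + x * u n\<close>, and
  the induction hypothesis for \<open>f x\<close> cancels the first summand. So \<open>stair\<close>
  inverts \<open>f\<close> on the right.\<close>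

lemma derivation_stair:
  assumes D: "derivation f" and u: "\<And>n. f (u (Suc n)) = u n"
  shows "f (stair f u x (Suc n)) = x * u n"
  using nil
proof (induction x arbitrary: n rule: locally_nilpotent_induct)
  case zero
  then show ?case by (simp add: stair_zero lin_op_zero[OF f])
next
  case (step x)
  then show ?case
    by (subst stair_rec) (simp add: lin_op_diff[OF f] derivation_mult[OF D] u)
qed

text \<open>In each term g acts either on a power of f applied to x, where it passes through the
  power, or on the last factor, where it shifts the index by two.\<close>

lemma derivation_stair_shift:
  assumes D: "derivation g" and u: "\<And>n. g (u (Suc (Suc n))) = u n" and comm: "\<And>x. f (g x) = g (f x)"
  shows "g (stair f u x (Suc (Suc n))) = stair f u (g x) (Suc (Suc n)) + stair f u x n"
  using nil
proof (induction x arbitrary: n rule: locally_nilpotent_induct)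
  case zero
  then show ?case by (simp add: stair_zero lin_op_zero[OF derivation_lin_op[OF D]])
next
  case (step x)
  have "g (stair f u x (Suc (Suc n))) =
      g x * u (Suc (Suc n)) + x * u n - g (stair f u (f x) (Suc (Suc (Suc n))))"
    by (subst stair_rec) (simp add: lin_op_diff[OF derivation_lin_op[OF D]] derivation_mult[OF D] u)
  also have "\<dots> = (g x * u (Suc (Suc n)) - stair f u (f (g x)) (Suc (Suc (Suc n)))) +
      (x * u n - stair f u (f x) (Suc n))"
    by (simp add: step comm)
  finally show ?case
    by (simp flip: stair_rec)
qed

lemma stair_hom:
  assumes "\<And>q k x. x \<in> hom q k \<Longrightarrow> f x \<in> hom q (k - 1)" "\<And>n. u n \<in> hom 1 (int n)"
    and "x \<in> hom q k"
  shows "stair f u x n \<in> hom (Suc q) (k + int n)"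
  using nil assms(3)
proof (induction x arbitrary: n k rule: locally_nilpotent_induct)
  case zero
  then show ?case by (simp add: stair_zero)
next
  case (step x)
  have "stair f u (f x) (Suc n) \<in> hom (Suc q) (k - 1 + int (Suc n))"
    by (intro step.IH assms(1) step.prems)
  moreover have "x * u n \<in> hom (q + 1) (k + int n)"
    by (intro hom_mult assms step)
  ultimately show ?case
    by (subst stair_rec) (simp add: hom_diff)
qed

end

section \<open>The forms Omega and W\<close>

definition Om :: "'a::field ext \<Rightarrow> nat \<Rightarrow> 'a ext"
  where "Om x n = stair ad1 (Ef 3) (x * Ef 3 n) (Suc n)"

text \<open>The variant that keeps the terms containing e^2. It computes the given map
  \<open>\<omega>\<close> and agrees with \<open>Om\<close> after multiplication by e^2.\<close>

definition Om1 :: "'a::field ext \<Rightarrow> nat \<Rightarrow> 'a ext"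
  where "Om1 x n = stair del1 (Ef 2) (x * Ef 2 n) (Suc n)"

text \<open>Formed for both \<open>Om\<close> and \<open>Om1\<close>: the identity for
  \<open>ad2\<close> holds for the former, while the generating cocycles come from the
  latter.\<close>

definition W :: "('a::field ext \<Rightarrow> nat \<Rightarrow> 'a ext) \<Rightarrow> 'a ext \<Rightarrow> nat \<Rightarrow> 'a ext"
  where "W om x n = Sum_any (\<lambda>l. scl (1 / 2 ^ l) (om ((cc ^^ l) x) (n + l)))"

lemmas stair0_rec = stair_rec[OF lin_op_ad1 locally_nilpotent_ad1]
lemmas stair1_rec = stair_rec[OF lin_op_del1 locally_nilpotent_del1]
lemmas lin_op_stair0 = lin_op_stair[OF lin_op_ad1 locally_nilpotent_ad1]
lemmas lin_op_stair1 = lin_op_stair[OF lin_op_del1 locally_nilpotent_del1]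

lemma lin_op_Om: "lin_op (\<lambda>x. Om x n)" and lin_op_Om1: "lin_op (\<lambda>x. Om1 x n)"
  by (rule lin_opI; simp add: Om_def Om1_def distrib_right scl_mult_left lin_op_add[OF lin_op_stair0]
      lin_op_scl[OF lin_op_stair0] lin_op_add[OF lin_op_stair1] lin_op_scl[OF lin_op_stair1])+

lemma W_rec:
  assumes "\<And>n. lin_op (\<lambda>x. om x n)"
  shows "W om x n = om x n + scl (1 / 2) (W om (cc x) (Suc n))"
proof -
  obtain N where N: "\<And>n. N \<le> n \<Longrightarrow> (cc ^^ n) x = 0"
    using locally_nilpotent_cc unfolding locally_nilpotent_def by blast
  let ?g = "\<lambda>l. scl (1 / 2 ^ l) (om ((cc ^^ l) x) (n + l))"
  let ?h = "\<lambda>l. scl (1 / 2 ^ l) (om ((cc ^^ l) (cc x)) (Suc n + l))"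
  have hN: "?h l = 0" if "N \<le> l" for l
    using N[of "Suc l"] that by (simp add: funpow_swap1 lin_op_zero[OF assms])
  have "W om x n = ?g 0 + Sum_any (\<lambda>l. ?g (Suc l))"
    unfolding W_def by (rule Sum_any_Suc[of N]) (simp add: N lin_op_zero[OF assms])
  also have "(\<lambda>l. ?g (Suc l)) = (\<lambda>l. scl (1 / 2) (?h l))"
    by (simp add: funpow_swap1)
  also have "Sum_any (\<lambda>l. scl (1 / 2) (?h l)) = scl (1 / 2) (Sum_any ?h)"
    using lin_op_Sum_any[of "scl (1 / 2)", OF _ hN]
    by (simp add: lin_op_def ext.scale_right_distrib mult.commute)
  finally show ?thesis
    by (simp add: W_def)
qed

lemmas W0_rec = W_rec[of Om, OF lin_op_Om]
lemmas W1_rec = W_rec[of Om1, OF lin_op_Om1]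

lemma W_zero:
  fixes om :: "'a::field ext \<Rightarrow> nat \<Rightarrow> 'a ext"
  assumes "\<And>n. lin_op (\<lambda>x. om x n)"
  shows "W om 0 n = 0"
proof -
  have "(cc ^^ l) 0 = (0 :: 'a ext)" for l by (simp add: lin_op_zero[OF lin_op_funpow[OF lin_op_cc]])
  then show ?thesis by (simp add: W_def lin_op_zero[OF assms])
qed

lemma lin_op_W:
  assumes om: "\<And>n. lin_op (\<lambda>x. om x n)"
  shows "lin_op (\<lambda>x. W om x n)"
proof (rule lin_opI)
  fix x y :: "'a ext" and c
  obtain N M where *: "\<And>n. N \<le> n \<Longrightarrow> (cc ^^ n) x = 0" "\<And>n. M \<le> n \<Longrightarrow> (cc ^^ n) y = 0"
    using locally_nilpotent_cc unfolding locally_nilpotent_def by meson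
  have "W om z n = (\<Sum>l<max N M. scl (1 / 2 ^ l) (om ((cc ^^ l) z) (n + l)))"
    if "z \<in> {x, y, x + y, scl c x}" for z
    unfolding W_def using that
    by (intro Sum_any_lessThan)
       (auto simp: * lin_op_add[OF lin_op_funpow[OF lin_op_cc]] lin_op_scl[OF lin_op_funpow[OF lin_op_cc]]
         lin_op_zero[OF om])
  then show "W om (x + y) n = W om x n + W om y n" and "W om (scl c x) n = scl c (W om x n)"
    by (simp_all add: lin_op_add[OF lin_op_funpow[OF lin_op_cc]] lin_op_scl[OF lin_op_funpow[OF lin_op_cc]]
        lin_op_add[OF om] lin_op_scl[OF om] ext.scale_right_distrib sum.distrib ext.scale_sum_right
        mult.commute)
qed

text \<open>Write a, b, c for \<open>ad1\<close>, \<open>ad2\<close>, \<open>cc\<close>. Applying b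
  brings in a stair that starts two indices lower; two steps of the recursion raise it again and
  turn b into c = b + a^2.\<close>

lemma ad2_Om: "ad2 (Om x (Suc n)) = Om (cc x) (Suc n) - scl 2 (Om x n)"
proof -
  let ?F = "stair ad1 (Ef 3) :: 'a ext \<Rightarrow> nat \<Rightarrow> 'a ext"
  let ?u = "Ef 3 :: nat \<Rightarrow> 'a ext"
  note rec = stair0_rec[of "Ef 3"]
  let ?y = "x * ?u (Suc n)"
  have two: "scl 2 z = z + z" for z :: "'a ext"
    using ext.scale_left_distrib[of 1 1 z] by simp
  have ad1u: "ad1 (ad1 (?u (Suc n))) = ad1 (?u n)" by (simp add: ad1_Ef)
  \<comment> \<open>Both sides are e^(n-1) up to the cut-off; n = 0 is separate because
    \<open>ad2_Ef\<close> lowers an index that is at least 2.\<close>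
  have ad2u: "ad2 (?u (Suc n)) = ad1 (?u n)"
  proof (cases n)
    case 0
    then show ?thesis
      by (simp add: Ef_def lin_op_zero[OF lin_op_ad2] lin_op_zero[OF lin_op_ad1])
  qed (simp add: ad1_Ef ad2_Ef)
  have "ad2 (Om x (Suc n)) = ?F (ad2 ?y) (Suc (Suc n)) + ?F ?y n"
    unfolding Om_def
    by (rule derivation_stair_shift[where u = "Ef 3", OF lin_op_ad1 locally_nilpotent_ad1 derivation_ad2 ad2_Ef ad1_ad2])
  \<comment> \<open>The starting index n is raised to n + 2, to match the other stair; the two sign
    changes leave a positive a^2 y.\<close>
  also have "?F ?y n = ?y * ?u n - ad1 ?y * ?u (Suc n) + ?F (ad1 (ad1 ?y)) (Suc (Suc n))"
    by (subst rec, subst rec) simp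
  also have "?y * ?u n - ad1 ?y * ?u (Suc n) = - scl 2 (x * ?u n * ?u (Suc n))"
  proof -
    have "?u (Suc n) * ?u n = - (?u n * ?u (Suc n))"
      using Ef_anticommute[of 3 "Suc n" n, where ?'a = 'a] by (simp add: Ef_def[of 3 n])
    then have "?y * ?u n = - (x * ?u n * ?u (Suc n))"
      by (simp add: mult.assoc)
    moreover have "ad1 ?y * ?u (Suc n) = x * ?u n * ?u (Suc n)"
      by (simp add: derivation_mult[OF derivation_ad1] ad1_Ef distrib_right mult.assoc Ef_square)
    ultimately show ?thesis by (simp add: two)
  qed
  also have "?F (ad2 ?y) (Suc (Suc n)) + (- scl 2 (x * ?u n * ?u (Suc n)) + ?F (ad1 (ad1 ?y)) (Suc (Suc n)))
      = ?F (cc ?y) (Suc (Suc n)) - scl 2 (x * ?u n * ?u (Suc n))"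
    by (simp add: cc_def lin_op_add[OF lin_op_stair0])
  \<comment> \<open>The operator c is of second order: the cross term 2 a x wedge a u(n+1) = 2 a x
    wedge u(n) joins x wedge c u(n+1) = 2 x wedge a u(n).\<close>
  also have "cc ?y = cc x * ?u (Suc n) + scl 2 (ad1 (x * ?u n))"
    by (simp add: cc_def derivation_mult[OF derivation_ad1] derivation_mult[OF derivation_ad2]
        lin_op_add[OF lin_op_ad1] ad1u ad2u ad1_Ef two distrib_right add_ac)
  also have "?F (cc x * ?u (Suc n) + scl 2 (ad1 (x * ?u n))) (Suc (Suc n)) - scl 2 (x * ?u n * ?u (Suc n))
      = Om (cc x) (Suc n) - scl 2 (x * ?u n * ?u (Suc n) - ?F (ad1 (x * ?u n)) (Suc (Suc n)))"
    by (simp add: Om_def lin_op_add[OF lin_op_stair0] lin_op_scl[OF lin_op_stair0]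
        ext.scale_right_diff_distrib)
  also have "x * ?u n * ?u (Suc n) - ?F (ad1 (x * ?u n)) (Suc (Suc n)) = Om x n"
    unfolding Om_def by (rule rec[symmetric])
  finally show ?thesis .
qed

text \<open>The factor 1/2 in \<open>W_rec\<close> is chosen so that Omega(c x, n + 1) from
  \<open>ad2_Om\<close> cancels against the value for c x; only -2 Omega(x, n) survives.\<close>

lemma ad2_W: "ad2 (W Om x (Suc n)) = - scl 2 (Om x n :: 'a::field_char_0 ext)"
  using locally_nilpotent_cc
proof (induction x arbitrary: n rule: locally_nilpotent_induct)
  case zero
  then show ?case
    by (simp add: W_zero[OF lin_op_Om] lin_op_zero[OF lin_op_Om] lin_op_zero[OF lin_op_ad2])
next
  case (step x)
  then show ?case
    by (subst W0_rec) (simp add: lin_op_add[OF lin_op_ad2] lin_op_scl[OF lin_op_ad2] ad2_Om)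
qed

section \<open>Comparison of \<open>ad1\<close> and \<open>del1\<close> after multiplication by
  e^2\<close>

lemma stair_E2_mult: "stair del1 (Ef 2) (E 2 * x) n = stair ad1 (Ef 3) (E 2 * x) n"
  using locally_nilpotent_ad1
proof (induction x arbitrary: n rule: locally_nilpotent_induct)
  case zero
  then show ?case by (simp add: lin_op_zero[OF lin_op_stair0] lin_op_zero[OF lin_op_stair1])
next
  case (step x)
  have "E 2 * x * Ef 2 n = E 2 * x * Ef 3 n"
    by (cases "n = 2") (auto simp: Ef_def E_mult_mult_E)
  then show ?case
    by (subst stair0_rec, subst stair1_rec) (simp add: ad1_E2_mult del1_E2_mult E2_del1 step)
qed

lemma E2_mult_stair0: "E 2 * stair ad1 u x n = stair ad1 u (E 2 * x) n"
  using locally_nilpotent_ad1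
proof (induction x arbitrary: n rule: locally_nilpotent_induct)
  case zero
  then show ?case by (simp add: lin_op_zero[OF lin_op_stair0])
next
  case (step x)
  then show ?case
    by (subst (1 2) stair0_rec) (simp add: ad1_E2_mult right_diff_distrib mult.assoc)
qed

lemma E2_mult_stair1: "E 2 * stair del1 u x n = stair del1 u (E 2 * x) n"
  using locally_nilpotent_del1
proof (induction x arbitrary: n rule: locally_nilpotent_induct)
  case zero
  then show ?case by (simp add: lin_op_zero[OF lin_op_stair1])
next
  case (step x)
  then show ?case
    by (subst (1 2) stair1_rec) (simp add: del1_E2_mult right_diff_distrib mult.assoc)
qed

text \<open>Multiplication by e^2 removes what \<open>del1\<close> and \<open>Ef 2\<close> add to
  \<open>ad1\<close> and \<open>Ef 3\<close>, namely terms containing e^2.\<close>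

lemma E2_mult_Om1: "E 2 * Om1 x n = E 2 * Om x n"
proof -
  have "E 2 * x * Ef 2 n = E 2 * x * Ef 3 n"
    by (cases "n = 2") (auto simp: Ef_def E_mult_mult_E)
  then show ?thesis
    by (simp add: Om_def Om1_def E2_mult_stair0 E2_mult_stair1 stair_E2_mult mult.assoc)
qed

lemma E2_mult_W1: "E 2 * W Om1 x n = E 2 * W Om x n"
  using locally_nilpotent_cc
proof (induction x arbitrary: n rule: locally_nilpotent_induct)
  case zero
  then show ?case by (simp add: W_zero[OF lin_op_Om] W_zero[OF lin_op_Om1])
next
  case (step x)
  then show ?case
    by (subst W0_rec, subst W1_rec) (simp add: distrib_left scl_mult_right E2_mult_Om1)
qed

text \<open>\<open>del1\<close> undoes the stair, which leaves x wedge e^n wedge e^n = 0.\<close>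

lemma del1_Om1: "del1 (Om1 x n) = 0"
  unfolding Om1_def
    derivation_stair[where u = "Ef 2", OF lin_op_del1 locally_nilpotent_del1 derivation_del1 del1_Ef]
  by (simp add: mult.assoc Ef_square)

lemma del1_W1: "del1 (W Om1 x n) = 0"
  using locally_nilpotent_cc
proof (induction x arbitrary: n rule: locally_nilpotent_induct)
  case zero
  then show ?case by (simp add: W_zero[OF lin_op_Om1] lin_op_zero[OF lin_op_del1])
next
  case (step x)
  then show ?case
    by (subst W1_rec) (simp add: lin_op_add[OF lin_op_del1] lin_op_scl[OF lin_op_del1] del1_Om1)
qed

text \<open>The e^1 part vanishes by \<open>del1_W1\<close>; in the e^2 part \<open>Om1\<close> may
  be replaced by \<open>Om\<close>, for which \<open>ad2_W\<close> is known.\<close>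

lemma dE_W1: "dE (W Om1 x (Suc n)) = - scl 2 (E 2 * Om1 x n :: 'a::field_char_0 ext)"
proof -
  have "dE (W Om1 x (Suc n)) = ad2 (E 2 * W Om1 x (Suc n))"
    by (simp add: dE_eq del1_W1 ad2_E2_mult)
  also have "\<dots> = E 2 * ad2 (W Om x (Suc n))"
    by (simp add: E2_mult_W1 ad2_E2_mult)
  finally show ?thesis
    by (simp add: ad2_W E2_mult_Om1 scl_mult_right)
qed

section \<open>Bidegrees and index ranges\<close>

lemma Om1_hom: "x \<in> hom q k \<Longrightarrow> Om1 x n \<in> hom (q + 2) (k + 2 * int n + 1)"
proof -
  assume "x \<in> hom q k"
  then have "x * Ef 2 n \<in> hom (q + 1) (k + int n)"
    by (intro hom_mult Ef_in_hom)
  from stair_hom[where u = "Ef 2" and n = "Suc n",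
      OF lin_op_del1 locally_nilpotent_del1 del1_hom Ef_in_hom this]
  show ?thesis by (simp add: Om1_def algebra_simps)
qed

text \<open>\<open>cc\<close> lowers the weight by 2 while raising n by 1 adds 2, so all terms of
  the sum have the same weight.\<close>

lemma W1_hom: "x \<in> hom q k \<Longrightarrow> W Om1 x n \<in> hom (q + 2) (k + 2 * int n + 1)"
  using locally_nilpotent_cc
proof (induction x arbitrary: n k rule: locally_nilpotent_induct)
  case zero
  then show ?case by (simp add: W_zero[OF lin_op_Om1])
next
  case (step x)
  have "W Om1 (cc x) (Suc n) \<in> hom (q + 2) ((k - 2) + 2 * int (Suc n) + 1)"
    using step by (intro step.IH cc_hom)
  then show ?case
    using Om1_hom[OF step.prems, of n] by (subst W1_rec) (simp add: hom_add hom_scl)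
qed

lemma Mon_mult_E_in:
  assumes "i \<in> I"
  shows "Mon I * E i = 0"
  using assms unfolding E_def
  by transfer (auto simp: wedge_mon_mon mon_wedge_eq)

lemma subalg_ad1: "x \<in> subalg {3..<n} \<Longrightarrow> ad1 x \<in> subalg {3..<n}"
  by (rule derivation_subalg[OF derivation_ad1, of "{3..<n}"]) (auto simp: ad1_E Ef_def intro: E_in_subalg)

lemma subalg_ad2: "x \<in> subalg {3..<n} \<Longrightarrow> ad2 x \<in> subalg {3..<n}"
  by (rule derivation_subalg[OF derivation_ad2, of "{3..<n}"]) (auto simp: ad2_E Ef_def intro: E_in_subalg)

lemma subalg_del1: "x \<in> subalg {2..<n} \<Longrightarrow> del1 x \<in> subalg {2..<n}"
  by (rule derivation_subalg[OF derivation_del1, of "{2..<n}"]) (auto simp: del1_E Ef_def intro: E_in_subalg)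

lemma subalg_ad2_from2: "x \<in> subalg {2..} \<Longrightarrow> ad2 x \<in> subalg {2..}"
  by (rule derivation_subalg[OF derivation_ad2, of "{2..}"]) (auto simp: ad2_E Ef_def intro: E_in_subalg)

lemma subalg_del1_from2: "x \<in> subalg {2..} \<Longrightarrow> del1 x \<in> subalg {2..}"
  by (rule derivation_subalg[OF derivation_del1, of "{2..}"]) (auto simp: del1_E Ef_def intro: E_in_subalg)

lemma subalg_cc: "x \<in> subalg {3..<n} \<Longrightarrow> cc x \<in> subalg {3..<n}"
  unfolding cc_def by (intro subalg_add subalg_ad1 subalg_ad2)

lemma subalg_cc_funpow: "x \<in> subalg {3..<n} \<Longrightarrow> (cc ^^ l) x \<in> subalg {3..<n}"
  by (induction l) (simp_all add: subalg_cc)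

section \<open>Identification with the given forms\<close>

lemma form_of_Sum_any: "form_of (Sum_any g) = Sum_any (\<lambda>l. form_of (g l))"
proof -
  have "form_of (sum g A) = (\<Sum>l\<in>A. form_of (g l))" for A
    by (induction A rule: infinite_finite_induct) (simp_all add: zero_ext.rep_eq plus_ext.rep_eq)
  moreover have "form_of (g l) = 0 \<longleftrightarrow> g l = 0" for l
    by (metis form_of_inject zero_ext.rep_eq)
  ultimately show ?thesis
    by (simp add: Sum_any.expand_set)
qed

lemma Max_insert_less:
  assumes "finite I" "\<And>j. j \<in> I \<Longrightarrow> j < (n::nat)"
  shows "Max (insert n I) = n"
  using assms by (intro Max_eqI) (auto intro: less_imp_le)

lemma Mon_mult_E_E:
  assumes "I \<in> index_sets" "\<And>i. i \<in> I \<Longrightarrow> i < n" "n \<noteq> 0"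
  shows "Mon I * E n * E (Suc n) = Mon (insert (Suc n) (insert n I))"
proof -
  have "Mon I * E n = (Mon (insert n I) :: 'a ext)"
    using assms by (intro Mon_mult_E_greater)
  also have "\<dots> * E (Suc n) = Mon (insert (Suc n) (insert n I))"
    using assms by (intro Mon_mult_E_greater) (auto simp: less_Suc_eq)
  finally show ?thesis .
qed

text \<open>\<open>\<omega>\<close> strips only the top factor e^(n+1); what remains is x wedge e^n,
  the argument of the stair in \<open>Om1\<close>. Since n \<ge> 3, \<open>Ef 2\<close> agrees with
  \<open>E\<close> at all appended indices.\<close>

lemma omega_eq_Om1:
  assumes "x \<in> subalg {3..<n}" "3 \<le> n"
  shows "\<omega> (form_of (x * E n * E (Suc n))) = form_of (Om1 x n)"
  using assms(1)
proof (induction rule: subalg_induct)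
  case zero
  then show ?case by (simp add: \<omega>_def zero_ext.rep_eq lin_op_zero[OF lin_op_Om1])
next
  case (add x y)
  then show ?case
    by (simp add: \<omega>_def distrib_right plus_ext.rep_eq lin_op_add[OF lin_op_Om1] lin_ext_add)
next
  case (Mon c I)
  have I: "finite I" "n \<notin> I" "Suc n \<notin> I" "\<And>i. i \<in> I \<Longrightarrow> i < n"
    using Mon by (auto simp: index_sets_def)
  let ?K = "insert (Suc n) (insert n I)"
  let ?z = "Mon (insert n I) :: 'a ext"
  have K: "?K \<in> index_sets" "insert n I \<in> index_sets"
    using Mon assms(2) by auto
  have Max: "Max ?K = Suc n"
    using I by (intro Max_insert_less) (auto simp: less_Suc_eq)
  have "card {n, Suc n} \<le> card ?K"
    using I by (intro card_mono) auto
  then have card: "2 \<le> card ?K" by simp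
  have zform: "form_of ?z = mon (insert n I)"
    using K by (simp add: Mon.rep_eq)
  have D: "(D1 ^^ l) (form_of ?z) = form_of ((del1 ^^ l) ?z)" for l
    by (induction l) (simp_all add: form_of_del1)
  have "?K - {Max ?K} = insert n I"
    unfolding Max using I by auto
  then have "\<omega> (mon ?K) = Sum_any (\<lambda>l. fscale ((- 1) ^ l) ((D1 ^^ l) (form_of ?z) \<^bold>\<and> e (Suc n + l)))"
    unfolding \<omega>_def lin_ext_mon zform Max using card by simp
  also have "\<dots> = form_of (stair del1 (Ef 2) ?z (Suc n))"
    unfolding stair_def form_of_Sum_any D using assms(2)
    by (simp add: scl.rep_eq times_ext.rep_eq Ef_def form_of_E)
  also have "?z = Mon I * Ef 2 n"
    using Mon I assms(2) by (simp add: Ef_def Mon_mult_E_greater)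
  finally have "\<omega> (mon ?K) = form_of (Om1 (Mon I) n :: 'a ext)"
    unfolding Om1_def .
  moreover have "form_of (Mon I * E n * E (Suc n) :: 'a ext) = mon ?K"
    using Mon I assms(2) K by (subst Mon_mult_E_E) (auto simp: Mon.rep_eq)
  ultimately show ?case
    by (simp add: scl_mult_left scl.rep_eq lin_op_scl[OF lin_op_Om1] \<omega>_def lin_ext_fscale)
qed

definition wE :: "nat set \<Rightarrow> 'a::field ext"
  where "wE I = W Om1 (Mon I) (Suc (Max I))"

text \<open>Powers of \<open>cc\<close> do not raise indices, so each summand has the form x wedge
  e^n wedge e^(n+1) with x below n, and thus lies in the domain of \<open>\<omega>\<close>.\<close>

lemma form_of_wE:
  assumes "finite I" "I \<noteq> {}" "\<And>i. i \<in> I \<Longrightarrow> 3 \<le> i"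
  shows "form_of (wE I) = (w I :: 'a::field form)"
proof -
  let ?n = "Suc (Max I)"
  have I: "I \<in> index_sets" "I \<subseteq> {3..<?n}"
    using assms by (force simp: index_sets_def less_Suc_eq_le)+
  have n: "3 \<le> ?n"
    using assms(3)[OF Max_in[OF assms(1,2)]] by simp
  have c: "form_of ((cc ^^ l) (Mon I)) = ((\<lambda>x. ad2_star x + ad1_star (ad1_star x)) ^^ l) (mon I :: 'a form)" for l
    using I by (induction l) (simp_all add: Mon.rep_eq cc_def plus_ext.rep_eq form_of_ad1 form_of_ad2)
  have "\<omega> (((\<lambda>x. ad2_star x + ad1_star (ad1_star x)) ^^ l) (mon I :: 'a form)
        \<^bold>\<and> e (Max I + 1 + l) \<^bold>\<and> e (Max I + 2 + l)) = form_of (Om1 ((cc ^^ l) (Mon I)) (?n + l))" for l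
  proof -
    have "(cc ^^ l) (Mon I :: 'a ext) \<in> subalg {3..<?n + l}"
      by (rule subalg_mono[OF subalg_cc_funpow[OF Mon_in_subalg[OF I(2)]]]) auto
    then have "\<omega> (form_of ((cc ^^ l) (Mon I :: 'a ext) * E (?n + l) * E (Suc (?n + l)))) =
        form_of (Om1 ((cc ^^ l) (Mon I :: 'a ext)) (?n + l))"
      by (rule omega_eq_Om1) (use n in simp)
    then show ?thesis
      by (simp add: times_ext.rep_eq c form_of_E)
  qed
  then show ?thesis
    by (simp add: wE_def W_def w_def form_of_Sum_any scl.rep_eq)
qed


section \<open>Representatives of the cohomology classes\<close>

text \<open>Left multiplication by e^i is injective on forms free of e^i; this is how e^1 and e^2
  are cancelled below.\<close>

lemma coef_E_mult_insert:
  assumes "I \<in> index_sets" "i \<noteq> 0" "i \<notin> I"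
  shows "coef (E i * x) (insert i I) = (- 1) ^ inversions {i} I * coef x I"
proof (induction x rule: ext_induct)
  case (Mon c J)
  show ?case
  proof (cases "i \<in> J")
    case True
    then show ?thesis
      using assms Mon by (auto simp: scl_mult_right E_mult_Mon_in coef_scl coef_Mon)
  next
    case False
    then have "insert i J = insert i I \<longleftrightarrow> J = I"
      using assms by auto
    then show ?thesis
      using assms Mon False
      by (simp add: scl_mult_right E_mult_Mon coef_scl coef_Mon del: minus_one_power_iff)
  qed
qed (simp add: distrib_left coef_add)

lemma coef_E_mult_notin:
  assumes "i \<notin> I"
  shows "coef (E i * x) I = 0"
proof (induction x rule: ext_induct)
  case (Mon c J)
  consider "i = 0" | "i \<in> J" | "i \<noteq> 0" "i \<notin> J" by blast
  then show ?case
    using assms Mon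
    by cases (auto simp: scl_mult_right E_mult_Mon E_mult_Mon_in coef_scl coef_Mon)
qed (simp add: distrib_left coef_add)

section \<open>A homotopy for \<open>del1\<close>\<close>

definition homotopy :: "'a::field ext \<Rightarrow> 'a ext"
  where "homotopy = lin (\<lambda>I. if I = {} then 0 else stair del1 (Ef 2) (Mon (I - {Max I})) (Suc (Max I)))"

lemma lin_op_homotopy: "lin_op homotopy"
  unfolding homotopy_def by (rule lin_op_lin)

lemma homotopy_one: "homotopy 1 = 0"
  unfolding homotopy_def by (subst Mon_empty[symmetric], subst lin_Mon) simp_all

lemma homotopy_mult_E:
  assumes "x \<in> subalg {2..<n}" "2 \<le> n"
  shows "homotopy (x * E n) = stair del1 (Ef 2) x (Suc n)"
  using assms(1)
proof (induction rule: subalg_induct)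
  case zero
  then show ?case by (simp add: lin_op_zero[OF lin_op_homotopy] lin_op_zero[OF lin_op_stair1])
next
  case (add x y)
  then show ?case
    by (simp add: distrib_right lin_op_add[OF lin_op_homotopy] lin_op_add[OF lin_op_stair1])
next
  case (Mon c I)
  have I: "finite I" "n \<notin> I" "\<And>i. i \<in> I \<Longrightarrow> i < n"
    using Mon by (auto simp: index_sets_def)
  moreover have "Mon I * E n = (Mon (insert n I) :: 'a ext)"
    using Mon I assms(2) by (intro Mon_mult_E_greater) auto
  moreover have "insert n I \<in> index_sets"
    using Mon assms(2) by auto
  ultimately have "homotopy (Mon I * E n) = stair del1 (Ef 2) (Mon I :: 'a ext) (Suc n)"
    by (simp add: homotopy_def lin_Mon Max_insert_less)
  then show ?case
    by (simp add: scl_mult_left lin_op_scl[OF lin_op_homotopy] lin_op_scl[OF lin_op_stair1])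
qed

lemma index_set_top:
  assumes "I \<in> index_sets" "I \<noteq> {}"
  obtains n J where "I = insert n J" "n \<notin> J" "J \<in> index_sets" "n \<noteq> 0" "\<forall>j\<in>J. j < n"
    "Max I = n" "I - {n} = J"
proof
  have fin: "finite I" using assms by (simp add: index_sets_def)
  show "I = insert (Max I) (I - {Max I})" using Max_in[OF fin assms(2)] by auto
  show "Max I \<noteq> 0" using Max_in[OF fin assms(2)] assms(1) unfolding index_sets_def by (metis (mono_tags) mem_Collect_eq)
  show "\<forall>j\<in>I - {Max I}. j < Max I"
    using Max_ge[OF fin] by (auto simp: le_less)
qed (use assms in \<open>auto simp: index_sets_Diff\<close>)

lemma Mon_insert_top:
  "J \<in> index_sets \<Longrightarrow> n \<noteq> 0 \<Longrightarrow> \<forall>j\<in>J. j < n \<Longrightarrow> Mon (insert n J) = Mon J * E n"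
  by (rule Mon_mult_E_greater[symmetric]) auto

lemma subalg_stair1:
  assumes "x \<in> subalg {2..}"
  shows "stair del1 (Ef 2) x n \<in> subalg {2..}"
  using locally_nilpotent_del1 assms
proof (induction x arbitrary: n rule: locally_nilpotent_induct)
  case zero
  then show ?case by (simp add: lin_op_zero[OF lin_op_stair1])
next
  case (step x)
  have "Ef 2 n \<in> subalg {2..}"
    by (auto simp: Ef_def intro: E_in_subalg)
  then show ?case
    using step by (subst stair1_rec) (intro subalg_diff subalg_mult subalg_del1_from2 step)
qed

lemma subalg_homotopy:
  assumes "x \<in> subalg {2..}"
  shows "homotopy x \<in> subalg {2..}"
  using assms
proof (induction rule: subalg_induct)
  case (Mon c I)
  show ?case
  proof (cases "I = {}")
    case False
    have "homotopy (Mon I) \<in> (subalg {2..} :: 'a ext set)"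
      using Mon False by (auto simp: homotopy_def lin_Mon intro!: subalg_stair1 Mon_in_subalg)
    then show ?thesis by (simp add: lin_op_scl[OF lin_op_homotopy] subalg_scl)
  qed (simp add: lin_op_scl[OF lin_op_homotopy] homotopy_one)
qed (simp_all add: lin_op_zero[OF lin_op_homotopy] lin_op_add[OF lin_op_homotopy] subalg_add)

text \<open>\<open>homotopy\<close> replaces the top factor e^n by the stair starting at n + 1,
  which \<open>del1\<close> takes back to e^n. The constant term is lost because 1 is sent to
  0.\<close>

lemma del1_homotopy:
  assumes "x \<in> subalg {2..}"
  shows "del1 (homotopy x) = x - scl (coef x {}) 1"
  using assms
proof (induction rule: subalg_induct)
  case (add x y)
  then show ?case
    by (simp add: lin_op_add[OF lin_op_homotopy] lin_op_add[OF lin_op_del1] coef_add ext.scale_left_distrib)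
next
  case (Mon c I)
  have "del1 (homotopy (Mon I)) = Mon I - scl (coef (Mon I) {}) (1 :: 'a ext)"
  proof (cases "I = {}")
    case True
    then show ?thesis
      using coef_Mon[of "{}" "{}", where ?'a = 'a]
      by (simp add: homotopy_one lin_op_zero[OF lin_op_del1])
  next
    case False
    from index_set_top[OF Mon(1) False] obtain n J where J: "I = insert n J" "n \<notin> J" "J \<in> index_sets"
      "n \<noteq> 0" "\<forall>j\<in>J. j < n" "Max I = n" "I - {n} = J" .
    have "homotopy (Mon I) = stair del1 (Ef 2) (Mon J :: 'a ext) (Suc n)"
      using Mon(1) False J(6,7) by (simp add: homotopy_def lin_Mon)
    then have "del1 (homotopy (Mon I)) = (Mon J * Ef 2 n :: 'a ext)"
      by (simp add: derivation_stair[where u = "Ef 2", OF lin_op_del1 locally_nilpotent_del1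
          derivation_del1 del1_Ef])
    also have "\<dots> = Mon I"
      using J(1) Mon(2) Mon_insert_top[OF J(3,4,5), where ?'a = 'a] by (auto simp: Ef_def)
    finally show ?thesis
      using Mon(1) False by (simp add: coef_Mon)
  qed
  then show ?case
    by (simp add: lin_op_scl[OF lin_op_homotopy] lin_op_scl[OF lin_op_del1] coef_scl
        ext.scale_right_diff_distrib)
qed (simp add: lin_op_zero[OF lin_op_homotopy] lin_op_zero[OF lin_op_del1])

text \<open>On indices at least 2 these are the values of x - \<open>homotopy (del1 x)\<close>, a
  projection onto the kernel of \<open>del1\<close>. They vanish unless the set is empty, is {2} or
  has two consecutive top indices; in the last case the value is omega(e^I).\<close>

definition proj1_mon :: "nat set \<Rightarrow> 'a::field ext"
  where "proj1_mon I = (if I = {} then 1 else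
    if Max I = 2 \<or> Max I - 1 \<in> I then stair del1 (Ef 2) (Mon (I - {Max I})) (Max I) else 0)"

text \<open>For I with top index n and remainder J, let G be the stair of e^J starting at n. The
  homotopy of (\<open>del1\<close> e^J) wedge e^n is e^I - G by the recursion. The other term e^J
  wedge e^(n-1) vanishes if n = 2 or n - 1 is in J; otherwise its homotopy is G and cancels the
  correction.\<close>

lemma proj1_homotopy:
  assumes "x \<in> subalg {2..}"
  shows "x = lin proj1_mon x + homotopy (del1 x)"
  using assms
proof (induction rule: subalg_induct)
  case zero
  then show ?case by (simp add: lin_op_zero[OF lin_op_homotopy] lin_op_zero[OF lin_op_del1] lin_op_zero[OF lin_op_lin])
next
  case (add x y)
  have "lin proj1_mon (x + y) + homotopy (del1 (x + y)) =
      (lin proj1_mon x + homotopy (del1 x)) + (lin proj1_mon y + homotopy (del1 y))"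
    by (simp add: lin_op_add[OF lin_op_homotopy] lin_op_add[OF lin_op_del1] lin_op_add[OF lin_op_lin] add_ac)
  also have "\<dots> = x + y"
    by (simp only: add[symmetric])
  finally show ?case ..
next
  case (Mon c I)
  have "(Mon I :: 'a ext) = proj1_mon I + homotopy (del1 (Mon I))"
  proof (cases "I = {}")
    case True
    then show ?thesis
      by (simp add: proj1_mon_def derivation_one[OF derivation_del1] lin_op_zero[OF lin_op_homotopy])
  next
    case False
    from index_set_top[OF Mon(1) False] obtain n J where J: "I = insert n J" "n \<notin> J" "J \<in> index_sets"
      "n \<noteq> 0" "\<forall>j\<in>J. j < n" "Max I = n" "I - {n} = J" .
    let ?m = "Mon J :: 'a ext"
    have n2: "2 \<le> n" "J \<subseteq> {2..<n}" using J(1,5) Mon(2) by auto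
    have m: "?m \<in> subalg {2..<n}" by (rule Mon_in_subalg[OF n2(2)])
    have I: "(Mon I :: 'a ext) = ?m * E n"
      using J(1) Mon_insert_top[OF J(3,4,5), where ?'a = 'a] by simp
    have rec: "stair del1 (Ef 2) ?m n = Mon I - stair del1 (Ef 2) (del1 ?m) (Suc n)"
      using stair1_rec[of "Ef 2" ?m n] n2 I by (simp add: Ef_def)
    have "homotopy (del1 ?m * E n) = stair del1 (Ef 2) (del1 ?m) (Suc n)"
      by (rule homotopy_mult_E[OF subalg_del1[OF m] n2(1)])
    moreover have "del1 (Mon I) = del1 ?m * E n + ?m * Ef 2 (n - 1)"
      unfolding I by (simp add: derivation_mult[OF derivation_del1] del1_E)
    moreover have "stair del1 (Ef 2) (del1 ?m) (Suc n) + homotopy (?m * Ef 2 (n - 1)) = Mon I - proj1_mon I"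
    proof (cases "n = 2 \<or> n - 1 \<in> J")
      case True
      have "?m * Ef 2 (n - 1) = 0"
        using True Mon_mult_E_in[of "n - 1" J, where ?'a = 'a] by (auto simp: Ef_def)
      then show ?thesis
        using True False J rec
        by (auto simp: proj1_mon_def lin_op_zero[OF lin_op_homotopy])
    next
      case nc: False
      then have "n - 1 \<notin> I" using J(1,4) by auto
      then have p: "proj1_mon I = (0 :: 'a ext)"
        using nc False J by (simp add: proj1_mon_def)
      have "j < n - 1" if "j \<in> J" for j
        using nc bspec[OF J(5) that] that by (cases "j = n - 1") auto
      then have "J \<subseteq> {2..<n - 1}" using n2(2) by auto
      then have "homotopy (?m * E (n - 1)) = stair del1 (Ef 2) ?m (Suc (n - 1))"
        using nc n2(1) by (intro homotopy_mult_E Mon_in_subalg) auto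
      moreover have "2 \<le> n - 1" using nc n2(1) by auto
      ultimately show ?thesis
        using rec n2(1) p by (simp add: Ef_def)
    qed
    ultimately show ?thesis
      by (simp add: lin_op_add[OF lin_op_homotopy])
  qed
  then have *: "proj1_mon I + homotopy (del1 (Mon I)) = (Mon I :: 'a ext)" ..
  have "lin proj1_mon (scl c (Mon I)) + homotopy (del1 (scl c (Mon I))) =
      scl c (proj1_mon I + homotopy (del1 (Mon I :: 'a ext)))"
    using Mon(1) by (simp add: lin_op_scl[OF lin_op_homotopy] lin_op_scl[OF lin_op_del1]
        lin_op_scl[OF lin_op_lin] lin_Mon ext.scale_right_distrib)
  then show ?case by (simp only: *)
qed

section \<open>Monomials with two consecutive top indices\<close>

definition top2 :: "nat set \<Rightarrow> bool"
  where "top2 I \<longleftrightarrow> I \<noteq> {} \<and> I \<subseteq> {3..} \<and> Max I - 1 \<in> I"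

text \<open>Keeps the values of \<open>proj1_mon\<close> only at nonempty sets free of 2; what is
  dropped consists of generators and coboundaries.\<close>

definition red_mon :: "nat set \<Rightarrow> 'a::field ext"
  where "red_mon I = (if top2 I then Om1 (Mon (I - {Max I, Max I - 1})) (Max I - 1) else 0)"

definition lift_mon :: "nat set \<Rightarrow> 'a::field ext"
  where "lift_mon I =
    (if top2 I then scl (- 1 / 2) (W Om1 (Mon (I - {Max I, Max I - 1})) (Max I)) else 0)"

lemma top2_cases:
  assumes "I \<in> index_sets" "top2 I"
  obtains n J where "I = insert (Suc n) (insert n J)" "3 \<le> n" "J \<subseteq> {3..<n}" "J \<in> index_sets"
proof -
  from index_set_top[OF assms(1)] assms(2) obtain n J where J: "I = insert n J" "n \<notin> J" "J \<in> index_sets"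
      "n \<noteq> 0" "\<forall>j\<in>J. j < n" "Max I = n"
    unfolding top2_def by metis
  then have n: "n - 1 \<in> J" "J \<subseteq> {3..}"
    using assms(2) by (auto simp: top2_def)
  show thesis
  proof (rule that[of "n - 1" "J - {n - 1}"])
    show "I = insert (Suc (n - 1)) (insert (n - 1) (J - {n - 1}))"
      using J n by auto
    show "3 \<le> n - 1" using n by auto
    show "J - {n - 1} \<subseteq> {3..<n - 1}"
    proof
      fix j
      assume "j \<in> J - {n - 1}"
      then show "j \<in> {3..<n - 1}"
        using bspec[OF J(5), of j] n by auto
    qed
    show "J - {n - 1} \<in> index_sets"
      by (rule index_sets_Diff[OF J(3)])
  qed
qed

lemma top2_insert:
  assumes "J \<subseteq> {3..<n}" "3 \<le> n"
  defines "I \<equiv> insert (Suc n) (insert n J)"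
  shows "top2 I" and "Max I = Suc n" and "I - {Max I, Max I - 1} = J"
proof -
  have fin: "finite J" using assms finite_subset by blast
  show Max: "Max I = Suc n"
    unfolding I_def using fin assms by (intro Max_insert_less) (auto simp: less_Suc_eq)
  show "top2 I" unfolding top2_def Max using assms by auto
  show "I - {Max I, Max I - 1} = J" unfolding Max using assms by auto
qed

lemma red_mon_insert:
  assumes "J \<subseteq> {3..<n}" "3 \<le> n"
  shows "red_mon (insert (Suc n) (insert n J)) = Om1 (Mon J) n"
  unfolding red_mon_def top2_insert(3)[OF assms] using top2_insert(1,2)[OF assms] by simp

lemma lift_mon_insert:
  assumes "J \<subseteq> {3..<n}" "3 \<le> n"
  shows "lift_mon (insert (Suc n) (insert n J)) = scl (- 1 / 2) (W Om1 (Mon J) (Suc n))"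
  unfolding lift_mon_def top2_insert(3)[OF assms] using top2_insert(1,2)[OF assms] by simp

text \<open>On \<open>Om x n\<close> this is \<open>- 1/2 W(x, n + 1)\<close>, since only the first monomials of \<open>Om x n\<close> have consecutive tops.\<close>

definition lift :: "'a::field ext \<Rightarrow> 'a ext"
  where "lift = lin lift_mon"

lemma lin_op_lift: "lin_op lift"
  unfolding lift_def by (rule lin_op_lin)

lemmas lin_op_W1 = lin_op_W[of Om1, OF lin_op_Om1]

lemma lift_mult_E_E:
  assumes "x \<in> subalg {3..<n}" "3 \<le> n"
  shows "lift (x * E n * E (Suc n)) = scl (- 1 / 2) (W Om1 x (Suc n))"
  using assms(1)
proof (induction rule: subalg_induct)
  case zero
  then show ?case by (simp add: lin_op_zero[OF lin_op_lift] lin_op_zero[OF lin_op_W1])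
next
  case (add x y)
  then show ?case
    by (simp add: distrib_right lin_op_add[OF lin_op_lift] lin_op_add[OF lin_op_W1] ext.scale_right_distrib)
next
  case (Mon c I)
  have "Mon I * E n * E (Suc n) = (Mon (insert (Suc n) (insert n I)) :: 'a ext)"
    using Mon assms(2) by (intro Mon_mult_E_E) auto
  moreover have "insert (Suc n) (insert n I) \<in> index_sets"
    using Mon assms(2) by auto
  ultimately have "lift (Mon I * E n * E (Suc n)) = scl (- 1 / 2) (W Om1 (Mon I :: 'a ext) (Suc n))"
    using Mon assms(2) by (simp add: lift_def lin_Mon lift_mon_insert)
  then show ?case
    by (simp add: scl_mult_left lin_op_scl[OF lin_op_lift] lin_op_scl[OF lin_op_W1] mult.commute)
qed

lemma lift_mult_E:
  assumes "x \<in> subalg {3..<n}"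
  shows "lift (x * E (Suc n)) = 0"
  using assms
proof (induction rule: subalg_induct)
  case (Mon c I)
  have I: "finite I" "n \<notin> I" "\<And>i. i \<in> I \<Longrightarrow> i < Suc n"
    using Mon by (auto simp: index_sets_def)
  have "Mon I * E (Suc n) = (Mon (insert (Suc n) I) :: 'a ext)"
    using Mon(1) I by (intro Mon_mult_E_greater) auto
  moreover have "\<not> top2 (insert (Suc n) I)"
    unfolding top2_def using I by (simp add: Max_insert_less)
  ultimately have "lift (Mon I * E (Suc n)) = (0 :: 'a ext)"
    using Mon(1) by (simp add: lift_def lin_Mon lift_mon_def)
  then show ?case
    by (simp add: scl_mult_left lin_op_scl[OF lin_op_lift])
qed (simp_all add: distrib_right lin_op_add[OF lin_op_lift] lin_op_zero[OF lin_op_lift])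

text \<open>No monomial has consecutive tops: the last index starts with a gap below it and moves
  up, while \<open>ad1\<close> does not raise the others.\<close>

lemma lift_stair0:
  assumes "x \<in> subalg {3..<n}"
  shows "lift (stair ad1 (Ef 3) x (Suc n)) = 0"
  using locally_nilpotent_ad1 assms
proof (induction x arbitrary: n rule: locally_nilpotent_induct)
  case zero
  then show ?case by (simp add: lin_op_zero[OF lin_op_stair0] lin_op_zero[OF lin_op_lift])
next
  case (step x)
  have "ad1 x \<in> subalg {3..<Suc n}"
    by (rule subalg_mono[OF subalg_ad1[OF step.prems]]) auto
  moreover have "lift (x * Ef 3 (Suc n)) = 0"
    using lift_mult_E[OF step.prems] by (simp add: Ef_def lin_op_zero[OF lin_op_lift])
  ultimately show ?case
    by (subst stair0_rec) (simp add: lin_op_diff[OF lin_op_lift] step.IH)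
qed

text \<open>Only the first term, x wedge e^n wedge e^(n+1), has consecutive tops.\<close>

lemma lift_Om:
  assumes "x \<in> subalg {3..<n}" "3 \<le> n"
  shows "lift (Om x n) = scl (- 1 / 2) (W Om1 x (Suc n))"
proof -
  have "x * E n \<in> subalg {3..<Suc n}"
    using assms by (intro subalg_mult E_in_subalg) (auto intro: subalg_mono)
  then have "lift (stair ad1 (Ef 3) (ad1 (x * E n)) (Suc (Suc n))) = 0"
    by (intro lift_stair0 subalg_ad1)
  then show ?thesis
    using assms unfolding Om_def
    by (subst stair0_rec) (simp add: Ef_def lin_op_diff[OF lin_op_lift] lift_mult_E_E)
qed

text \<open>The hypothesis puts the index 2 into every monomial of x, and \<open>lift_mon\<close>
  vanishes on such sets.\<close>

lemma lift_eq_zero: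
  assumes "E 2 * x = 0"
  shows "lift x = 0"
proof -
  have "scl (coef x I) (lift_mon I) = 0" if "I \<in> supp x" for I
  proof (cases "2 \<in> I")
    case True
    then have "\<not> top2 I" by (auto simp: top2_def)
    then show ?thesis by (simp add: lift_mon_def)
  next
    case False
    then have "coef x I = 0"
      using coef_E_mult_insert[of I 2 x] assms that supp_index_sets[of x]
      by (auto simp del: minus_one_power_iff)
    then show ?thesis by simp
  qed
  then show ?thesis
    unfolding lift_def lin_expand by (intro sum.neutral) auto
qed

section \<open>Generators and their span modulo coboundaries\<close>

definition w_sets :: "nat set set"
  where "w_sets = {I. finite I \<and> I \<noteq> {} \<and> (\<forall>i\<in>I. 3 \<le> i)}"

text \<open>The unit represents the constants, which span the cohomology in degree 0.\<close>

definition gens :: "'a::field ext set"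
  where "gens = {1, E 1, E 2, E 2 * E 3, E 3 * E 4 - E 2 * E 5} \<union> wE ` w_sets"

definition gen_classes :: "'a::field ext set"
  where "gen_classes = {x. \<exists>z. x - dE z \<in> ext.span gens}"

lemma gen_classes_gens: "x \<in> gens \<Longrightarrow> x \<in> gen_classes"
proof -
  assume "x \<in> gens"
  then have "x - dE 0 \<in> ext.span gens"
    by (simp add: lin_op_zero[OF lin_op_dE] ext.span_base)
  then show "x \<in> gen_classes" unfolding gen_classes_def by blast
qed

lemma gen_classes_dE: "dE z \<in> gen_classes"
  unfolding gen_classes_def by (auto intro!: exI[of _ z] ext.span_zero)

lemma gen_classes_add: "x \<in> gen_classes \<Longrightarrow> y \<in> gen_classes \<Longrightarrow> x + y \<in> gen_classes"
proof -
  assume "x \<in> gen_classes" "y \<in> gen_classes"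
  then obtain z z' where "x - dE z \<in> ext.span gens" "y - dE z' \<in> ext.span gens"
    by (auto simp: gen_classes_def)
  then have "(x - dE z) + (y - dE z') \<in> ext.span gens" by (rule ext.span_add)
  then show ?thesis
    unfolding gen_classes_def
    by (auto simp: lin_op_add[OF lin_op_dE] algebra_simps intro!: exI[of _ "z + z'"])
qed

lemma gen_classes_scl: "x \<in> gen_classes \<Longrightarrow> scl c x \<in> gen_classes"
proof -
  assume "x \<in> gen_classes"
  then obtain z where "x - dE z \<in> ext.span gens"
    by (auto simp: gen_classes_def)
  then have "scl c (x - dE z) \<in> ext.span gens" by (rule ext.span_scale)
  then show ?thesis
    unfolding gen_classes_def
    by (auto simp: lin_op_scl[OF lin_op_dE] ext.scale_right_diff_distrib intro!: exI[of _ "scl c z"])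
qed

lemma gen_classes_zero: "0 \<in> gen_classes"
  using gen_classes_dE[of 0] by (simp add: lin_op_zero[OF lin_op_dE])

lemma gen_classes_sum: "(\<And>i. i \<in> A \<Longrightarrow> f i \<in> gen_classes) \<Longrightarrow> sum f A \<in> gen_classes"
  by (induction A rule: infinite_finite_induct) (simp_all add: gen_classes_add gen_classes_zero)

text \<open>Together with \<open>W1_one\<close> this exhibits the exceptional generator as W(1, 3),
  so that \<open>dE_W1\<close> applies to it.\<close>

lemma Om1_one_3: "Om1 1 3 = E 3 * E 4 - E 2 * (E 5 :: 'a::field ext)"
proof -
  have "stair del1 (Ef 2) (E 2) 5 = (E 2 * E 5 :: 'a ext)"
    by (subst stair1_rec) (simp add: del1_E Ef_def lin_op_zero[OF lin_op_stair1])
  moreover have "del1 (E 3) = (E 2 :: 'a ext)"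
    by (simp add: del1_E Ef_def)
  ultimately show ?thesis
    unfolding Om1_def by (subst stair1_rec) (simp add: Ef_def eval_nat_numeral)
qed

lemma W1_one: "W Om1 1 n = Om1 1 n"
proof -
  have "cc 1 = (0 :: 'a ext)"
    by (simp add: cc_def derivation_one[OF derivation_ad1] derivation_one[OF derivation_ad2]
        lin_op_zero[OF lin_op_ad1])
  then show ?thesis
    by (subst W1_rec) (simp add: lin_op_zero[OF lin_op_W1])
qed

text \<open>With n = \<open>Max I\<close>, the right-hand side of \<open>dE_W1\<close> contains e^I
  wedge e^n = 0.\<close>

lemma dE_wE:
  assumes "finite I" "I \<noteq> {}"
  shows "dE (wE I :: 'a::field_char_0 ext) = 0"
proof -
  have "Mon I * Ef 2 (Max I) = (0 :: 'a ext)"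
    using Mon_mult_E_in[OF Max_in[OF assms], where ?'a = 'a] by (simp add: Ef_def)
  then have "Om1 (Mon I) (Max I) = (0 :: 'a ext)"
    by (simp add: Om1_def lin_op_zero[OF lin_op_stair1])
  then show ?thesis by (simp add: wE_def dE_W1)
qed

text \<open>Here the right-hand side of \<open>dE_W1\<close> is a multiple of e^2 wedge Omega(1, 2),
  which is 0 by the cut-off at 3.\<close>

lemma dE_W1_one: "dE (E 3 * E 4 - E 2 * E 5 :: 'a::field_char_0 ext) = 0"
proof -
  have "E 2 * Om1 1 2 = (E 2 * Om 1 2 :: 'a ext)" by (rule E2_mult_Om1)
  also have "\<dots> = 0" by (simp add: Om_def Ef_def lin_op_zero[OF lin_op_stair0])
  finally show ?thesis
    using dE_W1[where ?'a = 'a, of 1 2] by (simp add: W1_one Om1_one_3 flip: numeral_3_eq_3)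
qed

lemma dE_gens: "x \<in> gens \<Longrightarrow> dE (x :: 'a::field_char_0 ext) = 0"
proof -
  have "dE 1 = (0 :: 'a ext)" "dE (E 1) = (0 :: 'a ext)" "dE (E 2) = (0 :: 'a ext)"
    "dE (E 2 * E 3) = (0 :: 'a ext)"
    by (simp_all add: dE_eq derivation_mult[OF derivation_del1] derivation_mult[OF derivation_ad2]
       derivation_one[OF derivation_del1] derivation_one[OF derivation_ad2]
       del1_E ad2_E Ef_def E_square)
  then show "x \<in> gens \<Longrightarrow> dE x = 0"
    unfolding gens_def by (elim UnE insertE imageE) (simp_all add: w_sets_def dE_wE dE_W1_one)
qed

lemma dE_span_gens: "x \<in> ext.span gens \<Longrightarrow> dE (x :: 'a::field_char_0 ext) = 0"
  by (induction rule: ext.span_induct_alt)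
     (simp_all add: lin_op_zero[OF lin_op_dE] lin_op_add[OF lin_op_dE] lin_op_scl[OF lin_op_dE] dE_gens)

lemma dE_gen_classes: "x \<in> gen_classes \<Longrightarrow> dE (x :: 'a::field_char_0 ext) = 0"
  unfolding gen_classes_def using dE_span_gens by (force simp: lin_op_diff[OF lin_op_dE] dE_dE)

section \<open>Reduction of cocycles to the generators\<close>

lemma stair1_E2: "2 \<le> n \<Longrightarrow> stair del1 (Ef 2) (E 2) n = E 2 * E n"
  by (subst stair1_rec) (simp add: del1_E Ef_def lin_op_zero[OF lin_op_stair1])

text \<open>By \<open>dE_W1\<close> it is the coboundary of a multiple of W(x, n + 1).\<close>

lemma E2_mult_Om1_in_gen_classes:
  "E 2 * Om1 x n \<in> (gen_classes :: 'a::field_char_0 ext set)"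
proof -
  have "E 2 * Om1 x n = dE (scl (- 1 / 2) (W Om1 x (Suc n)))"
    by (simp add: lin_op_scl[OF lin_op_dE] lin_op_minus[OF lin_op_dE] dE_W1)
  then show ?thesis using gen_classes_dE by metis
qed

text \<open>The exceptional sets give 1, e^2 and e^2 wedge e^3. A set that contains 2 below
  consecutive tops gives e^2 wedge Omega, a coboundary; for all others the difference is 0.\<close>

lemma proj1_mon_red_mon:
  assumes I: "I \<in> index_sets" "I \<subseteq> {2..}"
  shows "proj1_mon I - red_mon I \<in> (gen_classes :: 'a::field_char_0 ext set)"
proof (cases "I = {}")
  case True
  then show ?thesis
    by (auto simp: proj1_mon_def red_mon_def top2_def gens_def intro!: gen_classes_gens)
next
  case False
  from index_set_top[OF I(1) False] obtain n J where J: "I = insert n J" "n \<notin> J" "J \<in> index_sets"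
    "n \<noteq> 0" "\<forall>j\<in>J. j < n" "Max I = n" "I - {n} = J" .
  have n2: "2 \<le> n" "J \<subseteq> {2..<n}" using J(1,5) I(2) by auto
  consider "n = 2" | "n \<noteq> 2" "n - 1 \<notin> I" | "n = 3" "n - 1 \<in> I" | "4 \<le> n" "n - 1 \<in> I"
    using n2 by linarith
  then show ?thesis
  proof cases
    case 1
    then have "J = {}" using n2 by auto
    then have "proj1_mon I = (E 2 :: 'a ext)"
      using False J 1 by (simp add: proj1_mon_def)
        (subst stair1_rec, simp add: Ef_def derivation_one[OF derivation_del1] lin_op_zero[OF lin_op_stair1])
    moreover have "red_mon I = (0 :: 'a ext)"
      using J 1 by (simp add: red_mon_def top2_def)
    ultimately show ?thesis
      by (auto simp: gens_def intro!: gen_classes_gens)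
  next
    case 2
    then show ?thesis
      using False J by (simp add: proj1_mon_def red_mon_def top2_def gen_classes_zero)
  next
    case 3
    then have "2 \<in> J" using J by auto
    moreover have "j = 2" if "j \<in> J" for j
      using bspec[OF J(5) that] n2(2) that 3(1) by auto
    ultimately have "J = {2}" by blast
    then have "proj1_mon I = (E 2 * E 3 :: 'a ext)"
      using False J 3 by (simp add: proj1_mon_def stair1_E2 flip: E_def)
    moreover have "red_mon I = (0 :: 'a ext)"
      using J \<open>J = {2}\<close> by (simp add: red_mon_def top2_def)
    ultimately show ?thesis
      by (auto simp: gens_def intro!: gen_classes_gens)
  next
    case 4
    define m where "m = n - 1"
    have m: "n = Suc m" "3 \<le> m" "m \<in> J"
      using 4 J by (auto simp: m_def)
    define K where "K = J - {m}"
    have JK: "J = insert m K" "m \<notin> K" "K \<in> index_sets"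
      using m J(3) by (auto simp: K_def index_sets_Diff)
    have Km: "k < m" if "k \<in> K" for k
      using bspec[OF J(5), of k] that m by (auto simp: K_def)
    have "(Mon J :: 'a ext) = Mon K * E m"
      unfolding JK(1) using JK m Km by (intro Mon_insert_top) auto
    then have p: "proj1_mon I = (Om1 (Mon K) m :: 'a ext)"
      using False J 4 m by (simp add: proj1_mon_def Om1_def Ef_def)
    show ?thesis
    proof (cases "2 \<in> K")
      case False
      have "K \<subseteq> {3..<m}"
      proof
        fix k
        assume "k \<in> K"
        then have "k < m" "2 \<le> k" "k \<noteq> 2"
          using Km n2(2) False JK by auto
        then show "k \<in> {3..<m}" by auto
      qed
      then have "red_mon I = (Om1 (Mon K) m :: 'a ext)"
        unfolding J(1) JK(1) m(1) using m by (intro red_mon_insert)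
      then show ?thesis by (simp add: p gen_classes_zero)
    next
      case True
      then have "\<not> top2 I" using J(1) JK(1) by (auto simp: top2_def)
      then have r: "red_mon I = (0 :: 'a ext)" by (simp add: red_mon_def)
      define L where "L = K - {2}"
      have L: "K = insert 2 L" "L \<in> index_sets" "2 \<notin> L"
        using True JK by (auto simp: L_def index_sets_Diff)
      have "2 < l" if "l \<in> L" for l
      proof -
        have "l \<in> J" "l \<noteq> 2" using that JK by (auto simp: L_def)
        then show ?thesis using n2(2) by force
      qed
      then have "E 2 * Mon L = (Mon K :: 'a ext)"
        unfolding L(1) using L by (intro E_mult_Mon_less) auto
      \<comment> \<open>As 2 is the smallest index, e^2 stands in front, and it can be pulled out of
        the stair.\<close>
      then have "Om1 (Mon K) m = (E 2 * Om1 (Mon L) m :: 'a ext)"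
        by (simp add: Om1_def E2_mult_stair1 flip: mult.assoc)
      then show ?thesis
        by (simp add: p r E2_mult_Om1_in_gen_classes)
    qed
  qed
qed

text \<open>With x = e^J and n the lower top index, \<open>ad2_Om\<close> and \<open>lift_Om\<close>
  turn the expression into W(x, n) + 2 lift(Omega(x, n - 1)). This is 0 if n - 1 is at least 3 and
  outside J; otherwise the second summand vanishes and the first is a generator.\<close>

lemma red_mon_lift:
  assumes I: "I \<in> index_sets"
  shows "red_mon I - lift (ad2 (red_mon I)) \<in> (gen_classes :: 'a::field_char_0 ext set)"
proof (cases "top2 I")
  case False
  then show ?thesis
    by (simp add: red_mon_def gen_classes_zero lin_op_zero[OF lin_op_ad2] lin_op_zero[OF lin_op_lift])
next
  case True
  from top2_cases[OF I True] obtain n J where J: "I = insert (Suc n) (insert n J)" "3 \<le> n"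
    "J \<subseteq> {3..<n}" "J \<in> index_sets" .
  define m where "m = n - 1"
  have m: "n = Suc m" "2 \<le> m" using J by (auto simp: m_def)
  let ?x = "Mon J :: 'a ext"
  have x: "?x \<in> subalg {3..<n}" by (rule Mon_in_subalg[OF J(3)])
  have red: "red_mon I = Om1 ?x n"
    unfolding J(1) using J by (intro red_mon_insert)
  \<comment> \<open>The difference consists of terms containing e^2, which \<open>lift\<close>
    ignores, so \<open>ad2_Om\<close> becomes available.\<close>
  have "lift (ad2 (Om1 ?x n) - ad2 (Om ?x n)) = 0"
  proof (rule lift_eq_zero)
    have "ad2 (E 2 * Om1 ?x n) = ad2 (E 2 * Om ?x n)"
      by (simp only: E2_mult_Om1)
    then show "E 2 * (ad2 (Om1 ?x n) - ad2 (Om ?x n)) = 0"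
      by (simp add: ad2_E2_mult right_diff_distrib)
  qed
  then have "lift (ad2 (red_mon I)) = lift (Om (cc ?x) n) - scl 2 (lift (Om ?x m))"
    by (simp add: red m(1) ad2_Om lin_op_diff[OF lin_op_lift] lin_op_scl[OF lin_op_lift])
  also have "lift (Om (cc ?x) n) = scl (- 1 / 2) (W Om1 (cc ?x) (Suc n))"
    by (rule lift_Om[OF subalg_cc[OF x] J(2)])
  finally have "red_mon I - lift (ad2 (red_mon I)) =
      (Om1 ?x n + scl (1 / 2) (W Om1 (cc ?x) (Suc n))) + scl 2 (lift (Om ?x m))"
    by (simp add: red)
  also have "Om1 ?x n + scl (1 / 2) (W Om1 (cc ?x) (Suc n)) = W Om1 ?x n"
    by (rule W1_rec[symmetric])
  finally have eq: "red_mon I - lift (ad2 (red_mon I)) = W Om1 ?x n + scl 2 (lift (Om ?x m))" .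
  consider "m = 2" | "3 \<le> m" "m \<in> J" | "3 \<le> m" "m \<notin> J" using m(2) by linarith
  then show ?thesis
  proof cases
    case 1
    then have "J = {}" using J m by auto
    moreover from this have "Om ?x m = 0"
      using 1 by (simp add: Om_def Ef_def lin_op_zero[OF lin_op_stair0])
    ultimately have "red_mon I - lift (ad2 (red_mon I)) = (E 3 * E 4 - E 2 * E 5 :: 'a ext)"
      using 1 by (simp add: eq m(1) W1_one Om1_one_3 lin_op_zero[OF lin_op_lift] flip: numeral_3_eq_3)
    then show ?thesis
      by (auto simp: gens_def intro!: gen_classes_gens)
  next
    case 2
    have "Om ?x m = 0"
      using 2 Mon_mult_E_in[of m J, where ?'a = 'a] by (simp add: Om_def Ef_def lin_op_zero[OF lin_op_stair0])
    moreover have "Max J = m"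
      using J 2 m(1) finite_subset[OF J(3)] by (intro Max_eqI) auto
    ultimately have "red_mon I - lift (ad2 (red_mon I)) = (wE J :: 'a ext)"
      by (simp add: eq m(1) wE_def lin_op_zero[OF lin_op_lift])
    moreover have "J \<in> w_sets"
      using J(3) 2 finite_subset[OF J(3)] by (auto simp: w_sets_def)
    ultimately show ?thesis
      by (simp add: gens_def gen_classes_gens)
  next
    case 3
    have "J \<subseteq> {3..<m}"
    proof
      fix j
      assume "j \<in> J"
      then have "j < n" "3 \<le> j" "j \<noteq> m" using J(3) 3 by auto
      then show "j \<in> {3..<m}" using m by auto
    qed
    then have "lift (Om ?x m) = scl (- 1 / 2) (W Om1 ?x n)"
      unfolding m(1) using 3 by (intro lift_Om Mon_in_subalg)
    then show ?thesis by (simp add: eq gen_classes_zero)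
  qed
qed

text \<open>Of the two summands of \<open>dE y\<close> in \<open>dE_eq\<close>, only the one with
  \<open>del1\<close> contains e^1, so it vanishes by itself.\<close>

lemma dE_eq_zero_subalg:
  assumes y: "y \<in> subalg {2..}" and dy: "dE y = 0"
  shows "del1 y = 0"
proof (rule ext_eqI)
  fix I :: "nat set"
  assume I: "I \<in> index_sets"
  show "coef (del1 y) I = coef 0 I"
  proof (cases "1 \<in> I")
    case True
    then have "\<not> I \<subseteq> {2..}" by auto
    then show ?thesis
      using subalg_del1_from2[OF y] by (auto simp: subalg_def supp_def)
  next
    case False
    have "E 2 * ad2 y \<in> subalg {2..}"
      by (intro subalg_mult E_in_subalg subalg_ad2_from2 y) simp
    then have "coef (E 2 * ad2 y) (insert 1 I) = 0"
      by (auto simp: subalg_def supp_def)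
    moreover have "coef (dE y) (insert 1 I) = 0"
      using dy by simp
    ultimately have "coef (E 1 * del1 y) (insert 1 I) = 0"
      by (simp add: dE_eq coef_add)
    then show ?thesis
      using coef_E_mult_insert[OF I _ False, of "del1 y"] by (auto simp del: minus_one_power_iff)
  qed
qed

text \<open>Since \<open>del1 y = 0\<close>, y equals its projection, which differs from
  \<open>y0\<close> by an element of \<open>gen_classes\<close>. The remaining condition e^2 wedge
  \<open>ad2 y0\<close> = 0 makes \<open>lift (ad2 y0)\<close> vanish, so it may be subtracted, and
  then \<open>red_mon_lift\<close> applies termwise.\<close>

lemma cocycle_subalg:
  fixes y :: "'a::field_char_0 ext"
  assumes y: "y \<in> subalg {2..}" and dy: "dE y = 0"
  shows "y \<in> gen_classes"
proof -
  have del: "del1 y = 0"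
    using assms by (rule dE_eq_zero_subalg)
  define y0 where "y0 = lin red_mon y"
  have supp: "I \<in> index_sets" "I \<subseteq> {2..}" if "I \<in> supp y" for I
    using that y supp_index_sets[of y] by (auto simp: subalg_def)
  have "y = lin proj1_mon y"
    using proj1_homotopy[OF y] del by (simp add: lin_op_zero[OF lin_op_homotopy])
  then have "y - y0 = lin proj1_mon y - lin red_mon y"
    by (simp add: y0_def)
  also have "\<dots> = (\<Sum>I\<in>supp y. scl (coef y I) (proj1_mon I - red_mon I))"
    by (simp add: lin_expand sum_subtractf ext.scale_right_diff_distrib)
  also have "\<dots> \<in> gen_classes"
    using supp by (intro gen_classes_sum gen_classes_scl proj1_mon_red_mon)
  finally have diff: "y - y0 \<in> gen_classes" .
  then have "dE y0 = 0"
    using dE_gen_classes[of "y - y0"] dy by (simp add: lin_op_diff[OF lin_op_dE])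
  moreover have "del1 y0 = 0"
    unfolding y0_def lin_expand lin_op_sum[OF lin_op_del1]
    by (intro sum.neutral) (simp add: lin_op_scl[OF lin_op_del1] red_mon_def del1_Om1 lin_op_zero[OF lin_op_del1])
  ultimately have "lift (ad2 y0) = 0"
    by (intro lift_eq_zero) (simp add: dE_eq)
  then have "y0 = y0 - lift (ad2 y0)" by simp
  also have "\<dots> = (\<Sum>I\<in>supp y. scl (coef y I) (red_mon I - lift (ad2 (red_mon I))))"
    unfolding y0_def lin_expand
    by (simp add: lin_op_sum[OF lin_op_ad2] lin_op_sum[OF lin_op_lift] lin_op_scl[OF lin_op_ad2]
        lin_op_scl[OF lin_op_lift] sum_subtractf ext.scale_right_diff_distrib)
  also have "\<dots> \<in> gen_classes"
    using supp by (intro gen_classes_sum gen_classes_scl red_mon_lift)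
  finally have "y0 \<in> gen_classes" .
  then show ?thesis
    using gen_classes_add[OF diff, of y0] by simp
qed

lemma split_E1: "\<exists>y\<in>subalg {2..}. \<exists>z\<in>subalg {2..}. x = y + E 1 * z"
proof (induction x rule: ext_induct)
  case (add x x')
  then obtain y z y' z' where "y \<in> subalg {2..}" "z \<in> subalg {2..}" "x = y + E 1 * z"
    "y' \<in> subalg {2..}" "z' \<in> subalg {2..}" "x' = y' + E 1 * z'" by blast
  then show ?case
    by (intro bexI[of _ "y + y'"] bexI[of _ "z + z'"]) (auto simp: distrib_left subalg_add add_ac)
next
  case (Mon c I)
  then have ge: "2 \<le> i" if "i \<in> I" "i \<noteq> 1" for i
    using that by (cases "i = 0") (auto simp: index_sets_def)
  show ?case
  proof (cases "1 \<in> I")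
    case True
    have "E 1 * Mon (I - {1}) = (Mon (insert 1 (I - {1})) :: 'a ext)"
      using Mon by (intro E_mult_Mon_less) (auto simp: index_sets_Diff dest: ge)
    then have "scl c (Mon I) = 0 + E 1 * scl c (Mon (I - {1}) :: 'a ext)"
      using True by (simp add: scl_mult_right insert_absorb del: One_nat_def)
    moreover have "scl c (Mon (I - {1}) :: 'a ext) \<in> subalg {2..}"
      using ge by (intro subalg_scl Mon_in_subalg) auto
    ultimately show ?thesis using subalg_zero by blast
  next
    case False
    then have "scl c (Mon I :: 'a ext) \<in> subalg {2..}"
      using ge by (intro subalg_scl Mon_in_subalg) force
    moreover have "scl c (Mon I :: 'a ext) = scl c (Mon I) + E 1 * 0" by simp
    ultimately show ?thesis using subalg_zero by blast
  qed
qed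

text \<open>Write x = y + e^1 wedge z. Subtracting the coboundary of a \<open>del1\<close>-primitive
  h of z removes z apart from its constant term, which gives a multiple of the generator e^1. The
  rest is free of e^1.\<close>

theorem cocycle_in_gen_classes:
  fixes x :: "'a::field_char_0 ext"
  assumes "dE x = 0"
  shows "x \<in> gen_classes"
proof -
  obtain y z where y: "y \<in> subalg {2..}" and z: "z \<in> subalg {2..}" and x: "x = y + E 1 * z"
    using split_E1 by blast
  define h where "h = homotopy z"
  have h: "h \<in> subalg {2..}" "del1 h = z - scl (coef z {}) 1"
    unfolding h_def using z by (simp_all add: subalg_homotopy del1_homotopy)
  \<comment> \<open>The correction is the e^2 part of \<open>dE h\<close>; its e^1 part accounts for
    z.\<close>
  define y' where "y' = y - E 2 * ad2 h"
  have y': "y' \<in> subalg {2..}"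
    unfolding y'_def by (intro subalg_diff y subalg_mult E_in_subalg subalg_ad2_from2 h) simp
  have eq: "x = y' + scl (coef z {}) (E 1) + dE h"
    unfolding x y'_def dE_eq h(2) by (simp add: right_diff_distrib scl_mult_right)
  have E1: "E 1 \<in> (gens :: 'a ext set)" by (simp add: gens_def)
  have "dE y' = 0"
    using assms dE_gens[OF E1] unfolding eq
    by (simp add: lin_op_add[OF lin_op_dE] lin_op_scl[OF lin_op_dE] dE_dE)
  then have "y' \<in> gen_classes"
    by (rule cocycle_subalg[OF y'])
  then show ?thesis
    unfolding eq by (simp add: gen_classes_add gen_classes_scl gen_classes_dE gen_classes_gens E1 del: One_nat_def)
qed

section \<open>Linear independence\<close>

lemma coef_mult_E:
  assumes "x \<in> subalg {2..<n}" "n \<le> m" "2 \<le> m" "\<And>I. I \<subseteq> {2..<n} \<Longrightarrow> J \<noteq> insert m I"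
  shows "coef (x * E m) J = 0"
  using assms(1)
proof (induction rule: subalg_induct)
  case (Mon c I)
  have "Mon I * E m = (Mon (insert m I) :: 'a ext)"
    using Mon assms(2,3) by (intro Mon_mult_E_greater) auto
  then show ?case
    using Mon assms(3) assms(4)[of I] by (auto simp: scl_mult_left coef_scl coef_Mon)
qed (simp_all add: distrib_right coef_add)

lemma coef_mult_E_E:
  assumes "x \<in> subalg {3..<n}" "n \<le> m" "3 \<le> m"
    "\<And>I. I \<subseteq> {3..<n} \<Longrightarrow> J \<noteq> insert (Suc m) (insert m I)"
  shows "coef (x * E m * E (Suc m)) J = 0"
  using assms(1)
proof (induction rule: subalg_induct)
  case (Mon c I)
  have "Mon I * E m * E (Suc m) = (Mon (insert (Suc m) (insert m I)) :: 'a ext)"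
    using Mon assms(2,3) by (intro Mon_mult_E_E) auto
  then show ?case
    using Mon assms(3) assms(4)[of I] by (auto simp: scl_mult_left coef_scl coef_Mon)
qed (simp_all add: distrib_right coef_add)

text \<open>No monomial of the stair has consecutive tops: the last index starts at n + 1, above
  indices below n, and moves further up.\<close>

lemma coef_stair1:
  assumes "x \<in> subalg {2..<n}" and J: "Max J - 1 \<in> J"
  shows "coef (stair del1 (Ef 2) x (Suc n)) J = 0"
  using locally_nilpotent_del1 assms(1)
proof (induction x arbitrary: n rule: locally_nilpotent_induct)
  case zero
  then show ?case by (simp add: lin_op_zero[OF lin_op_stair1])
next
  case (step x)
  have "coef (x * Ef 2 (Suc n)) J = 0"
  proof (cases "2 \<le> Suc n")
    case True
    have "J \<noteq> insert (Suc n) I" if I: "I \<subseteq> {2..<n}" for I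
    proof
      assume "J = insert (Suc n) I"
      moreover have "Max (insert (Suc n) I) = Suc n"
        using I by (intro Max_insert_less) (auto intro: finite_subset)
      ultimately show False using J I by auto
    qed
    then show ?thesis
      using True step.prems by (simp add: Ef_def coef_mult_E)
  qed (simp add: Ef_def)
  moreover have "del1 x \<in> subalg {2..<Suc n}"
    by (rule subalg_mono[OF subalg_del1[OF step.prems]]) auto
  ultimately show ?case
    by (subst stair1_rec) (simp add: coef_diff step.IH)
qed

lemma coef_Om1:
  assumes x: "x \<in> subalg {3..<n}" and "n \<le> m" "3 \<le> m" and J: "Max J - 1 \<in> J"
  shows "coef (Om1 x m) J = coef (x * E m * E (Suc m)) J"
proof -
  have "x * E m \<in> subalg {2..<Suc m}"
    using assms by (intro subalg_mult E_in_subalg) (auto intro: subalg_mono)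
  then have "coef (stair del1 (Ef 2) (del1 (x * E m)) (Suc (Suc m))) J = 0"
    by (intro coef_stair1 subalg_del1 J)
  then show ?thesis
    using assms(3) unfolding Om1_def by (subst stair1_rec) (simp add: Ef_def coef_diff)
qed

text \<open>Up to monomials without consecutive tops, each summand is y wedge e^m wedge e^(m+1) with
  y below m - 1, so three consecutive top indices do not occur.\<close>

lemma coef_W1:
  assumes "x \<in> subalg {3..<n}" "3 \<le> n" and J: "Max J - 1 \<in> J" "Max J - 2 \<in> J"
  shows "coef (W Om1 x (Suc n)) J = 0"
  using locally_nilpotent_cc assms(1,2)
proof (induction x arbitrary: n rule: locally_nilpotent_induct)
  case zero
  then show ?case by (simp add: lin_op_zero[OF lin_op_W1])
next
  case (step x)
  have neq: "J \<noteq> insert (Suc (Suc n)) (insert (Suc n) I)" if I: "I \<subseteq> {3..<n}" for I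
  proof
    assume "J = insert (Suc (Suc n)) (insert (Suc n) I)"
    moreover have "Max (insert (Suc (Suc n)) (insert (Suc n) I)) = Suc (Suc n)"
      using I by (intro Max_insert_less) (auto intro: finite_subset)
    ultimately show False using J I by auto
  qed
  have "coef (Om1 x (Suc n)) J = coef (x * E (Suc n) * E (Suc (Suc n))) J"
    using step.prems(2) by (intro coef_Om1[OF step.prems(1) _ _ J(1)]) simp_all
  also have "\<dots> = 0"
    using step.prems(2) by (intro coef_mult_E_E[OF step.prems(1)] neq) simp_all
  finally have "coef (Om1 x (Suc n)) J = 0" .
  moreover have "cc x \<in> subalg {3..<Suc n}"
    by (rule subalg_mono[OF subalg_cc[OF step.prems(1)]]) auto
  ultimately show ?case
    using step.prems by (subst W1_rec) (simp add: coef_add coef_scl step.IH)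
qed

text \<open>The index set of the leading monomial of \<open>wE I\<close>, used as a coordinate that
  detects I.\<close>

definition top_ext :: "nat set \<Rightarrow> nat set"
  where "top_ext I = insert (Max I + 2) (insert (Max I + 1) I)"

lemma Max_w_sets: "I \<in> w_sets \<Longrightarrow> 3 \<le> Max I"
  using Max_in[of I] by (auto simp: w_sets_def)

lemma Max_top_ext: "I \<in> w_sets \<Longrightarrow> Max (top_ext I) = Max I + 2"
  unfolding top_ext_def
  by (rule Max_insert_less) (auto simp: w_sets_def less_Suc_eq_le intro: le_SucI)

lemma top_ext_inject:
  assumes "I \<in> w_sets" "J \<in> w_sets" "top_ext I = top_ext J"
  shows "I = J"
proof -
  have "Max I = Max J"
    using assms Max_top_ext by (metis add_right_cancel)
  moreover have "I = top_ext I - {Max I + 1, Max I + 2}" if "I \<in> w_sets" for I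
  proof -
    have "i \<le> Max I" if "i \<in> I" for i
      using that \<open>I \<in> w_sets\<close> by (simp add: w_sets_def)
    from this[of "Max I + 1"] this[of "Max I + 2"] have "Max I + 1 \<notin> I" "Max I + 2 \<notin> I"
      by auto
    then show ?thesis by (auto simp: top_ext_def)
  qed
  ultimately show ?thesis
    using assms by metis
qed

text \<open>By \<open>coef_W1\<close> the terms of \<open>W_rec\<close> after the first do not
  contribute, and the first contributes only its leading monomial. So these coordinates are dual to
  the forms.\<close>

lemma coef_wE:
  assumes I: "I \<in> w_sets" and J: "J \<in> w_sets"
  shows "coef (wE I :: 'a::field ext) (top_ext J) = (if I = J then 1 else 0)"
proof -
  let ?n = "Suc (Max I)" and ?J = "top_ext J"
  have J': "Max ?J - 1 \<in> ?J" "Max ?J - 2 \<in> ?J"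
    unfolding Max_top_ext[OF J] using Max_in[of J] J by (auto simp: top_ext_def w_sets_def)
  have fin: "finite I" "I \<noteq> {}" and index: "I \<in> index_sets"
    using I by (auto simp: w_sets_def index_sets_def)
  have n: "3 \<le> ?n" using Max_w_sets[OF I] by simp
  have "I \<subseteq> {3..<?n}"
    using I Max_ge[OF fin(1)] by (auto simp: w_sets_def less_Suc_eq_le)
  then have x: "(Mon I :: 'a ext) \<in> subalg {3..<?n}" by (rule Mon_in_subalg)
  have "coef (wE I :: 'a ext) ?J = coef (Om1 (Mon I) ?n) ?J"
    unfolding wE_def using coef_W1[OF subalg_cc[OF x] n J']
    by (subst W1_rec) (simp add: coef_add coef_scl)
  also have "\<dots> = coef (Mon I * E ?n * E (Suc ?n)) ?J"
    by (rule coef_Om1[OF x order.refl n J'(1)])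
  also have "Mon I * E ?n * E (Suc ?n) = Mon (top_ext I)"
    using Mon_mult_E_E[OF index, of ?n] Max_ge[OF fin(1)]
    by (simp add: top_ext_def less_Suc_eq_le)
  also have "coef (Mon (top_ext I) :: 'a ext) ?J = (if I = J then 1 else 0)"
    using top_ext_inject[OF I J] index by (auto simp: coef_Mon top_ext_def)
  finally show ?thesis .
qed

text \<open>A coboundary is a sum of multiples of e^1 and e^2, whereas the indices of
  \<open>top_ext I\<close> are at least 3.\<close>

lemma coef_dE_top_ext:
  assumes "I \<in> w_sets"
  shows "coef (dE z) (top_ext I) = 0"
proof -
  have "1 \<notin> top_ext I" "2 \<notin> top_ext I"
  proof -
    have "1 \<notin> I" "2 \<notin> I" using assms by (auto simp: w_sets_def)
    then show "1 \<notin> top_ext I" "2 \<notin> top_ext I"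
      using Max_w_sets[OF assms] by (auto simp: top_ext_def)
  qed
  then show ?thesis
    by (simp add: dE_eq coef_add coef_E_mult_notin)
qed


section \<open>Counting partitions\<close>

text \<open>For m \<ge> 1 these are the partitions of k into m + c parts whose c + 1 largest parts
  coincide, written with a single copy of that part.\<close>

definition weighted_parts :: "nat \<Rightarrow> nat \<Rightarrow> int \<Rightarrow> nat list set"
  where "weighted_parts m c k = {xs. length xs = m \<and> sorted xs \<and> (\<forall>x\<in>set xs. 1 \<le> x)
    \<and> int (sum_list xs) + int c * int (last xs) = k}"

lemma finite_weighted_parts: "finite (weighted_parts m c k)"
proof (rule finite_subset)
  show "weighted_parts m c k \<subseteq> {xs. set xs \<subseteq> {..nat k} \<and> length xs = m}"
  proof
    fix xs
    assume xs: "xs \<in> weighted_parts m c k"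
    then have "int (sum_list xs) \<le> k"
      by (auto simp: weighted_parts_def)
    moreover have "x \<le> sum_list xs" if "x \<in> set xs" for x
      using that by (intro member_le_sum_list) auto
    ultimately have "x \<le> nat k" if "x \<in> set xs" for x
      using that by fastforce
    then show "xs \<in> {xs. set xs \<subseteq> {..nat k} \<and> length xs = m}"
      using xs by (auto simp: weighted_parts_def)
  qed
  show "finite {xs. set xs \<subseteq> {..nat k} \<and> length xs = m}"
    by (rule finite_lists_length_eq) simp
qed

text \<open>Lowering the last part pairs off the partitions whose last two parts differ.\<close>

lemma card_weighted_parts:
  assumes "1 \<le> m"
  shows "card (weighted_parts (Suc m) c k) =
    card (weighted_parts m (Suc c) k) + card (weighted_parts (Suc m) c (k - int (Suc c)))"
proof -
  \<comment> \<open>\<open>?f\<close> makes one of the extra copies of the largest part explicit;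
    \<open>?g\<close> raises the largest part by 1, which adds c + 1 to the weighted sum.\<close>
  let ?f = "\<lambda>xs. xs @ [last xs]" and ?g = "\<lambda>xs :: nat list. butlast xs @ [Suc (last xs)]"
  let ?A = "weighted_parts m (Suc c) k" and ?B = "weighted_parts (Suc m) c (k - int (Suc c))"
  have nonempty: "xs \<noteq> []" if "xs \<in> ?A \<or> xs \<in> ?B" for xs
    using that assms by (auto simp: weighted_parts_def)
  have sorted_le_last: "x \<le> last xs" if "sorted xs" "x \<in> set xs" for x and xs :: "nat list"
    using that by (induction xs) auto
  have "weighted_parts (Suc m) c k = ?f ` ?A \<union> ?g ` ?B"
  proof (intro equalityI subsetI)
    fix xs
    assume xs: "xs \<in> weighted_parts (Suc m) c k"
    then obtain ys b where ys: "xs = ys @ [b]" "length ys = m"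
      by (cases xs rule: rev_cases) (auto simp: weighted_parts_def)
    then have "ys \<noteq> []" using assms by auto
    then have last: "last ys \<in> set ys" by simp
    have sorted: "sorted ys" "\<forall>y\<in>set ys. y \<le> b" "1 \<le> b" "\<forall>y\<in>set ys. 1 \<le> y"
      "int (sum_list ys) + int b + int c * int b = k"
      using xs ys by (auto simp: weighted_parts_def sorted_append)
    show "xs \<in> ?f ` ?A \<union> ?g ` ?B"
    proof (cases "last ys = b")
      case True
      then have "ys \<in> ?A"
        using sorted ys by (auto simp: weighted_parts_def algebra_simps)
      then show ?thesis using ys True by auto
    next
      case False
      then have lt: "last ys < b" using sorted last by (simp add: le_neq_implies_less)
      define b' where "b' = b - 1"
      have b: "b = Suc b'" using lt by (simp add: b'_def)
      have "1 \<le> b'" using lt sorted(4) last b by fastforce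
      moreover have "\<forall>y\<in>set ys. y \<le> b'"
        using lt sorted_le_last[OF sorted(1)] b by fastforce
      ultimately have "ys @ [b'] \<in> ?B"
        using sorted ys b by (auto simp: weighted_parts_def sorted_append algebra_simps)
      moreover have "xs = ?g (ys @ [b'])" using ys b by simp
      ultimately show ?thesis by blast
    qed
  next
    fix xs
    assume "xs \<in> ?f ` ?A \<union> ?g ` ?B"
    then show "xs \<in> weighted_parts (Suc m) c k"
    proof
      assume "xs \<in> ?f ` ?A"
      then obtain ys where "xs = ?f ys" "ys \<in> ?A" by blast
      then show ?thesis
        using nonempty[of ys] sorted_le_last[of ys]
        by (auto simp: weighted_parts_def sorted_append algebra_simps)
    next
      assume "xs \<in> ?g ` ?B"
      then obtain ys where ys: "xs = ?g ys" "ys \<in> ?B" by blast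
      then obtain zs b where "ys = zs @ [b]"
        using nonempty[of ys] by (cases ys rule: rev_cases) auto
      with ys show ?thesis
        by (auto simp: weighted_parts_def sorted_append algebra_simps intro: le_SucI)
    qed
  qed
  \<comment> \<open>The last two parts agree in the image of \<open>?f\<close> and differ in the
    image of \<open>?g\<close>.\<close>
  moreover have "?f ` ?A \<inter> ?g ` ?B = {}"
  proof -
    have "?f xs \<noteq> ?g ys" if "xs \<in> ?A" "ys \<in> ?B" for xs ys
    proof
      assume eq: "?f xs = ?g ys"
      then have "xs = butlast ys" "last xs = Suc (last ys)"
        unfolding append1_eq_conv by blast+
      moreover have "xs \<noteq> []" using nonempty that by blast
      moreover have "last xs \<in> set xs" using \<open>xs \<noteq> []\<close> by simp
      ultimately have "Suc (last ys) \<in> set ys" using in_set_butlastD by metis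
      then show False
        using sorted_le_last[of ys] that(2) by (fastforce simp: weighted_parts_def)
    qed
    then show ?thesis by blast
  qed
  moreover have "inj_on ?f ?A" by (rule inj_onI) simp
  moreover have "inj_on ?g ?B"
    using nonempty by (intro inj_onI) (metis append1_eq_conv append_butlast_last_id nat.inject)
  ultimately show ?thesis
    by (simp add: card_Un_disjoint finite_weighted_parts card_image)
qed

section \<open>Labels of generators as partitions\<close>

lemma parts_eq: "parts q k = card (weighted_parts q 0 k)"
  by (simp add: parts_def weighted_parts_def)

text \<open>The labels belonging to degree q and weight k: the two appended indices add 2
  \<open>Max I\<close> + 3.\<close>

definition w_index :: "nat \<Rightarrow> int \<Rightarrow> nat set set"
  where "w_index q k = {I \<in> w_sets. card I + 2 = q \<and> int (\<Sum>I) + 2 * int (Max I) + 3 = k}"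

lemma sum_shift: "2 * (\<Sum>i<p. i + 2) = p * (p + 3)" for p :: nat
  by (induction p) (auto simp: algebra_simps)

text \<open>Subtracting the staircase 2, 3, ... from the increasing indices gives a weakly
  increasing list of positive parts. With the two appended indices, p + 2 steps of total (p + 2)(p +
  5)/2 are removed, and the largest part is counted three times.\<close>

lemma card_w_index:
  assumes "1 \<le> p"
  shows "card (w_index (p + 2) (k + int ((p + 2) * (p + 5) div 2))) = card (weighted_parts p 2 k)"
proof -
  let ?K = "k + int ((p + 2) * (p + 5) div 2)"
  \<comment> \<open>Positions start at 0, so a part 1 in first place corresponds to the smallest
    admissible index 3.\<close>
  define h :: "nat list \<Rightarrow> nat list" where "h xs = map (\<lambda>i. xs ! i + i + 2) [0..<p]" for xs
  define g :: "nat list \<Rightarrow> nat list" where "g xs = map (\<lambda>i. xs ! i - i - 2) [0..<p]" for xs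
  have "(p + 2) * (p + 5) = 2 * ((\<Sum>i<p. i + 2) + 2 * p + 5)"
    using sum_shift[of p] by (simp add: algebra_simps)
  \<comment> \<open>As \<open>Max I\<close> is the last part plus p + 1, the summand 2 p + 5 is what
    2 \<open>Max I\<close> + 3 contributes besides twice the last part.\<close>
  then have K: "?K = k + int (\<Sum>i<p. i + 2) + 2 * int p + 5"
    by simp
  have last_nth: "last xs = xs ! (p - 1)" if "length xs = p" for xs :: "nat list"
    using that assms by (subst last_conv_nth) auto
  have sum_h: "sum_list (h xs) = sum_list xs + (\<Sum>i<p. i + 2)" if "length xs = p" for xs
  proof -
    have "sum_list (h xs) = (\<Sum>i<p. xs ! i + (i + 2))"
      by (simp add: h_def sum_list_sum_nth lessThan_atLeast0 add.assoc)
    also have "\<dots> = (\<Sum>i<p. xs ! i) + (\<Sum>i<p. i + 2)"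
      by (rule sum.distrib)
    also have "(\<Sum>i<p. xs ! i) = sum_list xs"
      using that by (simp add: sum_list_sum_nth lessThan_atLeast0)
    finally show ?thesis .
  qed
  have last_h: "last (h xs) = last xs + p + 1" if "length xs = p" for xs
    using that assms last_nth[of xs] last_nth[of "h xs"] by (simp add: h_def)
  have strict_h: "sorted_wrt (<) (h xs)" if "length xs = p" "sorted xs" for xs
    using that by (auto simp: h_def sorted_wrt_iff_nth_less intro!: add_le_less_mono sorted_nth_mono)
  have set_sorted: "sorted_list_of_set (set L) = L" if "sorted_wrt (<) L" for L :: "nat list"
    using that by (simp add: sorted_list_of_set.idem_if_sorted_distinct strict_sorted_iff)
  have Max_set: "Max (set L) = last L" if "sorted_wrt (<) L" "L \<noteq> []" for L :: "nat list"
  proof (rule Max_eqI)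
    show "x \<le> last L" if "x \<in> set L" for x
      using that \<open>sorted_wrt (<) L\<close> by (induction L) (auto simp: less_imp_le)
  qed (use that in auto)
  have sum_set: "\<Sum>(set L) = sum_list L" if "sorted_wrt (<) L" for L :: "nat list"
    using that sum_list_distinct_conv_sum_set[of L "\<lambda>x. x"] by (simp add: strict_sorted_iff)
  have "bij_betw (\<lambda>xs. set (h xs)) (weighted_parts p 2 k) (w_index (p + 2) ?K)"
  proof (rule bij_betw_byWitness[where f' = "\<lambda>I. g (sorted_list_of_set I)"])
    show "\<forall>xs\<in>weighted_parts p 2 k. g (sorted_list_of_set (set (h xs))) = xs"
    proof
      fix xs
      assume "xs \<in> weighted_parts p 2 k"
      then have "length xs = p" "sorted xs" by (auto simp: weighted_parts_def)
      then show "g (sorted_list_of_set (set (h xs))) = xs"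
        by (simp add: set_sorted strict_h) (simp add: g_def h_def list_eq_iff_nth_eq)
    qed
    show "(\<lambda>xs. set (h xs)) ` weighted_parts p 2 k \<subseteq> w_index (p + 2) ?K"
    proof (rule image_subsetI)
      fix xs
      assume xs: "xs \<in> weighted_parts p 2 k"
      then have len: "length xs = p" "sorted xs" by (auto simp: weighted_parts_def)
      have str: "sorted_wrt (<) (h xs)" using len by (rule strict_h)
      have ne: "h xs \<noteq> []" using assms by (simp add: h_def)
      have "1 \<le> xs ! i" if "i < p" for i
        using xs that by (auto simp: weighted_parts_def)
      then have "\<forall>i\<in>set (h xs). 3 \<le> i"
        by (fastforce simp: h_def)
      moreover have "card (set (h xs)) = p"
        using str by (simp add: strict_sorted_iff distinct_card) (simp add: h_def)
      ultimately show "set (h xs) \<in> w_index (p + 2) ?K"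
        using xs ne unfolding w_index_def w_sets_def K
        by (simp add: Max_set[OF str ne] sum_set[OF str] sum_h[OF len(1)] last_h[OF len(1)]
            weighted_parts_def del: of_nat_sum)
    qed
    have inverse: "h (g L) = L \<and> sorted (g L) \<and> (\<forall>x\<in>set (g L). 1 \<le> x)"
      if L: "length L = p" "sorted_wrt (<) L" "\<forall>x\<in>set L. 3 \<le> x" for L
    proof -
      have step: "L ! i < L ! Suc i" if "Suc i < p" for i
        using L that by (simp add: sorted_wrt_nth_less)
      \<comment> \<open>This bound makes the truncated subtraction in \<open>g\<close>
        exact.\<close>
      have low: "i + 3 \<le> L ! i" if "i < p" for i
        using that
      proof (induction i)
        case 0
        then show ?case using L by simp
      next
        case (Suc i)
        then show ?case using step[of i] by simp
      qed
      have "h (g L) = L"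
      proof (rule nth_equalityI)
        fix i
        assume "i < length (h (g L))"
        then have "i < p" by (simp add: h_def)
        then show "h (g L) ! i = L ! i"
          using low[of i] by (simp add: h_def g_def)
      qed (simp add: h_def L)
      moreover have "sorted (g L)"
        unfolding sorted_iff_nth_Suc
      proof (intro allI impI)
        fix i
        assume "Suc i < length (g L)"
        then have "Suc i < p" by (simp add: g_def)
        then show "g L ! i \<le> g L ! Suc i"
          using step[of i] low[of i] by (simp add: g_def)
      qed
      moreover have "\<forall>x\<in>set (g L). 1 \<le> x"
        using low by (fastforce simp: g_def)
      ultimately show ?thesis by blast
    qed
    have lists: "length (sorted_list_of_set I) = p" "sorted_wrt (<) (sorted_list_of_set I)"
      "\<forall>x\<in>set (sorted_list_of_set I). 3 \<le> x" "set (sorted_list_of_set I) = I"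
      if "I \<in> w_index (p + 2) ?K" for I
      using that by (auto simp: w_index_def w_sets_def)
    show "\<forall>I\<in>w_index (p + 2) ?K. set (h (g (sorted_list_of_set I))) = I"
      using inverse lists by metis
    show "(\<lambda>I. g (sorted_list_of_set I)) ` w_index (p + 2) ?K \<subseteq> weighted_parts p 2 k"
    proof (rule image_subsetI)
      fix I
      assume I: "I \<in> w_index (p + 2) ?K"
      let ?L = "sorted_list_of_set I"
      have inv: "h (g ?L) = ?L" "sorted (g ?L)" "\<forall>x\<in>set (g ?L). 1 \<le> x"
        using inverse[OF lists(1-3)[OF I]] by auto
      have len: "length (g ?L) = p" by (simp add: g_def)
      have ne: "?L \<noteq> []"
        using lists(1)[OF I] assms by (metis list.size(3) not_one_le_zero)
      have "Max I = last (g ?L) + p + 1"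
        using Max_set[OF lists(2)[OF I] ne] last_h[OF len] lists(4)[OF I] inv by simp
      moreover have "\<Sum>I = sum_list (g ?L) + (\<Sum>i<p. i + 2)"
        using sum_set[OF lists(2)[OF I]] sum_h[OF len] lists(4)[OF I] inv by simp
      ultimately show "g ?L \<in> weighted_parts p 2 k"
        using I inv len unfolding w_index_def K
        by (simp add: weighted_parts_def del: of_nat_sum)
    qed
  qed
  then show ?thesis
    by (simp add: bij_betw_same_card)
qed

text \<open>The recursion for c = 0 and then c = 1 applies the difference operators 1 - S and 1 -
  S^2, with S the shift by 1, to the number of partitions into q parts; their product has the four
  terms.\<close>

lemma card_w_index_parts:
  assumes "3 \<le> q"
  shows "int (card (w_index q (k + int (q * (q + 3) div 2)))) =
    int (parts q k) - int (parts q (k - 1)) - int (parts q (k - 2)) + int (parts q (k - 3))"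
proof -
  define p where "p = q - 2"
  have q: "q = Suc (Suc p)" "1 \<le> p" using assms by (auto simp: p_def)
  have *: "card (weighted_parts q 0 k) =
      card (weighted_parts (Suc p) 1 k) + card (weighted_parts q 0 (k - 1))" for k
    using card_weighted_parts[of "Suc p" 0 k] by (simp add: q)
  have "card (weighted_parts (Suc p) 1 k) =
      card (weighted_parts p 2 k) + card (weighted_parts (Suc p) 1 (k - 2))"
    using card_weighted_parts[OF q(2), of 1 k] by (simp add: numeral_2_eq_2)
  moreover have "card (w_index q (k + int (q * (q + 3) div 2))) = card (weighted_parts p 2 k)"
  proof -
    have eq: "q * (q + 3) = (p + 2) * (p + 5)" using q(1) by (simp add: algebra_simps)
    show ?thesis
      unfolding eq using card_w_index[OF q(2), of k] by (simp add: q(1))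
  qed
  ultimately show ?thesis
    using *[of k] *[of "k - 2"] by (simp add: parts_eq)
qed


section \<open>The cohomology of \<open>\<mm>\<^sub>2\<close>\<close>

lemma form_of_0: "form_of 0 = 0"
  by (rule zero_ext.rep_eq)

lemma form_of_1: "form_of 1 = mon {}"
  by (rule one_ext.rep_eq)

lemma form_of_gens: "form_of ` gens = insert (mon {}) (m2_generators :: 'a::field form set)"
proof -
  have "form_of ` wE ` w_sets = (w ` w_sets :: 'a form set)"
    unfolding image_image by (intro image_cong) (auto simp: form_of_wE w_sets_def)
  then show ?thesis
    unfolding gens_def m2_generators_def w_sets_def[symmetric] image_Un
    by (simp add: form_of_1 form_of_E times_ext.rep_eq minus_ext.rep_eq)
qed

text \<open>Separates the generators of degree at most 2 from the forms \<open>wE I\<close>, whose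
  degree is at least 3 as I is nonempty.\<close>

lemma gens_hom:
  fixes x :: "'a::field ext"
  assumes "x \<in> gens"
  obtains (low) q k where "q \<le> 2" "x \<in> hom q k"
  | (w) I where "I \<in> w_sets" "x = wE I" "x \<in> hom (card I + 2) (int (\<Sum>I) + 2 * int (Max I) + 3)"
proof -
  have EE: "E i * E j \<in> (hom (1 + 1) (int i + int j) :: 'a ext set)" for i j
    by (rule hom_mult[OF E_in_hom E_in_hom])
  consider "x = 1" | i where "x = E i" | "x = E 2 * E 3" | "x = E 3 * E 4 - E 2 * E 5"
    | I where "I \<in> w_sets" "x = wE I"
    using assms unfolding gens_def by blast
  then show thesis
  proof cases
    case 1
    then show thesis using low[of 0 0] Mon_in_hom[of "{}", where ?'a = 'a] by simp
  next
    case (2 i)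
    then show thesis using low[of 1 "int i"] E_in_hom[of i, where ?'a = 'a] by simp
  next
    case 3
    then show thesis
      using low[of 2 5] EE[of 2 3] by (simp add: numeral_2_eq_2)
  next
    case 4
    have "E 3 * E 4 \<in> (hom 2 7 :: 'a ext set)" "E 2 * E 5 \<in> (hom 2 7 :: 'a ext set)"
      using EE[of 3 4] EE[of 2 5] by (simp_all add: numeral_2_eq_2)
    then show thesis
      using low[of 2 7] 4 by (simp add: hom_diff)
  next
    case (5 I)
    have "x \<in> hom (card I + 2) (int (\<Sum>I) + 2 * int (Max I) + 3)"
      using W1_hom[OF Mon_in_hom, of I "Suc (Max I)", where ?'a = 'a]
      by (simp add: 5 wE_def algebra_simps)
    with 5 show thesis by (rule w)
  qed
qed

section \<open>From forms to cohomology classes\<close>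

lemma cocycles_gens: "x \<in> form_of ` gens \<Longrightarrow> x \<in> forms \<and> d (x :: 'a::field_char_0 form) = 0"
  using dE_gens form_of by (force simp: form_of_0 simp flip: form_of_dE)

lemma coh_class_fscale:
  "x \<in> forms \<Longrightarrow> d x = 0 \<Longrightarrow> coh_class (fscale c x) = hscale c (coh_class x)"
  by (simp add: hscale.abs_eq cohomologous_refl)

lemma coh_class_span:
  assumes S: "\<And>x. x \<in> S \<Longrightarrow> x \<in> forms \<and> d x = 0" and x: "x \<in> form.span S"
  shows "x \<in> forms \<and> d x = 0 \<and> coh_class x \<in> coh.span (coh_class ` S)"
  using x
proof (induction rule: form.span_induct_alt)
  case base
  then show ?case by (simp add: coh.span_zero flip: zero_H.abs_eq)
next
  case (step c x y)
  then have "coh_class (fscale c x + y) = hscale c (coh_class x) + coh_class y"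
    using S by (simp add: coh_class_add coh_class_fscale forms_fscale d_fscale)
  then show ?case
    using step S by (auto simp: forms_add forms_fscale d_add d_fscale
        intro!: coh.span_add coh.span_scale intro: coh.span_base)
qed

lemma form_of_span: "x \<in> ext.span S \<Longrightarrow> form_of x \<in> form.span (form_of ` S)"
  by (induction rule: ext.span_induct_alt)
     (auto simp: form_of_0 form.span_zero plus_ext.rep_eq scl.rep_eq
       intro!: form.span_add form.span_scale intro: form.span_base)

lemma cocycle_decomposition:
  fixes x :: "'a::field_char_0 form"
  assumes "x \<in> forms" "d x = 0"
  obtains y z where "x = y + d z" "y \<in> form.span (form_of ` gens)" "z \<in> forms"
proof -
  have x: "form_of (ext_of x) = x" using assms(1) by (rule ext_of_inverse)
  then have "form_of (dE (ext_of x)) = form_of 0"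
    using assms(2) by (simp add: form_of_dE form_of_0)
  then have "ext_of x \<in> gen_classes"
    by (intro cocycle_in_gen_classes) (simp add: form_of_inject)
  then obtain z where z: "ext_of x - dE z \<in> ext.span gens"
    by (auto simp: gen_classes_def)
  have "x = form_of (ext_of x - dE z) + d (form_of z)"
    by (simp add: minus_ext.rep_eq form_of_dE x)
  then show thesis
    using that form_of_span[OF z] form_of by blast
qed

lemma span_gens: "coh.span (coh_class ` form_of ` gens) = (UNIV :: 'a::field_char_0 H set)"
proof (intro equalityI subsetI)
  fix h :: "'a H"
  have "\<exists>x. cohomologous x x \<and> coh_class x = h"
    using Quotient3_abs_rep[OF Quotient3_H] Quotient3_rep_reflp[OF Quotient3_H] by blast
  then obtain x where x: "x \<in> forms" "d x = 0" "h = coh_class x"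
    by (auto simp: cohomologous_def)
  then obtain y z where yz: "x = y + d z" "y \<in> form.span (form_of ` gens)" "z \<in> forms"
    using cocycle_decomposition by blast
  note y = coh_class_span[OF cocycles_gens yz(2)]
  have "coh_class x = coh_class y"
    using x y yz by (subst coh_class_eq_iff_cohomologous) auto
  then show "h \<in> coh.span (coh_class ` form_of ` gens)"
    using x(3) y by simp
qed simp

text \<open>The generators of degree at most 2 have no component here, and each \<open>wE I\<close>
  is bihomogeneous, so it survives or vanishes as a whole.\<close>

lemma hom_part_span_gens:
  assumes q: "3 \<le> q" and y: "y \<in> form.span (form_of ` gens)"
  shows "hom_part q k y \<in> form.span (form_of ` wE ` w_index q k)"
  using y
proof (induction rule: form.span_induct_alt)
  case base
  then show ?case by (simp add: hom_part_def form.span_zero)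
next
  case (step c x y)
  from step(1) obtain x' where x': "x = form_of x'" "x' \<in> gens" by blast
  have "hom_part q k x \<in> form.span (form_of ` wE ` w_index q k)"
    using x'(2)
  proof (cases rule: gens_hom)
    case (low q' k')
    then show ?thesis
      using q hom_part_other[of x q' k' q k] by (simp add: x' hom_def form.span_zero)
  next
    case (w I)
    show ?thesis
    proof (cases "I \<in> w_index q k")
      case True
      then have "x \<in> \<Lambda> q k"
        using w(3) by (auto simp: x' hom_def w_index_def)
      then have "hom_part q k x = x" by (rule hom_part_id)
      then show ?thesis
        using True by (auto simp: x' w(2) intro: form.span_base)
    next
      case False
      then have "(q, k) \<noteq> (card I + 2, int (\<Sum>I) + 2 * int (Max I) + 3)"
        using w(1) by (auto simp: w_index_def)
      then show ?thesis
        using hom_part_other[of x] w(3) by (simp add: x' hom_def form.span_zero del: of_nat_sum)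
    qed
  qed
  then show ?case
    using step by (simp add: hom_part_def lin_ext_add lin_ext_fscale form.span_add form.span_scale)
qed

section \<open>The dimension of the bihomogeneous components\<close>

lemma finite_w_index: "finite (w_index q k)"
proof (rule finite_subset)
  show "w_index q k \<subseteq> Pow {..nat k}"
  proof
    fix I
    assume I: "I \<in> w_index q k"
    then have "finite I" "int (\<Sum>I) \<le> k" by (auto simp: w_index_def w_sets_def)
    have "i \<le> \<Sum>I" if "i \<in> I" for i
      using member_le_sum[of i I "\<lambda>i. i"] that \<open>finite I\<close> by simp
    then have "i \<le> nat k" if "i \<in> I" for i
      using that \<open>int (\<Sum>I) \<le> k\<close> by (fastforce simp del: of_nat_sum)
    then show "I \<in> Pow {..nat k}" by auto
  qed
qed simp

text \<open>The classes of the forms \<open>wE I\<close> are a basis: they span by taking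
  bihomogeneous parts of the decomposition of a cocycle, and the coordinates
  \<open>top_ext J\<close> show independence modulo coboundaries.\<close>

lemma hom_H_dim:
  assumes q: "3 \<le> q"
  shows "coh.dim (hom_H q k :: 'a::field_char_0 H set) = card (w_index q k)"
proof -
  let ?w = "\<lambda>I. form_of (wE I) :: 'a form"
  let ?B = "(\<lambda>I. coh_class (?w I)) ` w_index q k"
  have wE: "?w I \<in> hom_cocycles q k" if "I \<in> w_index q k" for I
  proof -
    have "I \<in> w_sets" using that by (simp add: w_index_def)
    then have "wE I \<in> (gens :: 'a ext set)"
      by (simp add: gens_def)
    then have "d (?w I) = 0" using cocycles_gens by blast
    moreover have "?w I \<in> \<Lambda> q k"
      using that W1_hom[OF Mon_in_hom, of I "Suc (Max I)", where ?'a = 'a]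
      by (auto simp: wE_def hom_def w_index_def algebra_simps)
    ultimately show ?thesis by (simp add: hom_cocycles_def)
  qed
  then have wE': "?w I \<in> forms \<and> d (?w I) = 0" if "I \<in> w_index q k" for I
    using that by (auto simp: hom_cocycles_def form_of)
  \<comment> \<open>Comparing coefficients at \<open>top_ext J\<close> removes the coboundary and
    isolates \<open>c J\<close>.\<close>
  have not_exact: "c J = 0"
    if J: "J \<in> w_index q k" and exact: "(\<Sum>I\<in>w_index q k. fscale (c I) (?w I)) \<in> d ` forms" for c J
  proof -
    from exact obtain z where z: "z \<in> forms" "(\<Sum>I\<in>w_index q k. fscale (c I) (?w I)) = d z" by blast
    then have dz: "d z = form_of (dE (ext_of z))"
      by (simp add: form_of_dE ext_of_inverse)
    have sets: "I \<in> w_sets" if "I \<in> w_index q k" for I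
      using that by (simp add: w_index_def)
    have "0 = (\<Sum>I\<in>w_index q k. c I * coef (wE I) (top_ext J))"
      using arg_cong[OF z(2), of "\<lambda>x. Poly_Mapping.lookup x (top_ext J)"]
        coef_dE_top_ext[OF sets[OF J], of "ext_of z"]
      by (simp add: dz lookup_sum coef.rep_eq)
    also have "\<dots> = (\<Sum>I\<in>w_index q k. if I = J then c J else 0)"
      using sets J by (intro sum.cong) (auto simp: coef_wE)
    also have "\<dots> = c J"
      using J finite_w_index by (simp add: sum.delta)
    finally show ?thesis ..
  qed
  \<comment> \<open>Independence concerns a set of classes, so distinct labels must first be shown
    to give distinct classes.\<close>
  have inj: "inj_on (\<lambda>I. coh_class (?w I)) (w_index q k)"
  proof (rule inj_onI, rule ccontr)
    fix I J
    assume IJ: "I \<in> w_index q k" "J \<in> w_index q k" "coh_class (?w I) = coh_class (?w J)" "I \<noteq> J"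
    let ?c = "\<lambda>K. if K = I then 1 else if K = J then - 1 else 0 :: 'a"
    have "(\<Sum>K\<in>w_index q k. fscale (?c K) (?w K)) =
        (\<Sum>K\<in>w_index q k. (if K = I then ?w K else 0) - (if K = J then ?w K else 0))"
      using IJ(4) by (intro sum.cong) auto
    also have "\<dots> = ?w I - ?w J"
      using IJ finite_w_index by (simp add: sum_subtractf sum.delta)
    also have "\<dots> \<in> d ` forms"
      using IJ wE' coh_class_eq_iff_cohomologous by blast
    finally show False
      using not_exact[OF IJ(1), of ?c] by simp
  qed
  have indep: "coh.independent ?B"
  proof (rule coh.independent_if_scalars_zero)
    show "finite ?B" using finite_w_index by blast
    fix f x
    assume sum: "(\<Sum>x\<in>?B. hscale (f x) x) = 0" and "x \<in> ?B"
    then obtain J where J: "J \<in> w_index q k" "x = coh_class (?w J)" by blast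
    let ?c = "\<lambda>I. f (coh_class (?w I))"
    let ?s = "\<Sum>I\<in>w_index q k. fscale (?c I) (?w I)"
    have s: "?s \<in> forms \<and> d ?s = 0 \<and> coh_class ?s = (\<Sum>I\<in>w_index q k. coh_class (fscale (?c I) (?w I)))"
      using wE' by (intro coh_class_sum finite_w_index) (simp add: forms_fscale d_fscale)
    also have "(\<Sum>I\<in>w_index q k. coh_class (fscale (?c I) (?w I))) = (\<Sum>x\<in>?B. hscale (f x) x)"
      using wE' by (simp add: sum.reindex[OF inj] coh_class_fscale)
    finally have "coh_class ?s = coh_class 0"
      using s sum by (simp add: zero_H.abs_eq)
    then have "?s \<in> d ` forms"
      using s coh_class_eq_iff_cohomologous[of ?s 0] by simp
    then show "f x = 0"
      using not_exact[OF J(1), of ?c] J(2) by simp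
  qed
  have "?B \<subseteq> hom_H q k"
    using wE by (auto simp: hom_H_def)
  moreover have "hom_H q k \<subseteq> coh.span ?B"
  proof
    fix h :: "'a H"
    assume "h \<in> hom_H q k"
    then obtain x where x: "x \<in> \<Lambda> q k" "d x = 0" "h = coh_class x"
      by (auto simp: hom_H_def hom_cocycles_def)
    then have xf: "x \<in> forms" using hom_forms_subset by blast
    then obtain y z where yz: "x = y + d z" "y \<in> form.span (form_of ` gens)" "z \<in> forms"
      using cocycle_decomposition x(2) by blast
    let ?y = "hom_part q k y"
    \<comment> \<open>As x is its own component of bidegree (q, k), y and \<open>d z\<close> may be
      replaced by theirs; \<open>Suc (q - 1)\<close> is q because q \<ge> 3.\<close>
    have "x = hom_part q k x" using x(1) by (simp add: hom_part_id)
    also have "\<dots> = ?y + hom_part (Suc (q - 1)) k (d z)"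
      using q by (simp add: yz(1) hom_part_def lin_ext_add)
    also have "\<dots> = ?y + d (hom_part (q - 1) k z)"
      by (simp only: hom_part_d(1)[OF yz(3)])
    finally have x_eq: "x = ?y + d (hom_part (q - 1) k z)" .
    have "?y \<in> forms \<and> d ?y = 0 \<and> coh_class ?y \<in> coh.span (coh_class ` form_of ` wE ` w_index q k)"
      using wE' by (intro coh_class_span hom_part_span_gens q yz(2)) auto
    moreover have "x - ?y \<in> d ` forms"
      using x_eq hom_part_in_hom_forms[of "q - 1" k z] hom_forms_subset[of "q - 1" k]
      by (metis add_diff_cancel_left' image_eqI subsetD)
    ultimately show "h \<in> coh.span ?B"
      using x xf coh_class_eq_iff_cohomologous[of x ?y] by (simp add: image_image)
  qed
  ultimately have "coh.span ?B = coh.span (hom_H q k)"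
    by (metis coh.span_mono coh.span_span subset_antisym)
  then have "coh.dim (hom_H q k :: 'a H set) = card ?B"
    using indep by (rule coh.dim_eq_card)
  then show ?thesis
    by (simp add: card_image[OF inj])
qed

theorem theorem5p5:
  shows "(\<forall>x \<in> (m2_generators :: 'a::field_char_0 form set). \<exists>q k. x \<in> hom_cocycles q k)
    \<and> coh.span (coh_class ` insert (mon {}) (m2_generators :: 'a form set)) = (UNIV :: 'a H set)
    \<and> (\<forall>q::nat. \<forall>k::int. 3 \<le> q \<longrightarrow>
        int (coh.dim (hom_H q (k + int (q * (q + 3) div 2)) :: 'a H set)) =
          int (parts q k) - int (parts q (k - 1)) - int (parts q (k - 2)) + int (parts q (k - 3)))"
proof (intro conjI ballI allI impI)
  fix x :: "'a form"
  assume "x \<in> m2_generators"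
  then obtain x' where x': "x = form_of x'" "x' \<in> gens"
    using form_of_gens by blast
  have "\<exists>q k. x' \<in> hom q k"
    using x'(2) by (cases rule: gens_hom) blast+
  then show "\<exists>q k. x \<in> hom_cocycles q k"
    using x' cocycles_gens by (auto simp: hom_def hom_cocycles_def)
next
  show "coh.span (coh_class ` insert (mon {}) (m2_generators :: 'a form set)) = (UNIV :: 'a H set)"
    unfolding form_of_gens[symmetric] by (rule span_gens)
next
  fix q :: nat and k :: int
  assume "3 \<le> q"
  then show "int (coh.dim (hom_H q (k + int (q * (q + 3) div 2)) :: 'a H set)) =
      int (parts q k) - int (parts q (k - 1)) - int (parts q (k - 2)) + int (parts q (k - 3))"
    by (simp only: hom_H_dim card_w_index_parts)
qed

end
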